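(* Let $G$ be a finite group such that $\varphi(S)\neq 0$ for every subgroup $S$ of $G$. Then the following are equivalent: (i) for all subgroups $H,K\leq G$, $H\subseteq K$ implies $\varphi(H)\mid\varphi(K)$; (ii) $G$ is nilpotent and each of its Sylow subgroups is either cyclic, or isomorphic to the quaternion group $Q_8$, or isomorphic to $\mathbb{Z}_p\times\mathbb{Z}_p$ for some prime $p$.
   Context: For a finite group $G$, $\varphi(G)=|\{a\in G \mid o(a)=\exp(G)\}|$, where $o(a)$ is the order of the element $a$ in $G$ and $\exp(G)$ is the exponent of $G$ (the least common multiple of the orders of its elements). $\mathbb{Z}_n$ denotes the cyclic group of order $n$, and $Q_8$ the quaternion group of order $8$. *)

theory Defs
  imports "HOL-Algebra.Algebra"
begin

definition group_exponent :: "('a, 'b) monoid_scheme \<Rightarrow> nat"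
  where "group_exponent G = Lcm (group.ord G ` carrier G)"

definition num_exp_elems :: "('a, 'b) monoid_scheme \<Rightarrow> nat"  (\<open>\<phi>\<close>)
  where "\<phi> G = card {a \<in> carrier G. group.ord G a = group_exponent G}"

text \<open>
  Nilpotent means that there is a central series
  \<open>{1} = N 0 \<subseteq> N 1 \<subseteq> \<dots> \<subseteq> N n = G\<close> of normal subgroups. The commutator condition says that
  \<open>N (i+1) / N i\<close> lies in the center of \<open>G / N i\<close>.
\<close>
definition nilpotent_group :: "('a, 'b) monoid_scheme \<Rightarrow> bool"
  where "nilpotent_group G \<longleftrightarrow> group G \<and>
    (\<exists>(N :: nat \<Rightarrow> 'a set) n.
       N 0 = {\<one>\<^bsub>G\<^esub>} \<and> N n = carrier G \<and>
       (\<forall>i\<le>n. N i \<lhd> G) \<and>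
       (\<forall>i<n. N i \<subseteq> N (Suc i) \<and>
         (\<forall>x\<in>N (Suc i). \<forall>g\<in>carrier G.
            x \<otimes>\<^bsub>G\<^esub> g \<otimes>\<^bsub>G\<^esub> inv\<^bsub>G\<^esub> x \<otimes>\<^bsub>G\<^esub> inv\<^bsub>G\<^esub> g \<in> N i)))"

text \<open>For a prime \<open>p\<close> not dividing the order of \<open>G\<close>, this is the trivial subgroup.\<close>
definition sylow_subgroup :: "('a, 'b) monoid_scheme \<Rightarrow> nat \<Rightarrow> 'a set \<Rightarrow> bool"
  where "sylow_subgroup G p P \<longleftrightarrow>
    Factorial_Ring.prime p \<and> subgroup P G \<and> card P = p ^ multiplicity p (order G)"

text \<open>
  \<open>(a, b, c, d)\<close> stands for the quaternion \<open>a + b i + c j + d k\<close>; the carrier of \<open>Q8\<close> is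
  \<open>{\<plusminus>1, \<plusminus>i, \<plusminus>j, \<plusminus>k}\<close>.
\<close>
fun quat_mult :: "int \<times> int \<times> int \<times> int \<Rightarrow> int \<times> int \<times> int \<times> int \<Rightarrow> int \<times> int \<times> int \<times> int"
  where "quat_mult (a, b, c, d) (a', b', c', d') =
    (a * a' - b * b' - c * c' - d * d',
     a * b' + b * a' + c * d' - d * c',
     a * c' - b * d' + c * a' + d * b',
     a * d' + b * c' - c * b' + d * a')"

definition Q8 :: "(int \<times> int \<times> int \<times> int) monoid"
  where "Q8 = \<lparr>carrier =
      {(1, 0, 0, 0), (-1, 0, 0, 0), (0, 1, 0, 0), (0, -1, 0, 0),
       (0, 0, 1, 0), (0, 0, -1, 0), (0, 0, 0, 1), (0, 0, 0, -1)},
    monoid.mult = quat_mult, one = (1, 0, 0, 0)\<rparr>"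

lemma order_Q8: "order Q8 = 8"
  by (simp add: order_def Q8_def)

lemma group_Q8: "group Q8"
proof (rule groupI)
  fix x assume "x \<in> carrier Q8"
  then show "\<exists>y\<in>carrier Q8. y \<otimes>\<^bsub>Q8\<^esub> x = \<one>\<^bsub>Q8\<^esub>"
    by (auto simp: Q8_def)
next
  fix x y z :: "int \<times> int \<times> int \<times> int"
  show "x \<otimes>\<^bsub>Q8\<^esub> y \<otimes>\<^bsub>Q8\<^esub> z = x \<otimes>\<^bsub>Q8\<^esub> (y \<otimes>\<^bsub>Q8\<^esub> z)"
    by (cases x; cases y; cases z) (simp add: Q8_def algebra_simps)
qed (auto simp: Q8_def)

end

theory Submission
  imports Defs "HOL-Number_Theory.Totient"
begin

text \<open>
  The direction from \<open>\<phi>\<close>-divisibility starts with \<open>p\<close>-subgroups. A minimal noncyclic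
  \<open>p\<close>-group is \<open>\<int>\<^sub>p \<times> \<int>\<^sub>p\<close> or \<open>Q\<^sub>8\<close>. If such a subgroup \<open>R\<close> lies in a larger \<open>p\<close>-subgroup, it has
  index \<open>p\<close> in some subgroup \<open>F\<close>, and the divisors of \<open>\<phi>(F)\<close> coming from \<open>R\<close> and from a cyclic subgroup
  are too many for the few elements of maximal order in \<open>F\<close>. Hence every \<open>p\<close>-subgroup is cyclic, \<open>\<int>\<^sub>p \<times> \<int>\<^sub>p\<close> or \<open>Q\<^sub>8\<close>.

  A finite group is nilpotent if and only if elements of coprime orders commute. If all proper subgroups
  of \<open>S\<close> have this property, then \<open>S\<close> has a normal maximal subgroup, so that a counterexample would be
  \<open>S = Q\<langle>b\<rangle>\<close> with a normal Sylow subgroup \<open>Q\<close> and \<open>b\<close> of prime power order. An element of order \<open>exp(S)\<close>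
  splits as \<open>y u\<close>, where \<open>y\<close> generates a complement of \<open>Q\<close> and centralizes \<open>u \<in> Q\<close> of order \<open>exp(Q)\<close>; for the
  three types of \<open>Q\<close> this forces \<open>y\<close> to centralize \<open>Q\<close>.

  Conversely, when elements of coprime orders commute, \<open>\<phi>\<close> is the product of its values on
  the Sylow subgroups, and divisibility is checked for each of the three types.
\<close>

section \<open>Finite groups, orders and cyclic subgroups\<close>

hide_const (open) Divisibility.prime

text \<open>The hypothesis gives no normal subgroup to start from, so a smallest group with
  noncommuting elements of coprime orders must first be shown to have one. This is the classical
  counting argument for groups whose proper subgroups are all nilpotent (Schmidt); its only input
  from the proper subgroups is that normalizers grow there.

  The nonvanishing of \<phi> enters twice: it turns divisibility into an inequality, which bounds
  \<open>euler F\<close> from below, and it supplies in every subgroup one element whose order is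
  the whole exponent. The second use produces a complement that centralizes an element of largest
  order in the normal Sylow subgroup.

  The quaternion group appears in two forms. Generators and relations (\<open>quaternionic\<close>)
  are what the analysis of minimal noncyclic groups delivers; order, exponent and the number of
  involutions (\<open>quaternion_like\<close>) pass along isomorphisms and are what counting uses.
  Everything is phrased for subsets of one fixed group, so that orders and exponents of different
  subgroups can be compared directly.\<close>

lemma coprime_prime_powers:
  fixes p q :: nat
  assumes "prime p" "prime q" "p \<noteq> q"
  shows "coprime (p ^ i) (q ^ j)"
  using assms by (simp add: primes_coprime_nat coprime_power_left_iff coprime_power_right_iff)

locale finite_group = group G for G (structure) +
  assumes finite_carrier: "finite (carrier G)"
begin

lemma finite_subgroup: "subgroup H G \<Longrightarrow> finite H"
  using finite_carrier finite_subset subgroup.subset by blast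

lemma sub_mem: "subgroup H G \<Longrightarrow> x \<in> H \<Longrightarrow> x \<in> carrier G"
  using subgroup.subset by blast

lemma ord_pos: "x \<in> carrier G \<Longrightarrow> 0 < ord x"
  using finite_carrier ord_ge_1 by (metis less_eq_Suc_le One_nat_def)

lemma pow_mem: "subgroup H G \<Longrightarrow> x \<in> H \<Longrightarrow> x [^] (n::nat) \<in> H"
  by (induction n) (auto simp: subgroup.one_closed subgroup.m_closed)

lemma ord_sub:
  assumes "subgroup H G" "x \<in> H"
  shows "group.ord (G\<lparr>carrier := H\<rparr>) x = ord x"
proof -
  interpret H: group "G\<lparr>carrier := H\<rparr>" using assms by (simp add: subgroup_imp_group)
  have "H.ord x = ord x \<longleftrightarrow> (\<forall>n. x [^]\<^bsub>G\<lparr>carrier := H\<rparr>\<^esub> n = \<one>\<^bsub>G\<lparr>carrier := H\<rparr>\<^esub> \<longleftrightarrow> ord x dvd n)"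
    by (rule H.ord_unique) (use assms in simp)
  then show ?thesis
    using assms sub_mem[OF assms] by (simp add: pow_eq_id flip: nat_pow_consistent)
qed

lemma card_sub_dvd:
  assumes "subgroup H G" "subgroup K G" "H \<subseteq> K"
  shows "card H dvd card K"
proof -
  interpret K: group "G\<lparr>carrier := K\<rparr>" using assms by (simp add: subgroup_imp_group)
  show ?thesis
    using K.lagrange[OF subgroup_incl[OF assms]] by (simp add: order_def) (metis dvd_triv_right)
qed

lemma card_sub_pos: "subgroup H G \<Longrightarrow> 0 < card H"
  using finite_carrier subgroup.finite_imp_card_positive by blast

lemma ord_dvd_card: "subgroup H G \<Longrightarrow> x \<in> H \<Longrightarrow> ord x dvd card H"
proof -
  assume a: "subgroup H G" "x \<in> H"
  interpret H: group "G\<lparr>carrier := H\<rparr>" using a by (simp add: subgroup_imp_group)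
  show ?thesis
    using H.ord_dvd_group_order[of x] a by (simp add: ord_sub order_def)
qed

text \<open>In a finite group the inverse of \<open>a\<close> is the power
  \<open>a [^] (ord a - 1)\<close>, so closure under products already gives inverses.\<close>

lemma closed_imp_subgroup:
  assumes "S \<subseteq> carrier G" "\<one> \<in> S" "\<And>x y. x \<in> S \<Longrightarrow> y \<in> S \<Longrightarrow> x \<otimes> y \<in> S"
  shows "subgroup S G"
proof (rule subgroupI)
  fix a assume a: "a \<in> S"
  then have ac: "a \<in> carrier G" using assms by blast
  have pw: "a [^] (n::nat) \<in> S" for n
    by (induction n) (use a assms in auto)
  have "a \<otimes> a [^] (ord a - 1) = a [^] (Suc (ord a - 1))"
    using ac by (simp only: nat_pow_Suc2)
  also have "\<dots> = \<one>" using ord_pos[OF ac] ac by simp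
  finally have "inv a = a [^] (ord a - 1)"
    using ac by (metis inv_equality inv_comm nat_pow_closed)
  then show "inv a \<in> S" using pw by simp
qed (use assms in auto)

lemma cyc_eq: "a \<in> carrier G \<Longrightarrow> generate G {a} = range (\<lambda>n::nat. a [^] n)"
  using generate_pow_nat[of a] ord_pos[of a] by (auto simp: full_SetCompr_eq)

abbreviation cyc :: "'a \<Rightarrow> 'a set" where "cyc a \<equiv> generate G {a}"

lemma cyc_subgroup: "a \<in> carrier G \<Longrightarrow> subgroup (cyc a) G"
  by (simp add: generate_is_subgroup)

lemma cyc_memI: "a \<in> carrier G \<Longrightarrow> a [^] (n::nat) \<in> cyc a"
  by (simp add: cyc_eq)

lemma cyc_self: "a \<in> carrier G \<Longrightarrow> a \<in> cyc a"
  using cyc_memI[of a 1] by simp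

lemma cyc_memE: "a \<in> carrier G \<Longrightarrow> x \<in> cyc a \<Longrightarrow> \<exists>n::nat. x = a [^] n"
  by (auto simp: cyc_eq)

lemma card_cyc: "a \<in> carrier G \<Longrightarrow> card (cyc a) = ord a"
  using generate_pow_card by simp

lemma cyc_sub: "subgroup H G \<Longrightarrow> a \<in> H \<Longrightarrow> cyc a \<subseteq> H"
  by (simp add: generate_subgroup_incl)

lemma cyc_eq_if_ord: "subgroup H G \<Longrightarrow> a \<in> H \<Longrightarrow> ord a = card H \<Longrightarrow> H = cyc a"
  by (metis card_cyc card_subset_eq cyc_sub finite_subgroup sub_mem)

lemma cyc_comm: "a \<in> carrier G \<Longrightarrow> x \<in> cyc a \<Longrightarrow> y \<in> cyc a \<Longrightarrow> x \<otimes> y = y \<otimes> x"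
  by (metis cyc_memE nat_pow_comm)

text \<open>With \<open>n = ord a\<close>, the power \<open>a [^] k\<close> has order
  \<open>n div gcd k n\<close>. Elements of order \<open>d\<close> thus correspond to exponents with
  \<open>gcd k n = n div d\<close>, which a totient counts.\<close>

lemma ord_count_cyc:
  assumes a: "a \<in> carrier G" and d: "d dvd ord a"
  shows "card {x \<in> cyc a. ord x = d} = totient d"
proof -
  let ?n = "ord a"
  have n: "0 < ?n" using a by (rule ord_pos)
  have inj: "inj_on (\<lambda>k. a [^] k) {0<..?n}"
    using ord_inj'[OF a] by (simp add: atLeastSucAtMost_greaterThanAtMost)
  have img: "(\<lambda>k. a [^] k) ` {0<..?n} = cyc a"
  proof (rule card_subset_eq)
    show "finite (cyc a)" using a cyc_subgroup finite_subgroup by blast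
    show "(\<lambda>k. a [^] k) ` {0<..?n} \<subseteq> cyc a" using a cyc_memI by auto
    show "card ((\<lambda>k. a [^] k) ` {0<..?n}) = card (cyc a)"
      using card_image[OF inj] a by (simp add: card_cyc)
  qed
  have "{x \<in> cyc a. ord x = d} = (\<lambda>k. a [^] k) ` {k \<in> {0<..?n}. gcd k ?n = ?n div d}"
  proof -
    have "ord (a [^] k) = d \<longleftrightarrow> gcd k ?n = ?n div d" if "k \<in> {0<..?n}" for k
    proof -
      have o: "ord (a [^] k) = ?n div gcd k ?n"
        using ord_pow_gen[OF a, of k] that by (simp add: gcd.commute)
      have "?n div gcd k ?n = d \<longleftrightarrow> gcd k ?n = ?n div d"
      proof
        assume "?n div gcd k ?n = d"
        then have "?n div d = ?n div (?n div gcd k ?n)" by simp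
        also have "\<dots> = gcd k ?n"
        proof -
          obtain t where t: "?n = gcd k ?n * t" by (meson dvdE gcd_dvd2)
          have "0 < gcd k ?n" "0 < t" using n t by (auto intro: gr0I)
          then show ?thesis by (subst (1 2) t) simp
        qed
        finally show "gcd k ?n = ?n div d" by simp
      next
        assume "gcd k ?n = ?n div d"
        then have "?n div gcd k ?n = ?n div (?n div d)" by simp
        also have "\<dots> = d" using n d by (auto elim!: dvdE)
        finally show "?n div gcd k ?n = d" .
      qed
      then show ?thesis using o by simp
    qed
    then have eq: "{k \<in> {0<..?n}. gcd k ?n = ?n div d} = {k \<in> {0<..?n}. ord (a [^] k) = d}" by blast
    show ?thesis unfolding img[symmetric] eq by auto
  qed
  then have "card {x \<in> cyc a. ord x = d} = card {k \<in> {0<..?n}. gcd k ?n = ?n div d}"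
    using inj by (metis (no_types, lifting) card_image inj_on_subset mem_Collect_eq subsetI)
  also have "\<dots> = totient (?n div (?n div d))"
    by (rule card_gcd_eq_totient) (use n d in auto)
  also have "?n div (?n div d) = d" using d n by (auto elim!: dvdE)
  finally show ?thesis .
qed

lemma ord_commuting_coprime:
  assumes "x \<in> carrier G" "y \<in> carrier G" "x \<otimes> y = y \<otimes> x" "coprime (ord x) (ord y)"
  shows "ord (x \<otimes> y) = ord x * ord y"
proof (rule dvd_antisym)
  let ?k = "ord (x \<otimes> y)"
  show "?k dvd ord x * ord y" using assms(1-3) by (intro ord_mul_divides)
  have k: "x [^] ?k \<otimes> y [^] ?k = \<one>"
    using assms by (metis m_closed pow_mult_distrib pow_ord_eq_1)
  have "x [^] (?k * ord y) = \<one>"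
  proof -
    have "\<one> = (x \<otimes> y) [^] (?k * ord y)" using assms by (simp flip: nat_pow_pow)
    also have "\<dots> = x [^] (?k * ord y) \<otimes> y [^] (?k * ord y)" using assms(1-3) by (intro pow_mult_distrib)
    also have "y [^] (?k * ord y) = \<one>" using assms by (simp add: pow_eq_id)
    finally show ?thesis using assms by simp
  qed
  then have "ord x dvd ?k" using assms by (simp add: pow_eq_id coprime_dvd_mult_left_iff)
  moreover have "y [^] (?k * ord x) = \<one>"
  proof -
    have "\<one> = (x \<otimes> y) [^] (?k * ord x)" using assms by (simp flip: nat_pow_pow)
    also have "\<dots> = x [^] (?k * ord x) \<otimes> y [^] (?k * ord x)" using assms(1-3) by (intro pow_mult_distrib)
    also have "x [^] (?k * ord x) = \<one>" using assms by (simp add: pow_eq_id)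
    finally show ?thesis using assms by simp
  qed
  then have "ord y dvd ?k" using assms by (simp add: pow_eq_id coprime_dvd_mult_left_iff coprime_commute)
  ultimately show "ord x * ord y dvd ?k" using assms by (simp add: divides_mult)
qed

lemma pow_mod_ord: "a \<in> carrier G \<Longrightarrow> a [^] (n mod ord a) = a [^] (n::nat)"
proof -
  assume a: "a \<in> carrier G"
  have "a [^] n = a [^] (ord a * (n div ord a) + n mod ord a)" by simp
  also have "\<dots> = (a [^] ord a) [^] (n div ord a) \<otimes> a [^] (n mod ord a)"
    using a by (simp add: nat_pow_mult nat_pow_pow del: pow_ord_eq_1 mult_div_mod_eq)
  finally show ?thesis using a by simp
qed

text \<open>The exponents come from the Chinese remainder theorem: \<open>u\<close> is 1 modulo
  \<open>m\<close> and 0 modulo \<open>n\<close>, and \<open>v\<close> the reverse. As powers of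
  \<open>a\<close>, the two parts commute and stay in every subgroup that contains
  \<open>a\<close>.\<close>

lemma split_coprime:
  assumes a: "a \<in> carrier G" and o: "ord a = m * n" and c: "coprime m n"
  shows "\<exists>(u::nat) (v::nat). a = a [^] u \<otimes> a [^] v \<and> ord (a [^] u) = m \<and> ord (a [^] v) = n"
proof -
  have mn: "m * n > 0" using ord_pos[OF a] o by simp
  obtain u where u: "[u = 1] (mod m)" "[u = 0] (mod n)"
    using binary_chinese_remainder_nat[OF c] by blast
  obtain v where v: "[v = 0] (mod m)" "[v = 1] (mod n)"
    using binary_chinese_remainder_nat[OF c] by blast
  have gen: "ord (a [^] w) = k"
    if w: "[w = 1] (mod k)" "[w = 0] (mod l)" and kl: "k * l = m * n" and ckl: "coprime k l" for w k l :: nat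
  proof (cases "w = 0")
    case True
    then have "k dvd 1" using w(1) cong_0_iff cong_sym by blast
    then show ?thesis using True by simp
  next
    case False
    obtain t where t: "w = l * t" using w(2) by (auto simp: cong_0_iff)
    have "coprime k w" using w(1) by (metis cong_imp_coprime cong_sym coprime_1_left coprime_commute)
    then have "coprime k t" using t by simp
    then have g: "gcd (k * l) w = l" unfolding t
      by (metis coprime_iff_gcd_eq_1 gcd_mult_distrib_nat mult.commute nat_mult_1_right)
    have "0 < l" using kl mn by (metis gr0I mult_0_right less_numeral_extra(3))
    then show ?thesis using ord_pow_gen[OF a, of w] g o False kl by (metis nonzero_mult_div_cancel_right less_numeral_extra(3))
  qed
  have "[u + v = 1] (mod m)" "[u + v = 1] (mod n)"
    using cong_add[OF u(1) v(1)] cong_add[OF u(2) v(2)] by simp_all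
  then have "[u + v = 1] (mod (m * n))" using c by (simp add: coprime_cong_mult_nat)
  then have "a [^] (u + v) = a [^] (1::nat)"
    using pow_mod_ord[OF a] unfolding cong_def o by metis
  then have "a = a [^] u \<otimes> a [^] v" using a by (simp add: nat_pow_mult)
  moreover have "ord (a [^] u) = m" by (rule gen[of u m n]) (use u c in auto)
  moreover have "ord (a [^] v) = n" by (rule gen[of v n m]) (use v c in \<open>auto simp: coprime_commute mult.commute\<close>)
  ultimately show ?thesis by blast
qed

end

section \<open>Normalizers in p-groups\<close>

text \<open>Orbits have \<open>p\<close>-power size, so those that are not fixed points contribute
  multiples of \<open>p\<close> to \<open>card E\<close>; a single fixed point would leave the
  remainder 1.\<close>

lemma second_fixed_point:
  assumes act: "group_action G E f"
    and p: "prime (p::nat)" and o: "order G = p ^ n" and fin: "finite E" and dvd: "p dvd card E"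
    and x: "x \<in> E" "\<And>g. g \<in> carrier G \<Longrightarrow> f g x = x"
  shows "\<exists>y\<in>E. y \<noteq> x \<and> (\<forall>g\<in>carrier G. f g y = y)"
proof (rule ccontr)
  interpret group_action G E f by fact
  assume neg: "\<not> ?thesis"
  have ox: "orbit G f x = {x}"
    using x orbit_refl[OF x(1)] by (auto simp: orbit_def)
  have big: "p dvd card R" if R: "R \<in> orbits G E f - {{x}}" for R
  proof -
    obtain y where y: "y \<in> E" "R = orbit G f y" using R by (auto simp: orbits_def)
    have "y \<noteq> x" using y R ox by auto
    then obtain g where g: "g \<in> carrier G" "f g y \<noteq> y" using neg y by blast
    have sub: "{y, f g y} \<subseteq> R" using y g orbit_refl[OF y(1)] by (auto simp: orbit_def)
    have "R \<subseteq> E" using y element_image by (auto simp: orbit_def)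
    then have "finite R" using fin finite_subset by blast
    then have "2 \<le> card R" using card_mono[OF _ sub] g by simp
    moreover have "card R dvd p ^ n"
      using orbit_stabilizer_theorem[OF y(1)] o y by (metis dvd_triv_left)
    then obtain k where "card R = p ^ k" using p by (metis divides_primepow_nat)
    ultimately show ?thesis by (cases k) auto
  qed
  have finO: "finite (orbits G E f)" using fin by (auto simp: orbits_def)
  have xO: "{x} \<in> orbits G E f" using ox x by (force simp: orbits_def)
  have "card E = (\<Sum>R\<in>orbits G E f. card R)"
    using disjoint_sum[OF fin, of "\<lambda>_. 1::nat"] by simp
  also have "\<dots> = 1 + (\<Sum>R\<in>orbits G E f - {{x}}. card R)"
    using finO xO by (simp add: sum.remove)
  finally have "card E = 1 + (\<Sum>R\<in>orbits G E f - {{x}}. card R)" .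
  moreover have "p dvd (\<Sum>R\<in>orbits G E f - {{x}}. card R)" using big by (rule dvd_sum)
  ultimately have "p dvd 1" using dvd by (metis dvd_add_left_iff)
  then show False using p by simp
qed

text \<open>The inverse turns right multiplication into a left action; the restriction makes the
  maps extensional, as membership in \<open>Bij\<close> demands.\<close>

lemma (in group) coset_action:
  assumes H: "subgroup H G"
  shows "group_action (G\<lparr>carrier := H\<rparr>) (rcosets H) (\<lambda>h. \<lambda>C\<in>rcosets H. C #> inv h)"
proof -
  have Hc: "H \<subseteq> carrier G" using H subgroup.subset by blast
  have cl: "C #> inv h \<in> rcosets H" if "C \<in> rcosets H" "h \<in> carrier G" for C h
    using that Hc by (auto simp: RCOSETS_def coset_mult_assoc)
  have as: "(C #> a) #> b = C #> (a \<otimes> b)" if "C \<in> rcosets H" "a \<in> carrier G" "b \<in> carrier G" for C a b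
    using that coset_mult_assoc subgroup.rcosets_carrier[OF H group_axioms] by blast
  have one: "C #> \<one> = C" if "C \<in> rcosets H" for C
    using that coset_mult_one subgroup.rcosets_carrier[OF H group_axioms] by blast
  have bij: "(\<lambda>C\<in>rcosets H. C #> inv h) \<in> Bij (rcosets H)" if h: "h \<in> H" for h
  proof -
    have hc: "h \<in> carrier G" using h Hc by blast
    have "bij_betw (\<lambda>C\<in>rcosets H. C #> inv h) (rcosets H) (rcosets H)"
    proof (rule bij_betw_byWitness[where f' = "\<lambda>C. C #> h"])
      show "\<forall>a\<in>rcosets H. (\<lambda>C\<in>rcosets H. C #> inv h) a #> h = a"
        using hc by (simp add: as one)
      show "\<forall>a'\<in>rcosets H. (\<lambda>C\<in>rcosets H. C #> inv h) (a' #> h) = a'"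
        using hc cl[of _ "inv h"] by (simp add: as one)
      show "(\<lambda>C\<in>rcosets H. C #> inv h) ` (rcosets H) \<subseteq> rcosets H" using cl hc by auto
      show "(\<lambda>C. C #> h) ` (rcosets H) \<subseteq> rcosets H" using cl[of _ "inv h"] hc by auto
    qed
    then show ?thesis by (simp add: Bij_def)
  qed
  have "(\<lambda>h. \<lambda>C\<in>rcosets H. C #> inv h) \<in> hom (G\<lparr>carrier := H\<rparr>) (BijGroup (rcosets H))"
  proof (rule homI)
    fix a b assume ab: "a \<in> carrier (G\<lparr>carrier := H\<rparr>)" "b \<in> carrier (G\<lparr>carrier := H\<rparr>)"
    then have ab': "a \<in> H" "b \<in> H" "a \<in> carrier G" "b \<in> carrier G" using Hc by auto
    show "(\<lambda>C\<in>rcosets H. C #> inv (a \<otimes>\<^bsub>G\<lparr>carrier := H\<rparr>\<^esub> b)) =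
       (\<lambda>C\<in>rcosets H. C #> inv a) \<otimes>\<^bsub>BijGroup (rcosets H)\<^esub> (\<lambda>C\<in>rcosets H. C #> inv b)"
      using ab' bij[OF ab'(1)] bij[OF ab'(2)] cl
      by (auto simp: BijGroup_def compose_def inv_mult_group as intro!: restrict_ext)
  qed (use bij in \<open>simp add: BijGroup_def\<close>)
  then show ?thesis
    by (simp add: group_action_def group_hom_def group_hom_axioms_def group_BijGroup subgroup_imp_group H)
qed

text \<open>\<open>H\<close> acts on its right cosets, whose number is divisible by
  \<open>p\<close>. The coset \<open>H\<close> is fixed, so a second coset \<open>H #> a\<close> is
  fixed too, which says exactly that conjugation by \<open>a\<close> maps \<open>H\<close> into
  itself.\<close>

lemma (in group) p_group_normalizer_growth:
  assumes p: "prime (p::nat)" and o: "card (carrier G) = p ^ n"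
    and H: "subgroup H G" "H \<noteq> carrier G"
  shows "\<exists>g\<in>carrier G - H. \<forall>h\<in>H. g \<otimes> h \<otimes> inv g \<in> H"
proof -
  interpret A: group_action "G\<lparr>carrier := H\<rparr>" "rcosets H" "\<lambda>h. \<lambda>C\<in>rcosets H. C #> inv h"
    using H(1) by (rule coset_action)
  have Hc: "H \<subseteq> carrier G" using H subgroup.subset by blast
  have fin: "finite (carrier G)" using o p by (metis card.infinite not_prime_0 power_not_zero)
  have lag: "card (rcosets H) * card H = p ^ n" using lagrange[OF H(1)] o by (simp add: order_def)
  then obtain m where m: "card H = p ^ m" using p by (metis divides_primepow_nat dvd_triv_right)
  obtain k where k: "card (rcosets H) = p ^ k" using lag p by (metis divides_primepow_nat dvd_triv_left)
  have "k \<noteq> 0"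
  proof
    assume "k = 0"
    then have "card H = card (carrier G)" using k lag o by simp
    then show False using H Hc fin card_subset_eq by blast
  qed
  then have pd: "p dvd card (rcosets H)" using k by simp
  have HE: "H \<in> rcosets H" using H(1) by (simp add: subgroup.subgroup_in_rcosets[OF _ is_group])
  have "\<exists>y\<in>rcosets H. y \<noteq> H \<and> (\<forall>g\<in>carrier (G\<lparr>carrier := H\<rparr>). (\<lambda>C\<in>rcosets H. C #> inv g) y = y)"
  proof (rule second_fixed_point[OF A.group_action_axioms p _ _ pd HE])
    show "order (G\<lparr>carrier := H\<rparr>) = p ^ m" using m by (simp add: order_def)
    show "finite (rcosets H)" using fin by (metis finite_Pow_iff finite_subset rcosets_subset_PowG H(1))
    show "(\<lambda>C\<in>rcosets H. C #> inv g) H = H" if "g \<in> carrier (G\<lparr>carrier := H\<rparr>)" for g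
      using that HE H(1) Hc by (simp add: coset_join2 subgroup.m_inv_closed subset_iff)
  qed
  then obtain y where y: "y \<in> rcosets H" "y \<noteq> H" "\<And>h. h \<in> H \<Longrightarrow> y #> inv h = y"
    by auto
  obtain a where a: "a \<in> carrier G" "y = H #> a" using y(1) by (auto simp: RCOSETS_def)
  have "a \<notin> H" using a y(2) H(1) coset_join2 by blast
  moreover have "a \<otimes> h \<otimes> inv a \<in> H" if h: "h \<in> H" for h
  proof -
    have hc: "h \<in> carrier G" using h Hc by blast
    have "y #> inv (inv h) = y" using y(3)[OF subgroup.m_inv_closed[OF H(1) h]] .
    then have "H #> (a \<otimes> h) = H #> a" using a hc Hc by (simp add: coset_mult_assoc)
    then have "a \<otimes> h \<in> H #> a" using rcos_self[of "a \<otimes> h" H] a hc H(1) by simp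
    then obtain h' where h': "h' \<in> H" "a \<otimes> h = h' \<otimes> a" by (auto simp: r_coset_def)
    then have "a \<otimes> h \<otimes> inv a = h'" using a hc Hc by (simp add: m_assoc subset_iff)
    then show ?thesis using h' by simp
  qed
  ultimately show ?thesis using a by blast
qed

context finite_group
begin

text \<open>Reduces membership in \<open>H\<close>, typically a centralizer, to powers of prime
  power order: any other order is a product of two smaller coprime factors, and
  \<open>split_coprime\<close> feeds an induction on the order.\<close>

lemma gen_prime_powers:
  assumes H: "subgroup H G" and "a \<in> carrier G"
    and "\<And>p n i. prime p \<Longrightarrow> ord (a [^] (n::nat)) = p ^ i \<Longrightarrow> a [^] n \<in> H"
  shows "a \<in> H"
  using assms(2,3)
proof (induction "ord a" arbitrary: a rule: less_induct)
  case less
  show ?case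
  proof (cases "\<exists>p i. prime p \<and> ord a = p ^ i")
    case True
    then show ?thesis using less.prems(1) less.prems(2)[of _ 1] by auto
  next
    case False
    \<comment> \<open>The order 1 counts as the prime power \<open>2 ^ 0\<close>.\<close>
    then have "ord a \<noteq> 1" using two_is_prime_nat by (metis power_0)
    then obtain p where p: "prime p" "p dvd ord a" using prime_factor_nat by blast
    have pos: "0 < ord a" using less.prems by (simp add: ord_pos)
    obtain m where m: "ord a = p ^ multiplicity p (ord a) * m" "\<not> p dvd m"
      using multiplicity_decompose'[of "ord a" p] pos p by (metis less_numeral_extra(3) not_prime_unit)
    let ?k = "p ^ multiplicity p (ord a)"
    have "?k \<noteq> 1" using p pos using prime_gt_1_nat[OF p(1)] by (simp add: prime_multiplicity_gt_zero_iff)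
    moreover have "m \<noteq> 1" using False m(1) p(1) by auto
    moreover have "?k * m > 0" using m(1) pos by simp
    ultimately have lt: "?k < ord a" "m < ord a" using m(1)
      by (metis One_nat_def gr_implies_not0 less_one linorder_neqE_nat mult.right_neutral mult_0_right n_less_m_mult_n n_less_n_mult_m nat_0_less_mult_iff)+
    have "coprime ?k m" using p(1) m(2) by (simp add: prime_imp_coprime coprime_power_left_iff)
    then obtain u v :: nat where uv: "a = a [^] u \<otimes> a [^] v" "ord (a [^] u) = ?k" "ord (a [^] v) = m"
      using split_coprime[OF less.prems(1) m(1)] by blast
    have "a [^] u \<in> H"
      using less.hyps[of "a [^] u"] lt uv less.prems by (simp add: nat_pow_pow)
    moreover have "a [^] v \<in> H"
      using less.hyps[of "a [^] v"] lt uv less.prems by (simp add: nat_pow_pow)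
    ultimately show ?thesis using uv(1) H by (metis subgroup.m_closed)
  qed
qed

text \<open>Only an inclusion is asked for; for finite \<open>H\<close> it is an equality, since
  conjugation is injective.\<close>

definition normalizes :: "'a \<Rightarrow> 'a set \<Rightarrow> bool"
  where "normalizes g H \<longleftrightarrow> (\<forall>h\<in>H. g \<otimes> h \<otimes> inv g \<in> H)"

lemma conj_mult: "a \<in> carrier G \<Longrightarrow> b \<in> carrier G \<Longrightarrow> h \<in> carrier G \<Longrightarrow>
    (a \<otimes> b) \<otimes> h \<otimes> inv (a \<otimes> b) = a \<otimes> (b \<otimes> h \<otimes> inv b) \<otimes> inv a"
  by (simp add: inv_mult_group m_assoc)

lemma conj_hom: "a \<in> carrier G \<Longrightarrow> h \<in> carrier G \<Longrightarrow> k \<in> carrier G \<Longrightarrow>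
    a \<otimes> (h \<otimes> k) \<otimes> inv a = (a \<otimes> h \<otimes> inv a) \<otimes> (a \<otimes> k \<otimes> inv a)"
  by (simp add: m_assoc inv_solve_left)

lemma conj_pow: "a \<in> carrier G \<Longrightarrow> h \<in> carrier G \<Longrightarrow>
    a \<otimes> h [^] (n::nat) \<otimes> inv a = (a \<otimes> h \<otimes> inv a) [^] n"
  by (induction n) (auto simp: conj_hom)

lemma ord_conj:
  assumes "a \<in> carrier G" "h \<in> carrier G" shows "ord (a \<otimes> h \<otimes> inv a) = ord h"
proof -
  have "(a \<otimes> h \<otimes> inv a) [^] n = \<one> \<longleftrightarrow> h [^] n = \<one>" for n :: nat
  proof -
    have "(a \<otimes> h \<otimes> inv a) [^] n = \<one> \<longleftrightarrow> a \<otimes> h [^] n \<otimes> inv a = \<one>" using assms by (simp add: conj_pow)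
    also have "\<dots> \<longleftrightarrow> h [^] n = \<one>"
      using assms by (metis inv_closed inv_solve_right l_cancel_one' m_closed nat_pow_closed l_one one_closed)
    finally show ?thesis .
  qed
  then show ?thesis using assms by (subst ord_unique) (auto simp: pow_eq_id)
qed

section \<open>Normalizers and extension of a subgroup by a normalizing element\<close>

lemma normalizer_subgroup: "H \<subseteq> carrier G \<Longrightarrow> subgroup {g \<in> carrier G. normalizes g H} G"
  by (rule closed_imp_subgroup) (auto simp: normalizes_def conj_mult subset_iff)

lemma normalizes_pow:
  assumes "H \<subseteq> carrier G" "g \<in> carrier G" "normalizes g H" shows "normalizes (g [^] (n::nat)) H"
  using pow_mem[OF normalizer_subgroup[OF assms(1)], of g n] assms by simp

definition adjoin :: "'a set \<Rightarrow> 'a \<Rightarrow> 'a set"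
  where "adjoin H g = {h \<otimes> g [^] (n::nat) | h n. h \<in> H}"

lemma adjoin_subgroup:
  assumes H: "subgroup H G" and g: "g \<in> carrier G" and n: "normalizes g H"
  shows "subgroup (adjoin H g) G"
proof (rule closed_imp_subgroup)
  have Hc: "H \<subseteq> carrier G" using H subgroup.subset by blast
  show "adjoin H g \<subseteq> carrier G" using Hc g by (auto simp: adjoin_def)
  have "\<one> = \<one> \<otimes> g [^] (0::nat)" by simp
  then show "\<one> \<in> adjoin H g" using H subgroup.one_closed unfolding adjoin_def by blast
  fix x y assume "x \<in> adjoin H g" "y \<in> adjoin H g"
  then obtain h i k j where h: "h \<in> H" "x = h \<otimes> g [^] (i::nat)" "k \<in> H" "y = k \<otimes> g [^] (j::nat)"
    by (auto simp: adjoin_def)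
  have kc: "k \<in> carrier G" "h \<in> carrier G" using h Hc by auto
  let ?k = "g [^] i \<otimes> k \<otimes> inv (g [^] i)"
  have "?k \<in> H" using normalizes_pow[OF Hc g n, of i] h by (simp add: normalizes_def)
  then have "h \<otimes> ?k \<in> H" using h H by (simp add: subgroup.m_closed)
  moreover have "x \<otimes> y = (h \<otimes> ?k) \<otimes> g [^] (i + j)"
    using h kc g by (simp add: m_assoc inv_solve_left flip: nat_pow_mult)
  ultimately show "x \<otimes> y \<in> adjoin H g" unfolding adjoin_def by blast
qed

lemma adjoin_sup: "H \<subseteq> carrier G \<Longrightarrow> g \<in> carrier G \<Longrightarrow> H \<subseteq> adjoin H g"
proof
  fix h assume "H \<subseteq> carrier G" "g \<in> carrier G" "h \<in> H"
  then have "h = h \<otimes> g [^] (0::nat)" by auto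
  then show "h \<in> adjoin H g" using \<open>h \<in> H\<close> unfolding adjoin_def by blast
qed

lemma adjoin_mem: "subgroup H G \<Longrightarrow> g \<in> carrier G \<Longrightarrow> g \<in> adjoin H g"
proof -
  assume "subgroup H G" "g \<in> carrier G"
  then have "g = \<one> \<otimes> g [^] (1::nat)" "\<one> \<in> H" by (auto simp: subgroup.one_closed)
  then show ?thesis unfolding adjoin_def by blast
qed

lemma adjoin_least: "subgroup K G \<Longrightarrow> H \<subseteq> K \<Longrightarrow> g \<in> K \<Longrightarrow> adjoin H g \<subseteq> K"
  by (auto simp: adjoin_def pow_mem subgroup.m_closed subset_iff)

text \<open>Normal form: each element is \<open>h \<otimes> g [^] i\<close> for exactly one
  \<open>h\<close> in \<open>H\<close> and one \<open>i < k\<close>, since two different exponents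
  would put a smaller positive power of \<open>g\<close> into \<open>H\<close>.\<close>

lemma adjoin_card:
  assumes H: "subgroup H G" and g: "g \<in> carrier G" and k: "0 < k" "g [^] (k::nat) \<in> H"
    and least: "\<And>i::nat. 0 < i \<Longrightarrow> i < k \<Longrightarrow> g [^] i \<notin> H"
  shows "card (adjoin H g) = card H * k"
proof -
  have Hc: "H \<subseteq> carrier G" using H subgroup.subset by blast
  let ?f = "\<lambda>(h, i::nat). h \<otimes> g [^] i"
  have main: "i = j" if ij: "i \<le> j" "j < k" and hh: "h \<in> H" "h' \<in> H" and eq: "h \<otimes> g [^] i = h' \<otimes> g [^] j" for h h' and i j :: nat
  proof (rule ccontr)
    assume "i \<noteq> j"
    then have d: "0 < j - i" "j - i < k" using ij by auto
    have c: "h \<in> carrier G" "h' \<in> carrier G" using hh Hc by auto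
    have "g [^] j = g [^] (j - i) \<otimes> g [^] i" using g ij by (simp add: nat_pow_mult)
    then have "h \<otimes> g [^] i = (h' \<otimes> g [^] (j - i)) \<otimes> g [^] i" using eq c g by (simp add: m_assoc)
    then have "h = h' \<otimes> g [^] (j - i)" using c g by simp
    then have "g [^] (j - i) = inv h' \<otimes> h" using c g by (simp add: inv_solve_left)
    then have "g [^] (j - i) \<in> H" using hh H by (simp add: subgroup.m_closed subgroup.m_inv_closed)
    then show False using least d by blast
  qed
  have "inj_on ?f (H \<times> {..<k})"
  proof (rule inj_onI, clarsimp)
    fix h i h' j assume a: "h \<in> H" "i < k" "h' \<in> H" "j < k" "h \<otimes> g [^] i = h' \<otimes> g [^] j"
    have "i = j" using main[of i j h h'] main[of j i h' h] a by (cases "i \<le> j") auto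
    then show "h = h' \<and> i = j" using a g Hc by (simp add: subset_iff)
  qed
  moreover have "?f ` (H \<times> {..<k}) = adjoin H g"
  proof
    show "?f ` (H \<times> {..<k}) \<subseteq> adjoin H g" by (auto simp: adjoin_def)
    show "adjoin H g \<subseteq> ?f ` (H \<times> {..<k})"
    proof
      fix x assume "x \<in> adjoin H g"
      then obtain h n where h: "h \<in> H" "x = h \<otimes> g [^] (n::nat)" by (auto simp: adjoin_def)
      have "g [^] n = g [^] (k * (n div k) + n mod k)" by simp
      also have "\<dots> = (g [^] k) [^] (n div k) \<otimes> g [^] (n mod k)"
        using g by (simp add: nat_pow_mult nat_pow_pow del: mult_div_mod_eq)
      finally have "x = (h \<otimes> (g [^] k) [^] (n div k)) \<otimes> g [^] (n mod k)"
        using h g Hc by (simp add: m_assoc subset_iff)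
      moreover have "h \<otimes> (g [^] k) [^] (n div k) \<in> H" using h k H by (simp add: pow_mem subgroup.m_closed)
      ultimately show "x \<in> ?f ` (H \<times> {..<k})" using k by force
    qed
  qed
  ultimately show ?thesis by (metis card_image card_cartesian_product card_lessThan)
qed

text \<open>An exponent \<open>0 < i < p\<close> is invertible modulo \<open>p\<close>, so
  \<open>g [^] i\<close> and \<open>g [^] p\<close> in \<open>H\<close> would force \<open>g\<close>
  into \<open>H\<close>.\<close>

lemma adjoin_card_prime:
  assumes H: "subgroup H G" and g: "g \<in> carrier G" "g \<notin> H" and p: "prime p" "g [^] (p::nat) \<in> H"
  shows "card (adjoin H g) = card H * p"
proof (rule adjoin_card[OF H g(1)])
  show "0 < p" using p prime_gt_0_nat by blast
  fix i :: nat assume i: "0 < i" "i < p"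
  show "g [^] i \<notin> H"
  proof
    assume gi: "g [^] i \<in> H"
    have "coprime i p" using i p(1) by (metis coprime_commute nat_dvd_not_less prime_imp_coprime)
    then obtain x where "[i * x = Suc 0] (mod p)" using cong_solve_coprime_nat by blast
    then have "i * x mod p = 1" using prime_gt_1_nat[OF p(1)] by (simp add: cong_def)
    then obtain t where t: "i * x = 1 + p * t" by (metis mult_div_mod_eq add.commute)
    have "(g [^] i) [^] x = g \<otimes> (g [^] p) [^] t"
      using g nat_pow_mult[OF g(1), of 1 "p * t"] by (simp add: nat_pow_pow t)
    then have "g = (g [^] i) [^] x \<otimes> inv ((g [^] p) [^] t)" using g by (simp add: inv_solve_right)
    then show False using gi p(2) g(2) H by (metis pow_mem subgroup.m_closed subgroup.m_inv_closed)
  qed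
qed (use p in simp)

text \<open>Among the iterated \<open>p\<close>-th powers of \<open>x\<close>, the last one outside
  \<open>H\<close> does it. This prepares elements for \<open>adjoin_card_prime\<close>.\<close>

lemma prime_step:
  assumes H: "subgroup H G" and x: "x \<in> carrier G" "x \<notin> H" and o: "ord x = p ^ i"
  shows "\<exists>n::nat. x [^] n \<notin> H \<and> (x [^] n) [^] (p::nat) \<in> H"
proof -
  let ?P = "\<lambda>j. x [^] (p ^ j) \<in> H"
  have "?P i" using x o pow_ord_eq_1[OF x(1)] H by (simp add: subgroup.one_closed)
  then have L: "?P (LEAST j. ?P j)" by (rule LeastI)
  have "\<not> ?P 0" using x by simp
  then obtain j where j: "(LEAST j. ?P j) = Suc j" using L by (cases "LEAST j. ?P j") auto
  then have "\<not> ?P j" using not_less_Least[of j ?P] by simp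
  moreover have "(x [^] (p ^ j)) [^] p \<in> H" using L j x by (simp add: nat_pow_pow mult.commute)
  ultimately show ?thesis by blast
qed

text \<open>A power of the normalizing element is taken so that its \<open>p\<close>-th power falls
  into \<open>H\<close>; adjoining it then multiplies the order by exactly \<open>p\<close>.\<close>

lemma p_growth:
  assumes p: "prime p" and S: "subgroup S G" "card S = p ^ n" and H: "subgroup H G" "H \<subset> S"
  shows "\<exists>g\<in>S - H. normalizes g H \<and> g [^] (p::nat) \<in> H"
proof -
  interpret S: group "G\<lparr>carrier := S\<rparr>" using S(1) by (rule subgroup_imp_group)
  have "\<exists>g\<in>S - H. \<forall>h\<in>H. g \<otimes> h \<otimes> inv\<^bsub>G\<lparr>carrier := S\<rparr>\<^esub> g \<in> H"
    using S.p_group_normalizer_growth[OF p, of n H] S H subgroup_incl[OF H(1) S(1)] by auto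
  then obtain g where g: "g \<in> S" "g \<notin> H" "normalizes g H"
    using m_inv_consistent[OF S(1)] by (auto simp: normalizes_def)
  have gc: "g \<in> carrier G" using g S sub_mem by blast
  have "ord g dvd p ^ n" using ord_dvd_card S g by metis
  then obtain i where "ord g = p ^ i" using p by (metis divides_primepow_nat)
  then obtain m :: nat where m: "g [^] m \<notin> H" "(g [^] m) [^] p \<in> H"
    using prime_step[OF H(1) gc g(2)] by blast
  have "normalizes (g [^] m) H" using normalizes_pow gc g H(1) subgroup.subset by blast
  then show ?thesis using m g pow_mem[OF S(1)] by blast
qed

end

section \<open>Minimal noncyclic p-groups\<close>

text \<open>The binomial expansion to first order. It is used with \<open>P = p ^ (k' - 1)\<close>,
  where \<open>p ^ k'\<close> divides \<open>P ^ 2\<close>.\<close>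

lemma power_one_plus_cong:
  fixes r P :: nat shows "[(1 + r * P) ^ i = 1 + i * r * P] (mod P ^ 2)"
proof (induction i)
  case (Suc i)
  have "[(1 + r * P) ^ i * (1 + r * P) = (1 + i * r * P) * (1 + r * P)] (mod P ^ 2)"
    using Suc by (intro cong_mult) auto
  also have "(1 + i * r * P) * (1 + r * P) = 1 + Suc i * r * P + i * r * r * P ^ 2"
    by (simp add: algebra_simps power2_eq_square)
  also have "[\<dots> = 1 + Suc i * r * P + 0] (mod P ^ 2)"
    by (intro cong_add) (auto simp: cong_0_iff)
  finally show ?case by (simp add: mult.commute)
qed simp

context finite_group
begin

definition is_cyclic :: "'a set \<Rightarrow> bool"
  where "is_cyclic S \<longleftrightarrow> (\<exists>a\<in>S. S = cyc a)"

text \<open>The group \<open>\<int>\<^sub>p \<times> \<int>\<^sub>p\<close> by order and exponent;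
  that it is commutative is \<open>elementary_comm\<close>, the isomorphism is
  \<open>elementary_iso\<close>.\<close>

definition elementary :: "nat \<Rightarrow> 'a set \<Rightarrow> bool"
  where "elementary p R \<longleftrightarrow> prime p \<and> subgroup R G \<and> card R = p\<^sup>2 \<and> (\<forall>x\<in>R. x [^] p = \<one>)"

text \<open>The usual presentation of \<open>Q8\<close>, with \<open>a [^] 3\<close> in place of the
  inverse of \<open>a\<close>.\<close>

definition quaternionic :: "'a set \<Rightarrow> bool"
  where "quaternionic R \<longleftrightarrow> subgroup R G \<and> card R = 8 \<and>
    (\<exists>a\<in>R. \<exists>b\<in>R. ord a = 4 \<and> b \<notin> cyc a \<and> b [^] (2::nat) = a [^] (2::nat) \<and> b \<otimes> a \<otimes> inv b = a [^] (3::nat))"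

lemma pow_eq_iff:
  assumes a: "a \<in> carrier G"
  shows "a [^] (m::nat) = a [^] (n::nat) \<longleftrightarrow> [m = n] (mod ord a)"
proof -
  have "a [^] m = a [^] n \<longleftrightarrow> int (ord a) dvd int n - int m"
    using int_pow_eq[OF a, of "int m" "int n"] by (simp add: int_pow_int)
  also have "\<dots> \<longleftrightarrow> [m = n] (mod ord a)"
    by (metis cong_iff_dvd_diff cong_int_iff cong_sym)
  finally show ?thesis .
qed

lemma sub_sylow:
  assumes p: "prime p" and R: "subgroup R G" and d: "p ^ a dvd card R"
  shows "\<exists>M. subgroup M G \<and> M \<subseteq> R \<and> card M = p ^ a"
proof -
  obtain m where m: "card R = p ^ a * m" using d by blast
  have "\<exists>H. subgroup H (G\<lparr>carrier := R\<rparr>) \<and> card H = p ^ a"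
    by (rule sylow_thm[OF p subgroup_imp_group[OF R], of a m]) (use m finite_subgroup[OF R] in \<open>auto simp: order_def\<close>)
  then obtain M where M: "subgroup M (G\<lparr>carrier := R\<rparr>)" "card M = p ^ a" by blast
  have "subgroup M G" using incl_subgroup[OF R M(1)] .
  moreover have "M \<subseteq> R" using subgroup.subset[OF M(1)] by simp
  ultimately show ?thesis using M(2) by blast
qed

lemma normalizes_cyc:
  assumes "b \<in> carrier G" "a \<in> carrier G" "b \<otimes> a \<otimes> inv b \<in> cyc a"
  shows "normalizes b (cyc a)"
  unfolding normalizes_def
proof
  fix h assume "h \<in> cyc a"
  then obtain n :: nat where "h = a [^] n" using assms cyc_memE by blast
  then have "b \<otimes> h \<otimes> inv b = (b \<otimes> a \<otimes> inv b) [^] n" using assms by (simp add: conj_pow)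
  then show "b \<otimes> h \<otimes> inv b \<in> cyc a" using assms pow_mem[OF cyc_subgroup] by metis
qed

lemma conj_commute: "b \<in> carrier G \<Longrightarrow> a \<in> carrier G \<Longrightarrow> b \<otimes> a \<otimes> inv b = a \<longleftrightarrow> b \<otimes> a = a \<otimes> b"
  by (metis inv_solve_right m_closed)

lemma adjoin_elementary:
  assumes p: "prime p" and z: "z \<in> carrier G" "ord z = p"
    and y: "y \<in> carrier G" "y [^] p = \<one>" "y \<notin> cyc z" and c: "z \<otimes> y = y \<otimes> z"
  shows "elementary p (adjoin (cyc z) y)"
proof -
  have "y \<otimes> z \<otimes> inv y = z" using conj_commute z y c by simp
  then have n: "normalizes y (cyc z)" using normalizes_cyc z y cyc_self by simp
  have T: "subgroup (adjoin (cyc z) y) G" using adjoin_subgroup cyc_subgroup z y n by simp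
  have "y [^] p \<in> cyc z" using y(2) cyc_subgroup z subgroup.one_closed by metis
  then have cT: "card (adjoin (cyc z) y) = p * p"
    using adjoin_card_prime[OF cyc_subgroup[OF z(1)] y(1,3) p] card_cyc[OF z(1)] z(2) by simp
  have "w [^] p = \<one>" if w: "w \<in> adjoin (cyc z) y" for w
  proof -
    obtain h n where hn: "h \<in> cyc z" "w = h \<otimes> y [^] (n::nat)" using w by (auto simp: adjoin_def)
    then obtain m where m: "h = z [^] (m::nat)" using z cyc_memE by blast
    have "z [^] m \<otimes> y [^] n = y [^] n \<otimes> z [^] m"
      using c z y by (metis group_commutes_pow nat_pow_closed)
    then have "w [^] p = (z [^] m) [^] p \<otimes> (y [^] n) [^] p"
      unfolding hn(2) m using z y by (intro pow_mult_distrib) auto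
    also have "(z [^] m) [^] p = (z [^] p) [^] m" using z by (simp add: nat_pow_pow mult.commute)
    also have "(y [^] n) [^] p = (y [^] p) [^] n" using y(1) by (simp add: nat_pow_pow mult.commute)
    also have "(z [^] p) [^] m \<otimes> (y [^] p) [^] n = \<one>" using y(2) z(2) pow_ord_eq_1[OF z(1)] by simp
    finally show ?thesis .
  qed
  then show ?thesis using p T cT by (simp add: elementary_def power2_eq_square)
qed

text \<open>Otherwise \<open>z\<close> and \<open>y\<close> would span an elementary group of order
  \<open>p ^ 2\<close>, which is proper because \<open>3 \<le> k\<close> and yet not cyclic.\<close>

lemma unique_order_p:
  assumes p: "prime p" and R: "subgroup R G" "card R = p ^ k" "3 \<le> k"
    and proper: "\<And>T. subgroup T G \<Longrightarrow> T \<subset> R \<Longrightarrow> is_cyclic T"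
    and z: "z \<in> R" "ord z = p" and y: "y \<in> R" "y [^] p = \<one>" and c: "z \<otimes> y = y \<otimes> z"
  shows "y \<in> cyc z"
proof (rule ccontr)
  assume yz: "y \<notin> cyc z"
  let ?T = "adjoin (cyc z) y"
  have "elementary p ?T"
    using adjoin_elementary[OF p _ z(2) _ y(2) yz c] z y R sub_mem by blast
  then have T: "subgroup ?T G" "card ?T = p ^ 2" "\<forall>w\<in>?T. w [^] p = \<one>" by (auto simp: elementary_def)
  have TR: "?T \<subseteq> R" using adjoin_least[OF R(1)] cyc_sub[OF R(1) z(1)] y(1) by simp
  have p1: "1 < p" using p prime_gt_1_nat by blast
  have "p ^ 2 < p ^ k" using p1 R(3) by (intro power_strict_increasing) auto
  then have "?T \<noteq> R" using T(2) R(2) by auto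
  then obtain w where w: "w \<in> ?T" "?T = cyc w" using proper T(1) TR unfolding is_cyclic_def by blast
  have "ord w dvd p" using sub_mem[OF T(1) w(1)] T(3) w(1) by (simp flip: pow_eq_id)
  then have "card ?T \<le> p" using w card_cyc[OF sub_mem[OF T(1) w(1)]] p1 by (simp add: dvd_imp_le)
  then show False using T(2) p1 by (simp add: power2_eq_square)
qed

text \<open>
  Here \<open>R = \<langle>a\<rangle>\<langle>b\<rangle>\<close> with \<open>\<langle>a\<rangle>\<close> of index \<open>p\<close>, and \<open>a\<^sup>p\<close> is central because \<open>\<langle>a\<^sup>p, b\<rangle>\<close> is a proper, hence
  cyclic, subgroup. Replacing \<open>b\<close> by some \<open>b' = a\<^sup>u b\<close> makes \<open>b'\<^sup>p = 1\<close> for odd \<open>p\<close>, which yields a proper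
  subgroup \<open>\<int>\<^sub>p \<times> \<int>\<^sub>p\<close>; for \<open>p = 2\<close> the only escape is \<open>|a| = 4\<close>.
\<close>

lemma minimal_noncyclic:
  assumes p: "prime p" and R: "subgroup R G" "card R = p ^ k" and nc: "\<not> is_cyclic R"
    and proper: "\<And>T. subgroup T G \<Longrightarrow> T \<subset> R \<Longrightarrow> is_cyclic T"
  shows "elementary p R \<or> p = 2 \<and> quaternionic R"
proof -
  have p1: "1 < p" using p prime_gt_1_nat by blast
  have Rc: "R \<subseteq> carrier G" using R(1) subgroup.subset by blast
  have full: "ord x \<noteq> card R" if "x \<in> R" for x
    using that nc cyc_eq_if_ord[OF R(1)] by (auto simp: is_cyclic_def)
  have ordp: "\<exists>i\<le>k. ord x = p ^ i" if "x \<in> R" for x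
    using ord_dvd_card[OF R(1) that] R(2) p by (metis divides_primepow_nat)
  have "k \<noteq> 0"
    using full[of \<one>] R subgroup.one_closed by (metis ord_id power_0)
  then obtain k' where k': "k = Suc k'" by (cases k) auto
  have "p ^ k' dvd card R" using R(2) k' by simp
  then obtain M where M: "subgroup M G" "M \<subseteq> R" "card M = p ^ k'" using sub_sylow[OF p R(1)] by blast
  have "M \<noteq> R" using M(3) R(2) k' p1 by auto
  then have MR: "M \<subset> R" using M by blast
  then obtain a where a: "a \<in> M" "M = cyc a" using proper[OF M(1)] by (auto simp: is_cyclic_def)
  have ac: "a \<in> carrier G" using a M sub_mem by blast
  have oa: "ord a = p ^ k'" using card_cyc[OF ac] a(2) M(3) by simp
  obtain b where b: "b \<in> R" "b \<notin> M" "normalizes b M" "b [^] p \<in> M"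
    using p_growth[OF p R M(1) MR] by blast
  have bc: "b \<in> carrier G" using b Rc by blast
  have "k' \<noteq> 0"
  proof
    assume "k' = 0"
    then have "card R = p" using R(2) k' by simp
    moreover have "ord b \<noteq> 1" using b(2) ord_eq_1[OF bc] M(1) subgroup.one_closed by metis
    ultimately show False using full[OF b(1)] ord_dvd_card[OF R(1) b(1)] p by (metis prime_nat_iff)
  qed
  show ?thesis
  proof (cases "k' = 1")
    case True
    \<comment> \<open>Here \<open>card R = p ^ 2\<close>, and a noncyclic group has no element of
      order \<open>card R\<close>, so only the orders 1 and \<open>p\<close> remain.\<close>
    have "x [^] p = \<one>" if x: "x \<in> R" for x
    proof -
      obtain i where i: "i \<le> k" "ord x = p ^ i" using ordp[OF x] by blast
      have "i \<noteq> k" using full[OF x] R(2) i by auto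
      then have "i \<le> 1" using i k' True by auto
      then have "ord x dvd p" using i by (cases i) auto
      then show ?thesis using x Rc pow_eq_id by blast
    qed
    then show ?thesis using R p k' True by (auto simp: elementary_def power2_eq_square)
  next
    case False
    define P where "P = p ^ (k' - 1)"
    define q where "q = p ^ k'"
    obtain k'' where k'': "k' = Suc (Suc k'')" using False \<open>k' \<noteq> 0\<close> by (metis One_nat_def not0_implies_Suc)
    have qP: "q = P * p" using k'' by (simp add: P_def q_def)
    have Pp: "P = p * p ^ k''" using k'' by (simp add: P_def)
    have q0: "0 < q" "0 < P" using p1 by (auto simp: q_def P_def)
    have k3: "3 \<le> k" using k' k'' by simp
    note uniq = unique_order_p[OF p R k3 proper]
    have "b \<otimes> a \<otimes> inv b \<in> M" using b(3) a(1) by (simp add: normalizes_def)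
    then obtain t where t: "b \<otimes> a \<otimes> inv b = a [^] (t::nat)" using a(2) cyc_memE[OF ac] by blast
    have conjb: "b \<otimes> a [^] (m::nat) \<otimes> inv b = a [^] (t * m)" for m
      using t ac bc by (simp add: conj_pow nat_pow_pow)
    have baswap: "b \<otimes> a [^] (m::nat) = a [^] (t * m) \<otimes> b" for m
      using conjb[of m] ac bc by (metis inv_solve_right m_closed nat_pow_closed)
    obtain s where s: "b [^] p = a [^] (s::nat)" using b(4) a(2) cyc_memE[OF ac] by blast
    \<comment> \<open>If \<open>s\<close> were prime to \<open>p\<close>, then
      \<open>b [^] p\<close> would generate \<open>M\<close>, and \<open>b\<close> would have order
      \<open>card R\<close>.\<close>
    have "p dvd s"
    proof (rule ccontr)
      assume "\<not> p dvd s"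
      then have "s \<noteq> 0" by (metis dvd_0_right)
      have "coprime q s" using p \<open>\<not> p dvd s\<close> by (simp add: q_def prime_imp_coprime coprime_power_left_iff)
      then have "ord (b [^] p) = q" using s ord_pow_gen[OF ac, of s] oa \<open>s \<noteq> 0\<close> by (simp add: q_def)
      moreover obtain i where i: "ord b = p ^ i" using ordp[OF b(1)] by blast
      have "i \<noteq> 0"
      proof
        assume "i = 0"
        then have "b = \<one>" using i ord_eq_1[OF bc] by simp
        then show False using b(2) M(1) subgroup.one_closed by blast
      qed
      then obtain j where j: "i = Suc j" by (cases i) auto
      have "ord (b [^] p) = p ^ j" using ord_pow[OF bc, of p] i j p1 by simp
      ultimately have "p ^ j = p ^ k'" by (simp add: q_def)
      then have "j = k'" using p1 by (simp add: power_inject_exp)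
      then show False using full[OF b(1)] R(2) i j k' by simp
    qed
    then obtain s' where s': "s = p * s'" by blast
    have apc: "a [^] p \<in> carrier G" using ac by simp
    have comm: "b \<otimes> a [^] p = a [^] p \<otimes> b"
    proof -
      let ?N = "cyc (a [^] p)"
      have NM: "?N \<subseteq> M" using cyc_sub[OF M(1)] pow_mem[OF M(1) a(1)] by simp
      have "b \<otimes> a [^] p \<otimes> inv b = (a [^] p) [^] t" using conjb[of p] ac by (simp add: nat_pow_pow mult.commute)
      then have n: "normalizes b ?N" using normalizes_cyc[OF bc apc] cyc_memI[OF apc] by simp
      have "b [^] p = (a [^] p) [^] s'" using s s' ac by (simp add: nat_pow_pow)
      then have "b [^] p \<in> ?N" using cyc_memI[OF apc] by simp
      then have "card (adjoin ?N b) = card ?N * p"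
        using adjoin_card_prime[OF cyc_subgroup[OF apc] bc _ p] NM b(2) by blast
      also have "card ?N = P" using card_cyc[OF apc] ord_pow[OF ac, of p] oa k'' p1 by (simp add: P_def)
      finally have "card (adjoin ?N b) \<noteq> card R" using R(2) k' qP q_def p1 q0 by (simp add: mult.commute)
      moreover have "adjoin ?N b \<subseteq> R" using adjoin_least[OF R(1)] NM M(2) b(1) by blast
      ultimately have "is_cyclic (adjoin ?N b)"
        using proper adjoin_subgroup[OF cyc_subgroup[OF apc] bc n] by blast
      then obtain w where w: "w \<in> adjoin ?N b" "adjoin ?N b = cyc w" by (auto simp: is_cyclic_def)
      have wc: "w \<in> carrier G" using w \<open>adjoin ?N b \<subseteq> R\<close> Rc by blast
      have "b \<in> adjoin ?N b" using adjoin_mem[OF cyc_subgroup[OF apc] bc] .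
      moreover have "a [^] p \<in> adjoin ?N b"
        using adjoin_sup[OF subgroup.subset[OF cyc_subgroup[OF apc]] bc] cyc_self[OF apc] by blast
      ultimately show ?thesis using cyc_comm[OF wc] w(2) by blast
    qed
    have t1: "t \<noteq> 0"
    proof
      assume "t = 0"
      then have "b \<otimes> a \<otimes> inv b = \<one>" using t by simp
      then have "a = \<one>" using ac bc by (metis inv_solve_right l_cancel_one' m_closed l_one one_closed)
      then have "p ^ k' = 1" using oa by simp
      then show False using \<open>k' \<noteq> 0\<close> one_less_power[OF p1, of k'] by simp
    qed
    \<comment> \<open>Conjugation by \<open>b\<close> fixes \<open>a [^] p\<close>, so
      \<open>t * p\<close> and \<open>p\<close> agree modulo \<open>ord a = P * p\<close>.\<close>
    obtain r where r: "t = 1 + r * P"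
    proof -
      have "a [^] (t * p) = a [^] p" using conjb[of p] conj_commute[OF bc apc] comm by metis
      then have "[t * p = 1 * p] (mod (P * p))" using pow_eq_iff[OF ac] oa qP q_def by simp
      moreover have "1 * p \<le> t * p" using t1 by simp
      ultimately have "P * p dvd t * p - 1 * p" using cong_altdef_nat by blast
      then have "P * p dvd (t - 1) * p" by (simp only: diff_mult_distrib)
      then have "P dvd t - 1" using p1 by simp
      then obtain r where "t - 1 = P * r" by blast
      then have "t = 1 + r * P" using t1 by (simp add: mult.commute)
      then show ?thesis using that by blast
    qed
    define S where "S n = (\<Sum>i<n. t ^ i)" for n :: nat
    \<comment> \<open>Moving a \<open>b\<close> to the right past a power of \<open>a\<close>
      multiplies the exponent by \<open>t\<close>; this builds up the geometric sum
      \<open>S n\<close>.\<close>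
    have powf: "(a [^] u \<otimes> b) [^] n = a [^] (u * S n) \<otimes> b [^] n" for u n :: nat
    proof (induction n)
      case (Suc n)
      have "S (Suc n) = 1 + t * S n"
        unfolding S_def by (simp add: sum.lessThan_Suc_shift sum_distrib_left del: sum.lessThan_Suc)
      then have e: "a [^] (u * S (Suc n)) = a [^] u \<otimes> a [^] (t * (u * S n))"
        using ac by (simp add: nat_pow_mult algebra_simps)
      have "(a [^] u \<otimes> b) [^] Suc n = (a [^] u \<otimes> b) \<otimes> (a [^] (u * S n) \<otimes> b [^] n)"
        using Suc ac bc by (simp only: nat_pow_Suc2 m_closed nat_pow_closed)
      also have "\<dots> = a [^] u \<otimes> (b \<otimes> a [^] (u * S n)) \<otimes> b [^] n" using ac bc by (simp add: m_assoc)
      also have "\<dots> = a [^] (u * S (Suc n)) \<otimes> (b \<otimes> b [^] n)"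
        unfolding baswap e using ac bc by (simp add: m_assoc)
      also have "b \<otimes> b [^] n = b [^] Suc n" using bc by (simp only: nat_pow_Suc2)
      finally show ?case .
    qed (use ac in \<open>simp add: S_def\<close>)
    \<comment> \<open>Modulo \<open>q\<close> this is \<open>- s'\<close>, written as a natural
      number, so that \<open>u * p + s\<close> vanishes modulo \<open>q\<close>.\<close>
    define u where "u = s' * (q - 1)"
    have us: "u * p + s = s' * p * q"
      using q0 unfolding u_def s' by (cases q) (auto simp: algebra_simps)
    define b' where "b' = a [^] u \<otimes> b"
    have b'R: "b' \<in> R" using b(1) a(1) M(2) R(1) by (auto simp: b'_def intro!: subgroup.m_closed[OF R(1)] pow_mem[OF R(1)])
    then have b'c: "b' \<in> carrier G" using Rc by blast
    have notM: "x \<otimes> b' \<notin> M" if x: "x \<in> M" for x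
    proof
      assume m: "x \<otimes> b' \<in> M"
      have "x \<otimes> a [^] u \<in> M" using x a(1) M(1) by (simp add: pow_mem subgroup.m_closed)
      moreover have "x \<otimes> b' = (x \<otimes> a [^] u) \<otimes> b" using x ac bc sub_mem[OF M(1)] by (simp add: b'_def m_assoc)
      then have "b = inv (x \<otimes> a [^] u) \<otimes> (x \<otimes> b')" using x ac bc sub_mem[OF M(1)] by (simp add: inv_solve_left)
      ultimately show False using b(2) m M(1) by (metis subgroup.m_closed subgroup.m_inv_closed)
    qed
    have b'M: "b' \<notin> M" using notM[of \<one>] M(1) b'c by (simp add: subgroup.one_closed)
    have b'p: "b' [^] p = a [^] (u * S p + s)"
      unfolding b'_def powf s using ac by (simp add: nat_pow_mult)
    \<comment> \<open>An element of order \<open>p\<close> in \<open>M\<close>. As \<open>p\<close>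
      divides \<open>P\<close>, it is a power of \<open>a [^] p\<close> and commutes with
      \<open>b'\<close>.\<close>
    define z where "z = a [^] P"
    have zM: "z \<in> M" using a(1) M(1) by (simp add: z_def pow_mem)
    have zR: "z \<in> R" and zc: "z \<in> carrier G" using zM M Rc by auto
    have oz: "ord z = p" using ord_pow[OF ac, of P] oa q0 qP q_def by (simp add: z_def)
    have czM: "cyc z \<subseteq> M" using cyc_sub[OF M(1) zM] .
    have comm': "(a [^] p) [^] (m::nat) \<otimes> b' = b' \<otimes> (a [^] p) [^] m" for m
    proof -
      have "b \<otimes> (a [^] p) [^] m = (a [^] p) [^] m \<otimes> b" using comm apc bc by (metis group_commutes_pow)
      moreover have "(a [^] p) [^] m \<otimes> a [^] u = a [^] u \<otimes> (a [^] p) [^] m"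
        using ac by (simp add: nat_pow_pow nat_pow_mult add.commute)
      ultimately show ?thesis unfolding b'_def using apc ac bc
        by (metis m_assoc nat_pow_closed)
    qed
    have z_alt: "z = (a [^] p) [^] (p ^ k'')" using ac Pp by (simp add: z_def nat_pow_pow)
    have zb: "z \<otimes> b' = b' \<otimes> z" unfolding z_alt by (rule comm')
    have b'1: "b' [^] p \<noteq> \<one>"
      using uniq[OF _ _ zR oz b'R _ zb] czM b'M by blast
    \<comment> \<open>For odd \<open>p\<close> the sum of the numbers below \<open>p\<close> is a
      multiple of \<open>p\<close>, so the linear terms of \<open>S p\<close> add up to a multiple
      of \<open>P * p = q\<close>. Then \<open>S p\<close> is \<open>p\<close> modulo
      \<open>q\<close>, and the choice of \<open>u\<close> gives
      \<open>b' [^] p = \<one>\<close>.\<close>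
    have "p = 2"
    proof (rule ccontr)
      assume "p \<noteq> 2"
      then have "odd p" using p p1 by (simp add: prime_odd_nat)
      then obtain h where h: "p = Suc (2 * h)" by (metis oddE Suc_eq_plus1)
      have "[S p = (\<Sum>i<p. 1 + i * r * P)] (mod P ^ 2)"
        unfolding S_def r by (intro cong_sum power_one_plus_cong)
      moreover have "q dvd P ^ 2" using Pp by (simp add: qP power2_eq_square)
      ultimately have "[S p = (\<Sum>i<p. 1 + i * r * P)] (mod q)" using cong_dvd_modulus_nat by blast
      also have "(\<Sum>i<p. 1 + i * r * P) = p + (\<Sum>i<p. i) * r * P"
        by (simp only: sum.distrib sum_distrib_right) simp
      also have "(\<Sum>i<p. i) = p * h" unfolding h using gauss_sum_nat[of "2*h"]
        by (simp add: lessThan_Suc_atMost atLeast0AtMost)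
      also have "p + p * h * r * P = p + q * (h * r)" by (simp add: qP)
      also have "[\<dots> = p + 0] (mod q)" by (intro cong_add) (auto simp: cong_0_iff)
      finally have "[u * S p + s = u * p + s] (mod q)" by (intro cong_add cong_mult) auto
      then have "[u * S p + s = 0] (mod q)" unfolding us by (simp add: cong_def)
      then have "b' [^] p = \<one>" unfolding b'p using ac oa by (simp add: pow_eq_id cong_0_iff q_def)
      then show False using b'1 by simp
    qed
    have z2: "z \<otimes> z = \<one>" using oz pow_ord_eq_1[OF zc] \<open>p = 2\<close> zc by (simp add: numeral_2_eq_2)
    \<comment> \<open>With \<open>S 2 = 2 + r * P\<close> the exponent is a multiple of
      \<open>P\<close> modulo \<open>q\<close>, so the square is a power of the involution
      \<open>z\<close>, and it is not trivial.\<close>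
    have b'z: "b' [^] (2::nat) = z"
    proof -
      have "S 2 = 2 + r * P" by (simp add: S_def r numeral_2_eq_2)
      then have "u * S 2 + s = P * (u * r) + s' * 2 * q" using us \<open>p = 2\<close> by (simp add: algebra_simps)
      then have "b' [^] (2::nat) = z [^] (u * r) \<otimes> (a [^] q) [^] (s' * 2)"
        using b'p \<open>p = 2\<close> ac by (simp add: z_def nat_pow_pow nat_pow_mult mult.commute)
      also have "a [^] q = \<one>" using pow_ord_eq_1[OF ac] oa q_def by simp
      finally have "b' [^] (2::nat) = z [^] ((u * r) mod 2)" using pow_mod_ord[OF zc, of "u * r"] oz \<open>p = 2\<close> zc by simp
      moreover have "u * r mod 2 = 0 \<or> u * r mod 2 = 1" by linarith
      ultimately show ?thesis using b'1 \<open>p = 2\<close> zc by auto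
    qed
    \<comment> \<open>Since \<open>w\<close> and \<open>b'\<close> both have square
      \<open>z\<close>, the product \<open>w \<otimes> b'\<close> would have trivial square and lie
      outside \<open>M\<close>, against \<open>uniq\<close>. Below, \<open>w\<close> is a power of
      \<open>a [^] p\<close> if \<open>k'' > 0\<close>, and \<open>a\<close> itself if
      \<open>r\<close> is even.\<close>
    have noroot: False if w: "w \<in> M" "w \<otimes> b' = b' \<otimes> w" "w \<otimes> w = z" for w
    proof -
      have wc: "w \<in> carrier G" using w M sub_mem by blast
      have "(w \<otimes> b') [^] (2::nat) = w [^] (2::nat) \<otimes> b' [^] (2::nat)" using w(2) wc b'c by (rule pow_mult_distrib)
      also have "\<dots> = \<one>" using b'z w(3) z2 wc by (simp add: numeral_2_eq_2)
      finally have "(w \<otimes> b') [^] p = \<one>" using \<open>p = 2\<close> by simp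
      moreover have "w \<otimes> b' \<in> R" using w(1) M(2) b'R R(1) by (auto intro: subgroup.m_closed)
      moreover have "z \<otimes> (w \<otimes> b') = (w \<otimes> b') \<otimes> z"
      proof -
        have "z \<otimes> w = w \<otimes> z" using cyc_comm[OF ac] zM w(1) a(2) by blast
        then show ?thesis using zb wc zc b'c by (metis m_assoc)
      qed
      ultimately have "w \<otimes> b' \<in> cyc z" using uniq[OF _ _ zR oz] by blast
      then show False using notM[OF w(1)] czM by blast
    qed
    have "k'' = 0"
    proof (rule ccontr)
      assume "k'' \<noteq> 0"
      then obtain l where l: "k'' = Suc l" by (cases k'') auto
      let ?w = "(a [^] p) [^] (p ^ l)"
      have "?w \<in> M" using a(1) M(1) by (simp add: pow_mem)
      moreover have "?w \<otimes> ?w = z" using ac l \<open>p = 2\<close> by (simp add: z_alt nat_pow_mult mult_2)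
      ultimately show False using noroot comm' by blast
    qed
    then have oa4: "ord a = 4" and P2: "P = 2" and c8: "card R = 8"
      using oa k'' \<open>p = 2\<close> R(2) k' by (auto simp: P_def)
    have b'a: "b' \<otimes> a \<otimes> inv b' = a [^] t"
    proof -
      have "b' \<otimes> a \<otimes> inv b' = a [^] u \<otimes> a [^] t \<otimes> inv (a [^] u)"
        unfolding b'_def using conj_mult[of "a [^] u" b a] ac bc t by simp
      also have "\<dots> = a [^] t" by (rule conj_commute[THEN iffD2]) (use ac in \<open>simp_all add: nat_pow_mult add.commute\<close>)
      finally show ?thesis .
    qed
    have "odd r"
    proof
      assume "even r"
      then have "[t = 1] (mod 4)" using r P2 by (auto simp: cong_def elim!: evenE)
      then have "a [^] t = a" using pow_eq_iff[OF ac, of t 1] oa4 ac by simp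
      then have "a \<otimes> b' = b' \<otimes> a" using b'a conj_commute[OF b'c ac] by simp
      moreover have "a \<otimes> a = z" using ac P2 by (simp add: z_def numeral_2_eq_2)
      ultimately show False using noroot a(1) by blast
    qed
    then have "[t = 3] (mod 4)" using r P2 by (auto simp: cong_def elim!: oddE)
    then have "b' \<otimes> a \<otimes> inv b' = a [^] (3::nat)" using b'a pow_eq_iff[OF ac] oa4 by simp
    then have "quaternionic R"
      unfolding quaternionic_def using R(1) c8 a M(2) b'R oa4 b'M b'z P2 z_def by blast
    then show ?thesis using \<open>p = 2\<close> by blast
  qed
qed

section \<open>p-subgroups of groups with the divisibility property\<close>

text \<open>\<open>Q8\<close> by conditions on powers alone: they pass along isomorphisms and give
  the number of elements of order 4 by subtraction. The set of size 2 holds the identity and the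
  only involution.\<close>

definition quaternion_like :: "'a set \<Rightarrow> bool"
  where "quaternion_like R \<longleftrightarrow> subgroup R G \<and> card R = 8 \<and> (\<forall>x\<in>R. x [^] (4::nat) = \<one>) \<and>
    card {x \<in> R. x [^] (2::nat) = \<one>} = 2"

text \<open>The element \<open>z = a \<otimes> a\<close> commutes with \<open>a\<close> and
  \<open>b\<close>, so products can be rewritten with \<open>z\<close> in front and \<open>a\<close>
  before \<open>b\<close>. The homomorphism property becomes a finite check; surjectivity follows
  from injectivity and \<open>card R = 8\<close>.\<close>

lemma quaternionic_iso_Q8:
  assumes "quaternionic R"
  shows "G\<lparr>carrier := R\<rparr> \<cong> Q8"
proof -
  obtain a b where R: "subgroup R G" "card R = 8" and a: "a \<in> R" "ord a = 4" and b: "b \<in> R" "b \<notin> cyc a"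
    and ba: "b [^] (2::nat) = a [^] (2::nat)" "b \<otimes> a \<otimes> inv b = a [^] (3::nat)"
    using assms unfolding quaternionic_def by blast
  have c: "a \<in> carrier G" "b \<in> carrier G" using a b R sub_mem by auto
  define z where "z = a \<otimes> a"
  have zc: "z \<in> carrier G" and zR: "z \<in> R" using c a R by (auto simp: z_def subgroup.m_closed)
  have a4: "a [^] (4::nat) = \<one>" using pow_ord_eq_1[OF c(1)] a by simp
  have r1: "z \<otimes> z = \<one>" using a4 c by (simp add: z_def numeral_eq_Suc m_assoc)
  have r2: "a \<otimes> a = z" by (simp add: z_def)
  have r3: "b \<otimes> b = z" using ba(1) c by (simp add: z_def numeral_2_eq_2)
  have r4: "a \<otimes> z = z \<otimes> a" using c by (simp add: z_def m_assoc)
  have r5: "b \<otimes> z = z \<otimes> b" using c by (simp add: r3[symmetric] m_assoc)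
  have "b \<otimes> a = a [^] (3::nat) \<otimes> b" using ba(2) c by (metis inv_solve_right m_closed nat_pow_closed)
  then have r6: "b \<otimes> a = z \<otimes> (a \<otimes> b)" using c by (simp add: z_def numeral_eq_Suc m_assoc)
  \<comment> \<open>The \<open>l\<close> rules repeat the \<open>r\<close> rules with a further
    factor on the right, so that rewriting reaches into right-nested products.\<close>
  have l1: "z \<otimes> (z \<otimes> x) = x" if "x \<in> carrier G" for x using that r1 zc by (metis m_assoc l_one)
  have l2: "a \<otimes> (a \<otimes> x) = z \<otimes> x" if "x \<in> carrier G" for x using that r2 c by (metis m_assoc)
  have l3: "b \<otimes> (b \<otimes> x) = z \<otimes> x" if "x \<in> carrier G" for x using that r3 c by (metis m_assoc)
  have l4: "a \<otimes> (z \<otimes> x) = z \<otimes> (a \<otimes> x)" if "x \<in> carrier G" for x using that r4 c zc by (metis m_assoc)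
  have l5: "b \<otimes> (z \<otimes> x) = z \<otimes> (b \<otimes> x)" if "x \<in> carrier G" for x using that r5 c zc by (metis m_assoc)
  have l6: "b \<otimes> (a \<otimes> x) = z \<otimes> (a \<otimes> (b \<otimes> x))" if "x \<in> carrier G" for x
    using that r6 c zc by (metis m_assoc m_closed)
  note rules = r1 r2 r3 r4 r5 r6 l1 l2 l3 l4 l5 l6
  \<comment> \<open>-1, i, j and k go to \<open>z\<close>, \<open>a\<close>, \<open>b\<close> and
    \<open>a \<otimes> b\<close>; the last branch serves -k.\<close>
  define f :: "int \<times> int \<times> int \<times> int \<Rightarrow> 'a" where "f = (\<lambda>(p, q, r, s).
    if p = 1 then \<one> else if p = -1 then z else if q = 1 then a else if q = -1 then z \<otimes> a else
    if r = 1 then b else if r = -1 then z \<otimes> b else if s = 1 then a \<otimes> b else z \<otimes> (a \<otimes> b))"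
  interpret R: group "G\<lparr>carrier := R\<rparr>" using R(1) by (rule subgroup_imp_group)
  have fR: "f x \<in> R" for x
    using a b zR R(1) by (auto simp: f_def subgroup.m_closed subgroup.one_closed split: prod.split)
  have hom: "f \<in> hom Q8 (G\<lparr>carrier := R\<rparr>)"
  proof (rule homI)
    show "f (x \<otimes>\<^bsub>Q8\<^esub> y) = f x \<otimes>\<^bsub>G\<lparr>carrier := R\<rparr>\<^esub> f y" if "x \<in> carrier Q8" "y \<in> carrier Q8" for x y
      using that c zc by (auto simp: Q8_def f_def m_assoc rules)
  qed (use fR in auto)
  then interpret f: group_hom Q8 "G\<lparr>carrier := R\<rparr>" f
    by (simp add: group_hom_def group_hom_axioms_def group_Q8 R.is_group)
  have ca: "\<one> \<in> cyc a" "a \<in> cyc a" "z \<in> cyc a"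
    using cyc_memI[OF c(1), of 0] cyc_memI[OF c(1), of 1] cyc_memI[OF c(1), of 2] c by (auto simp: z_def numeral_2_eq_2)
  have nz: "z \<noteq> \<one>"
  proof
    assume "z = \<one>"
    then have "a [^] (2::nat) = \<one>" using c by (simp add: z_def numeral_2_eq_2)
    then have "(4::nat) dvd 2" using pow_eq_id[OF c(1)] a by simp
    then show False by simp
  qed
  have na: "a \<noteq> \<one>" using nz c by (auto simp: z_def)
  have nza: "z \<otimes> a \<noteq> \<one>"
  proof
    assume "z \<otimes> a = \<one>"
    then have "a [^] (3::nat) = \<one>" using c by (simp add: z_def numeral_eq_Suc)
    then have "(4::nat) dvd 3" using pow_eq_id[OF c(1)] a by simp
    then show False by simp
  qed
  have sg: "subgroup (cyc a) G" using cyc_subgroup c by blast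
  have nb: "x \<otimes> b \<noteq> \<one>" if "x \<in> cyc a" for x
  proof
    assume "x \<otimes> b = \<one>"
    then have "b = inv x" using that c sub_mem[OF sg] by (metis inv_equality inv_inv)
    then show False using b(2) that sg subgroup.m_inv_closed by metis
  qed
  have nb': "b \<noteq> \<one>" "z \<otimes> b \<noteq> \<one>" "a \<otimes> b \<noteq> \<one>" "z \<otimes> (a \<otimes> b) \<noteq> \<one>"
    using nb[OF ca(1)] nb[OF ca(3)] nb[OF ca(2)] nb[of "z \<otimes> a"] ca sg c zc
    by (auto simp: subgroup.m_closed m_assoc)
  have "\<forall>x\<in>carrier Q8. f x = \<one> \<longrightarrow> x = \<one>\<^bsub>Q8\<^esub>"
    using nz na nza nb' by (auto simp: Q8_def f_def)
  then have inj: "inj_on f (carrier Q8)" using f.inj_on_one_iff by simp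
  have "f ` carrier Q8 = R"
    by (rule card_subset_eq) (use fR finite_subgroup[OF R(1)] card_image[OF inj] order_Q8 R(2) in \<open>auto simp: order_def\<close>)
  then have "f \<in> iso Q8 (G\<lparr>carrier := R\<rparr>)"
    using hom inj by (auto simp: iso_def bij_betw_def)
  then have "Q8 \<cong> G\<lparr>carrier := R\<rparr>" by (auto simp: is_iso_def)
  then show ?thesis using group.iso_sym[OF group_Q8] by blast
qed

lemma iso_Q8_quaternion_like:
  assumes R: "subgroup R G" and iso: "G\<lparr>carrier := R\<rparr> \<cong> Q8"
  shows "quaternion_like R"
proof -
  interpret R: group "G\<lparr>carrier := R\<rparr>" using R by (rule subgroup_imp_group)
  obtain f where f: "f \<in> iso (G\<lparr>carrier := R\<rparr>) Q8" using iso by (auto simp: is_iso_def)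
  interpret f: group_hom "G\<lparr>carrier := R\<rparr>" Q8 f
    using f by (simp add: iso_def group_hom_def group_hom_axioms_def group_Q8 R.is_group)
  interpret Q: group Q8 by (rule group_Q8)
  have bij: "bij_betw f R (carrier Q8)" using f by (simp add: iso_def)
  have c8: "card R = 8" using bij_betw_same_card[OF bij] order_Q8 by (simp add: order_def)
  have one: "\<one> \<in> R" using R subgroup.one_closed by blast
  have pw: "x [^] (n::nat) = \<one> \<longleftrightarrow> f x [^]\<^bsub>Q8\<^esub> n = \<one>\<^bsub>Q8\<^esub>" if "x \<in> R" for x n
  proof -
    have "f (x [^] n) = f x [^]\<^bsub>Q8\<^esub> n" using f.hom_nat_pow[of x n] that by (simp flip: nat_pow_consistent)
    moreover have "f \<one> = \<one>\<^bsub>Q8\<^esub>" using f.hom_one by simp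
    moreover have "x [^] n \<in> R" using that R pow_mem by blast
    ultimately show ?thesis using bij one by (metis bij_betw_inv_into_left)
  qed
  have "y [^]\<^bsub>Q8\<^esub> (4::nat) = \<one>\<^bsub>Q8\<^esub>" if "y \<in> carrier Q8" for y
    using that by (auto simp: Q8_def numeral_eq_Suc)
  then have p4: "\<forall>x\<in>R. x [^] (4::nat) = \<one>" using pw bij bij_betwE by blast
  have "{y \<in> carrier Q8. y [^]\<^bsub>Q8\<^esub> (2::nat) = \<one>\<^bsub>Q8\<^esub>} = {(1,0,0,0), (-1,0,0,0)}"
    by (auto simp: Q8_def numeral_eq_Suc)
  then have c2: "card {y \<in> carrier Q8. y [^]\<^bsub>Q8\<^esub> (2::nat) = \<one>\<^bsub>Q8\<^esub>} = 2" by simp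
  have "f ` {x \<in> R. x [^] (2::nat) = \<one>} = {y \<in> carrier Q8. y [^]\<^bsub>Q8\<^esub> (2::nat) = \<one>\<^bsub>Q8\<^esub>}" (is "f ` ?A = ?B")
  proof
    show "f ` ?A \<subseteq> ?B" using pw[of _ 2] bij_betwE[OF bij] by auto
    show "?B \<subseteq> f ` ?A"
    proof
      fix y assume y: "y \<in> ?B"
      then obtain x where "x \<in> R" "y = f x" using bij unfolding bij_betw_def by blast
      then show "y \<in> f ` ?A" using y pw[of x 2] by blast
    qed
  qed
  then have "card ?A = card ?B"
    using card_image[of f ?A] bij inj_on_subset[of f R ?A] by (auto simp: bij_betw_def)
  then show ?thesis using R c8 p4 c2 by (simp add: quaternion_like_def)
qed

section \<open>Exponents and \<phi> for subgroups of a fixed group\<close>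

definition expo :: "'a set \<Rightarrow> nat" where "expo S = Lcm (ord ` S)"

text \<open>Orders are those in \<open>G\<close>, so subgroups are compared without changing the
  structure; \<open>num_exp_elems_sub\<close> identifies the number with
  \<open>\<phi>\<close>.\<close>

definition euler :: "'a set \<Rightarrow> nat" where "euler S = card {x \<in> S. ord x = expo S}"

lemma num_exp_elems_sub: "subgroup S G \<Longrightarrow> \<phi> (G\<lparr>carrier := S\<rparr>) = euler S"
proof -
  assume S: "subgroup S G"
  then have "group.ord (G\<lparr>carrier := S\<rparr>) ` S = ord ` S" using ord_sub by auto
  then have "group_exponent (G\<lparr>carrier := S\<rparr>) = expo S" by (simp add: group_exponent_def expo_def)
  then show ?thesis using ord_sub[OF S] by (auto simp: num_exp_elems_def euler_def intro!: arg_cong[where f = card])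
qed

lemma ord_dvd_expo: "x \<in> S \<Longrightarrow> ord x dvd expo S"
  by (simp add: expo_def)

lemma expo_dvd: "(\<And>x. x \<in> S \<Longrightarrow> ord x dvd m) \<Longrightarrow> expo S dvd m"
  by (auto simp: expo_def intro: Lcm_least)

lemma expo_dvd_card: "subgroup S G \<Longrightarrow> expo S dvd card S"
  using ord_dvd_card expo_dvd by blast

lemma expo_cyc: "a \<in> carrier G \<Longrightarrow> expo (cyc a) = ord a"
  using expo_dvd_card[OF cyc_subgroup] card_cyc ord_dvd_expo[OF cyc_self] by (metis dvd_antisym)

lemma euler_cyc: "a \<in> carrier G \<Longrightarrow> euler (cyc a) = totient (ord a)"
  using ord_count_cyc[of a "ord a"] by (simp add: euler_def expo_cyc)

lemma euler_exponent_prime: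
  assumes S: "subgroup S G" and p: "prime p" and e: "\<And>x. x \<in> S \<Longrightarrow> x [^] (p::nat) = \<one>" and n: "S \<noteq> {\<one>}"
  shows "expo S = p" "euler S = card S - 1"
proof -
  have o: "ord x = p" if "x \<in> S" "x \<noteq> \<one>" for x
    using that e[OF that(1)] p ord_eq_1 pow_eq_id sub_mem[OF S] by (metis prime_nat_iff)
  obtain x where x: "x \<in> S" "x \<noteq> \<one>" using n S subgroup.one_closed by blast
  have "expo S dvd p" using e pow_eq_id sub_mem[OF S] by (intro expo_dvd) blast
  then show ex: "expo S = p" using ord_dvd_expo[OF x(1)] o[OF x] by (simp add: dvd_antisym)
  have "ord \<one> \<noteq> p" using p by auto
  then have "{x \<in> S. ord x = p} = S - {\<one>}" using o by auto
  then show "euler S = card S - 1" using S by (simp add: euler_def ex subgroup.one_closed)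
qed

text \<open>All orders divide 4, and apart from the two solutions of \<open>x [^] 2 = \<one>\<close>
  they equal 4; this leaves 8 - 2 elements.\<close>

lemma euler_quaternion_like:
  assumes "quaternion_like R"
  shows "expo R = 4" "euler R = 6"
proof -
  have R: "subgroup R G" "card R = 8" and e: "\<And>x. x \<in> R \<Longrightarrow> ord x dvd 4"
    and c2: "card {x \<in> R. x [^] (2::nat) = \<one>} = 2"
    using assms sub_mem[of R] by (auto simp: quaternion_like_def simp flip: pow_eq_id)
  have d4: "d dvd 4 \<Longrightarrow> \<not> d dvd 2 \<Longrightarrow> d = 4" for d :: nat
  proof -
    assume d: "d dvd 4" "\<not> d dvd 2"
    have "d \<le> 4" using d(1) by (intro dvd_imp_le) auto
    then have "d \<in> {0,1,2,3,4}" by auto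
    then show "d = 4" using d by auto
  qed
  have o4: "ord x = 4 \<longleftrightarrow> x [^] (2::nat) \<noteq> \<one>" if "x \<in> R" for x
    using e[OF that] d4 pow_eq_id sub_mem[OF R(1) that] by auto
  have fin: "finite R" using R finite_subgroup by blast
  have "{x \<in> R. x [^] (2::nat) \<noteq> \<one>} = R - {x \<in> R. x [^] (2::nat) = \<one>}" by auto
  then have c6: "card {x \<in> R. x [^] (2::nat) \<noteq> \<one>} = 6" using fin R(2) c2 by (simp add: card_Diff_subset)
  then obtain x where x: "x \<in> R" "x [^] (2::nat) \<noteq> \<one>" by (metis (mono_tags, lifting) card.empty empty_Collect_eq numeral_neq_zero zero_neq_numeral)
  have "4 dvd expo R" using ord_dvd_expo[OF x(1)] o4[OF x(1)] x(2) by metis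
  moreover have "expo R dvd 4" using e by (rule expo_dvd)
  ultimately show ex: "expo R = 4" by (simp add: dvd_antisym)
  have "{x \<in> R. ord x = 4} = {x \<in> R. x [^] (2::nat) \<noteq> \<one>}" using o4 by auto
  then show "euler R = 6" using c6 by (simp add: euler_def ex)
qed

definition euler_monotone :: bool
  where "euler_monotone \<longleftrightarrow> (\<forall>H K. subgroup H G \<longrightarrow> subgroup K G \<longrightarrow> H \<subseteq> K \<longrightarrow> euler H dvd euler K)"

text \<open>This expresses that \<phi> vanishes on no subgroup. It also makes \<open>euler S\<close>
  positive, so that any divisor of \<open>euler S\<close> is a lower bound for it.\<close>

definition exp_attained :: bool
  where "exp_attained \<longleftrightarrow> (\<forall>S. subgroup S G \<longrightarrow> (\<exists>x\<in>S. ord x = expo S))"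

lemma euler_pos: "exp_attained \<Longrightarrow> subgroup S G \<Longrightarrow> 0 < euler S"
  using finite_subgroup[of S] by (auto simp: exp_attained_def euler_def card_gt_0_iff)

text \<open>
  In a subgroup \<open>F\<close> of order \<open>p\<^sup>3\<close> above \<open>R\<close> with exponent at least \<open>p\<^sup>2\<close>, the number \<open>p (p\<^sup>2 - 1)\<close> would
  divide \<open>\<phi>(F) \<le> p\<^sup>3 - p\<^sup>2\<close>; with exponent \<open>p\<close>, \<open>p\<^sup>2 - 1\<close> would divide \<open>p\<^sup>3 - 1\<close>.
\<close>

lemma elementary_maximal:
  assumes D: euler_monotone and A: exp_attained and S: "subgroup S G" "card S = p ^ n"
    and R: "elementary p R" "R \<subseteq> S"
  shows "R = S"
proof (rule ccontr)
  assume "R \<noteq> S"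
  have p: "prime p" and sR: "subgroup R G" and cR: "card R = p\<^sup>2" and eR: "\<And>x. x \<in> R \<Longrightarrow> x [^] p = \<one>"
    using R(1) by (auto simp: elementary_def)
  have p1: "1 < p" using p prime_gt_1_nat by blast
  have one: "\<one> \<in> R" using sR subgroup.one_closed by blast
  have p2: "p < p\<^sup>2" using p1 by (simp add: power2_eq_square)
  have "R \<noteq> {\<one>}" using cR p1 p2 by (auto simp del: power_eq_1_iff)
  note eulR = euler_exponent_prime[OF sR p eR this]
  obtain g where g: "g \<in> S - R" "normalizes g R" "g [^] p \<in> R"
    using p_growth[OF p S sR] R(2) \<open>R \<noteq> S\<close> by blast
  have gc: "g \<in> carrier G" using g S sub_mem by blast
  define F where "F = adjoin R g"
  have F: "subgroup F G" using adjoin_subgroup[OF sR gc g(2)] by (simp add: F_def)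
  have cF: "card F = p ^ 3" using adjoin_card_prime[OF sR gc _ p g(3)] g(1) cR by (simp add: F_def power2_eq_square power3_eq_cube)
  have RF: "R \<subseteq> F" using adjoin_sup[OF subgroup.subset[OF sR] gc] by (simp add: F_def)
  have dvd: "p\<^sup>2 - 1 dvd euler F" using D sR F RF eulR(2) cR by (auto simp: euler_monotone_def)
  show False
  proof (cases "\<forall>x\<in>F. x [^] p = \<one>")
    case True
    have "F \<noteq> {\<one>}" using cF p1 by (auto simp: power3_eq_cube)
    then have "euler F = p ^ 3 - 1" using euler_exponent_prime(2)[OF F p] True cF by auto
    \<comment> \<open>Division by \<open>p\<^sup>2 - 1\<close> leaves the remainder
      \<open>p - 1\<close>, which is positive and too small.\<close>
    moreover have "p ^ 3 - 1 = p * (p\<^sup>2 - 1) + (p - 1)"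
    proof -
      obtain d where "p = Suc d" using p1 by (cases p) auto
      then show ?thesis by (simp add: power2_eq_square power3_eq_cube algebra_simps)
    qed
    ultimately have "p\<^sup>2 - 1 dvd p - 1" using dvd by (metis dvd_add_right_iff dvd_triv_right)
    then have "p\<^sup>2 - 1 \<le> p - 1" using p1 by (intro dvd_imp_le) auto
    moreover have "p < p\<^sup>2" using p1 by (simp add: power2_eq_square)
    ultimately show False using p1 by linarith
  next
    case False
    then obtain x where x: "x \<in> F" "\<not> ord x dvd p" using pow_eq_id sub_mem[OF F] by blast
    obtain y where y: "y \<in> F" "ord y = expo F" using A F by (auto simp: exp_attained_def)
    have yc: "y \<in> carrier G" using y F sub_mem by blast
    obtain m where m: "ord y = p ^ m" using ord_dvd_card[OF F y(1)] cF p by (metis divides_primepow_nat)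
    have nd: "\<not> expo F dvd p" using x ord_dvd_expo[OF x(1)] dvd_trans by blast
    then have "2 \<le> m" using m y(2) by (metis One_nat_def dvd_refl le_SucE linorder_not_le less_2_cases one_dvd power_0 power_one_right)
    then obtain k where k: "m = Suc (Suc k)" by (metis add_2_eq_Suc le_Suc_ex)
    \<comment> \<open>The order of \<open>y\<close> is \<open>p ^ m\<close> with
      \<open>2 \<le> m\<close>, so its totient, and with it \<open>euler F\<close>, is divisible by
      \<open>p\<close>.\<close>
    have "euler (cyc y) dvd euler F" using D F cyc_subgroup[OF yc] cyc_sub[OF F y(1)] by (auto simp: euler_monotone_def)
    then have pd: "p dvd euler F" using euler_cyc[OF yc] m k totient_prime_power_Suc[OF p, of "Suc k"]
      by (auto intro: dvd_trans[rotated])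
    have "coprime (p * p) (p * p - 1)" by (rule coprime_diff_one_right_nat) (use p1 in simp)
    then have "coprime p (p\<^sup>2 - 1)" by (simp add: power2_eq_square)
    then have "p * (p\<^sup>2 - 1) dvd euler F" using pd dvd by (simp add: divides_mult)
    then have low: "p * (p\<^sup>2 - 1) \<le> euler F" using euler_pos[OF A F] by (simp add: dvd_imp_le)
    have "ord z \<noteq> expo F" if "z \<in> R" for z
      using that nd eR pow_eq_id sub_mem[OF sR] by metis
    then have "{z \<in> F. ord z = expo F} \<subseteq> F - R" by auto
    then have "euler F \<le> card (F - R)" unfolding euler_def using finite_subgroup[OF F] by (intro card_mono) auto
    also have "\<dots> = p ^ 3 - p\<^sup>2" using RF finite_subgroup[OF F] cF cR finite_subset by (subst card_Diff_subset) auto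
    finally have "p * (p\<^sup>2 - 1) \<le> p ^ 3 - p\<^sup>2" using low by linarith
    moreover have "p * (p\<^sup>2 - 1) = p ^ 3 - p" by (simp add: power2_eq_square power3_eq_cube diff_mult_distrib2)
    moreover have "p < p\<^sup>2" "p\<^sup>2 < p ^ 3" using p1 by (auto simp: power2_eq_square power3_eq_cube)
    ultimately show False by linarith
  qed
qed

text \<open>
  In a subgroup \<open>F\<close> of order 16 above \<open>R\<close>, either 12 divides \<open>\<phi>(F) \<le> 8\<close>, or the exponent is 4 and
  6 divides \<open>\<phi>(F)\<close>, which forces an involution outside \<open>R\<close>.
\<close>

lemma quaternion_maximal:
  assumes D: euler_monotone and A: exp_attained and S: "subgroup S G" "card S = 2 ^ n"
    and R: "quaternion_like R" "R \<subseteq> S"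
  shows "R = S"
proof (rule ccontr)
  assume "R \<noteq> S"
  have p: "prime (2::nat)" by simp
  have sR: "subgroup R G" and cR: "card R = 8" and c2: "card {x \<in> R. x [^] (2::nat) = \<one>} = 2"
    using R(1) by (auto simp: quaternion_like_def)
  note eulR = euler_quaternion_like[OF R(1)]
  obtain g where g: "g \<in> S - R" "normalizes g R" "g [^] (2::nat) \<in> R"
    using p_growth[OF p S sR] R(2) \<open>R \<noteq> S\<close> by blast
  have gc: "g \<in> carrier G" using g S sub_mem by blast
  define F where "F = adjoin R g"
  have F: "subgroup F G" using adjoin_subgroup[OF sR gc g(2)] by (simp add: F_def)
  have finF: "finite F" using F finite_subgroup by blast
  have cF: "card F = 16" using adjoin_card_prime[OF sR gc _ p g(3)] g(1) cR by (simp add: F_def)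
  have RF: "R \<subseteq> F" using adjoin_sup[OF subgroup.subset[OF sR] gc] by (simp add: F_def)
  have FS: "F \<subseteq> S" using adjoin_least[OF S(1) R(2)] g(1) by (simp add: F_def)
  have dvd: "6 dvd euler F" using D sR F RF eulR(2) unfolding euler_monotone_def by metis
  have e4: "4 dvd expo F"
    using ord_dvd_expo[of _ F] A sR eulR(1) RF unfolding exp_attained_def by (metis subsetD)
  show False
  proof (cases "expo F dvd 4")
    case False
    obtain y where y: "y \<in> F" "ord y = expo F" using A F by (auto simp: exp_attained_def)
    have yc: "y \<in> carrier G" using y F sub_mem by blast
    have "ord y dvd 2 ^ 4" using ord_dvd_card[OF F y(1)] cF by simp
    then obtain m where m: "ord y = 2 ^ m" using p by (metis divides_primepow_nat)
    have "\<not> m \<le> 2"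
    proof
      assume "m \<le> 2"
      then have "(2::nat) ^ m dvd 2 ^ 2" by (rule le_imp_power_dvd)
      then show False using m y(2) False by simp
    qed
    then obtain k where k: "m = Suc (Suc (Suc k))" by (metis Suc_leI add_2_eq_Suc le_Suc_ex not_le add_Suc)
    have "euler (cyc y) dvd euler F" using D F cyc_subgroup[OF yc] cyc_sub[OF F y(1)] by (auto simp: euler_monotone_def)
    \<comment> \<open>The order of \<open>y\<close> is at least 8, so its totient contributes a
      factor 4; together with the divisor 6 this gives 12.\<close>
    moreover have "euler (cyc y) = 4 * 2 ^ k" using euler_cyc[OF yc] m k totient_prime_power_Suc[OF p, of "Suc (Suc k)"] by simp
    ultimately have "4 dvd euler F" by (metis dvd_mult_left)
    then have "12 dvd euler F" using dvd by presburger
    then have low: "12 \<le> euler F" using euler_pos[OF A F] by (simp add: dvd_imp_le)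
    have "ord z \<noteq> expo F" if "z \<in> R" for z
      using ord_dvd_expo[OF that] eulR(1) False by metis
    then have "{z \<in> F. ord z = expo F} \<subseteq> F - R" by auto
    then have "euler F \<le> card (F - R)" unfolding euler_def using finF by (intro card_mono) auto
    also have "\<dots> = 8" using RF finF cF cR finite_subset by (subst card_Diff_subset) auto
    finally show False using low by simp
  next
    case True
    then have ex: "expo F = 4" using e4 dvd_antisym by blast
    have d4: "d dvd 4 \<Longrightarrow> \<not> d dvd 2 \<Longrightarrow> d = 4" for d :: nat
    proof -
      assume d: "d dvd 4" "\<not> d dvd 2"
      have "d \<le> 4" using d(1) by (intro dvd_imp_le) auto
      then have "d \<in> {0,1,2,3,4}" by auto
      then show "d = 4" using d by auto
    qed
    have o4: "ord x = 4 \<longleftrightarrow> x [^] (2::nat) \<noteq> \<one>" if "x \<in> F" for x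
      using ord_dvd_expo[OF that] ex d4 pow_eq_id sub_mem[OF F that] by auto
    \<comment> \<open>Otherwise 16 - 2 = 14 elements of \<open>F\<close> would have order 4, and 6
      does not divide 14.\<close>
    have "\<exists>y\<in>F - R. y [^] (2::nat) = \<one>"
    proof (rule ccontr)
      assume "\<not> ?thesis"
      then have "{x \<in> F. ord x = 4} = F - {x \<in> R. x [^] (2::nat) = \<one>}" using o4 RF by auto
      then have "euler F = 14" using c2 cF finF RF by (simp add: euler_def ex card_Diff_subset finite_subset subset_iff)
      then show False using dvd by simp
    qed
    then obtain y where y: "y \<in> F" "y \<notin> R" "y [^] (2::nat) = \<one>" by blast
    have one: "\<one> \<in> {x \<in> R. x [^] (2::nat) = \<one>}" using sR by (simp add: subgroup.one_closed)
    then obtain z where z: "{x \<in> R. x [^] (2::nat) = \<one>} = {\<one>, z}" "z \<noteq> \<one>"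
      using c2 unfolding card_2_iff by (metis insertE insert_commute singletonD)
    have zR: "z \<in> R" "z [^] (2::nat) = \<one>" using z by auto
    have zc: "z \<in> carrier G" and yc: "y \<in> carrier G" using zR y sR F sub_mem by auto
    \<comment> \<open>Since \<open>F\<close> normalizes \<open>R\<close>, the element
      \<open>y\<close> commutes with the only involution \<open>z\<close> of \<open>R\<close>. The
      two span an elementary group of order 4, which by \<open>elementary_maximal\<close> is all of
      \<open>S\<close>; but \<open>S\<close> contains \<open>R\<close>.\<close>
    have "F \<subseteq> {h \<in> carrier G. normalizes h R}" unfolding F_def
    proof (rule adjoin_least[OF normalizer_subgroup])
      show "R \<subseteq> carrier G" using sR subgroup.subset by blast
      then show "R \<subseteq> {h \<in> carrier G. normalizes h R}"
        using sR by (auto simp: normalizes_def subgroup.m_closed subgroup.m_inv_closed)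
    qed (use gc g in simp)
    then have "y \<otimes> z \<otimes> inv y \<in> R" using y(1) zR(1) by (auto simp: normalizes_def)
    moreover have "(y \<otimes> z \<otimes> inv y) [^] (2::nat) = \<one>" using conj_pow[OF yc zc, of 2] zR(2) yc by simp
    moreover have "y \<otimes> z \<otimes> inv y \<noteq> \<one>" using z(2) ord_conj[OF yc zc] ord_eq_1 zc yc by (metis inv_closed m_closed)
    ultimately have "y \<otimes> z \<otimes> inv y = z" using z(1) by blast
    then have c: "z \<otimes> y = y \<otimes> z" using conj_commute yc zc by simp
    have "ord z dvd 2" "ord z \<noteq> 1" using zR(2) pow_eq_id[OF zc] z(2) ord_eq_1[OF zc] by auto
    then have oz: "ord z = 2" using p by (metis prime_nat_iff)
    have "y \<notin> cyc z" using y(2) cyc_sub[OF sR zR(1)] by blast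
    then have "elementary 2 (adjoin (cyc z) y)" using adjoin_elementary[OF p zc oz yc y(3) _ c] by simp
    moreover have "adjoin (cyc z) y \<subseteq> S"
      using adjoin_least[OF S(1)] cyc_sub[OF S(1)] zR(1) R(2) FS y(1) by blast
    ultimately have "card S = 4" using elementary_maximal[OF D A S] by (auto simp: elementary_def)
    then show False using card_mono[OF finite_subgroup[OF S(1)] R(2)] cR by simp
  qed
qed

text \<open>A noncyclic subgroup of least order has only cyclic proper subgroups, so
  \<open>minimal_noncyclic\<close> identifies it, and the two maximality lemmas make it equal to
  \<open>S\<close>.\<close>

lemma p_subgroup_types:
  assumes D: euler_monotone and A: exp_attained and p: "prime p" and S: "subgroup S G" "card S = p ^ n"
  shows "is_cyclic S \<or> elementary p S \<or> quaternionic S"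
proof (cases "is_cyclic S")
  case False
  let ?Q = "\<lambda>R. subgroup R G \<and> R \<subseteq> S \<and> \<not> is_cyclic R"
  have "?Q S" using S False by blast
  then obtain R where R: "?Q R" "\<And>T. ?Q T \<Longrightarrow> card R \<le> card T"
    using ex_has_least_nat[of ?Q S card] by blast
  have "card R dvd p ^ n" using card_sub_dvd[of R S] R(1) S by simp
  then obtain k where k: "card R = p ^ k" using p by (metis divides_primepow_nat)
  have "is_cyclic T" if "subgroup T G" "T \<subset> R" for T
  proof (rule ccontr)
    assume "\<not> is_cyclic T"
    then have "card R \<le> card T" using R that by blast
    then show False using that R(1) finite_subgroup psubset_card_mono by (metis leD)
  qed
  then have "elementary p R \<or> p = 2 \<and> quaternionic R" using minimal_noncyclic[OF p _ k] R(1) by blast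
  then show ?thesis
  proof
    assume "elementary p R"
    then show ?thesis using elementary_maximal[OF D A S] R(1) by blast
  next
    assume q: "p = 2 \<and> quaternionic R"
    then have "quaternion_like R" using R(1) quaternionic_iso_Q8 iso_Q8_quaternion_like by blast
    then have "R = S" using quaternion_maximal[OF D A S(1)] S(2) q R(1) by blast
    then show ?thesis using q by blast
  qed
qed simp

section \<open>Groups whose elements of coprime orders commute\<close>

text \<open>For finite groups this is a form of nilpotency that passes to subgroups at once.\<close>

definition comm_coprime :: "'a set \<Rightarrow> bool"
  where "comm_coprime S \<longleftrightarrow> (\<forall>a\<in>S. \<forall>b\<in>S. coprime (ord a) (ord b) \<longrightarrow> a \<otimes> b = b \<otimes> a)"

text \<open>In general only a set; once coprime orders commute it is the Sylow
  \<open>p\<close>-subgroup (\<open>p_elements_subgroup\<close>).\<close>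

definition p_elements :: "nat \<Rightarrow> 'a set \<Rightarrow> 'a set"
  where "p_elements p S = {x \<in> S. \<exists>i. ord x = p ^ i}"

lemma comm_coprimeD: "comm_coprime S \<Longrightarrow> a \<in> S \<Longrightarrow> b \<in> S \<Longrightarrow> coprime (ord a) (ord b) \<Longrightarrow> a \<otimes> b = b \<otimes> a"
  unfolding comm_coprime_def by blast

lemma ord_pow_dvd: "a \<in> carrier G \<Longrightarrow> ord (a [^] (n::nat)) dvd ord a"
  by (metis nat_pow_closed nat_pow_one nat_pow_pow mult.commute pow_eq_id pow_ord_eq_1)

lemma centralizer_subgroup: "b \<in> carrier G \<Longrightarrow> subgroup {x \<in> carrier G. x \<otimes> b = b \<otimes> x} G"
  by (rule closed_imp_subgroup) (auto simp: m_assoc, metis m_assoc)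

text \<open>\<open>gen_prime_powers\<close> is used twice, in the centralizer of \<open>b\<close>
  and in that of a power of \<open>a\<close>, so that only prime power orders remain.\<close>

lemma comm_coprimeI:
  assumes S: "subgroup S G"
    and comm: "\<And>p q i j a b. prime p \<Longrightarrow> prime q \<Longrightarrow> p \<noteq> q \<Longrightarrow> a \<in> S \<Longrightarrow> b \<in> S
      \<Longrightarrow> ord a = p ^ i \<Longrightarrow> ord b = q ^ j \<Longrightarrow> a \<otimes> b = b \<otimes> a"
  shows "comm_coprime S"
  unfolding comm_coprime_def
proof (intro ballI impI)
  fix a b assume ab: "a \<in> S" "b \<in> S" "coprime (ord a) (ord b)"
  have c: "a \<in> carrier G" "b \<in> carrier G" using ab sub_mem[OF S] by auto
  have "a \<in> {x \<in> carrier G. x \<otimes> b = b \<otimes> x}"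
  proof (rule gen_prime_powers[OF centralizer_subgroup[OF c(2)] c(1)])
    fix p n i assume p: "prime p" "ord (a [^] (n::nat)) = p ^ i"
    have ac: "a [^] n \<in> carrier G" using c by simp
    have "b \<in> {x \<in> carrier G. x \<otimes> a [^] n = a [^] n \<otimes> x}"
    proof (rule gen_prime_powers[OF centralizer_subgroup[OF ac] c(2)])
      fix q m j assume q: "prime q" "ord (b [^] (m::nat)) = q ^ j"
      have "a [^] n \<otimes> b [^] m = b [^] m \<otimes> a [^] n"
      proof (cases "p = q")
        case True
        \<comment> \<open>For equal primes, coprimality makes one of the two powers trivial.\<close>
        have "coprime (p ^ i) (p ^ j)"
          using ab(3) ord_pow_dvd[OF c(1), of n] ord_pow_dvd[OF c(2), of m] p(2) q(2) True
          by (metis coprime_divisors)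
        then have "p ^ i = 1 \<or> p ^ j = 1" using p(1) by (auto simp: coprime_power_left_iff coprime_power_right_iff)
        then have "a [^] n = \<one> \<or> b [^] m = \<one>" using p(2) q(2) True ord_eq_1 c by (metis nat_pow_closed)
        then show ?thesis using c by auto
      next
        case False
        then show ?thesis using comm[OF p(1) q(1) False] pow_mem[OF S] ab p(2) q(2) by blast
      qed
      then show "b [^] m \<in> {x \<in> carrier G. x \<otimes> a [^] n = a [^] n \<otimes> x}" using c by simp
    qed
    then show "a [^] n \<in> {x \<in> carrier G. x \<otimes> b = b \<otimes> x}" using c by simp
  qed
  then show "a \<otimes> b = b \<otimes> a" by simp
qed

lemma subgroup_Int: "subgroup H G \<Longrightarrow> subgroup K G \<Longrightarrow> subgroup (H \<inter> K) G"
  by (rule subgroups_Inter_pair)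

text \<open>Every prime power in \<open>card T\<close> divides \<open>card N\<close>, hence so does
  \<open>card T\<close>. With a normalizer as \<open>N\<close>, only Sylow subgroups need to be
  inspected.\<close>

lemma sylow_generate:
  assumes N: "subgroup N G" "N \<subseteq> T" and T: "subgroup T G"
    and P: "\<And>p. prime p \<Longrightarrow> \<exists>P. subgroup P G \<and> P \<subseteq> N \<and> card P = p ^ multiplicity p (card T)"
  shows "N = T"
proof -
  have "card T dvd card N"
  proof (rule multiplicity_le_imp_dvd)
    show "card T \<noteq> 0" using card_sub_pos[OF T] by simp
    fix p :: nat assume p: "prime p"
    obtain P where "subgroup P G" "P \<subseteq> N" "card P = p ^ multiplicity p (card T)" using P[OF p] by blast
    then have "p ^ multiplicity p (card T) dvd card N" using card_sub_dvd N by metis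
    then show "multiplicity p (card T) \<le> multiplicity p (card N)"
      using card_sub_pos[OF N(1)] p by (intro multiplicity_geI) auto
  qed
  then have "card T \<le> card N" using card_sub_pos[OF N(1)] by (simp add: dvd_imp_le)
  then show ?thesis using N(2) finite_subgroup[OF T] by (simp add: card_seteq)
qed

lemma normalizes_self: "subgroup H G \<Longrightarrow> h \<in> H \<Longrightarrow> normalizes h H"
  by (simp add: normalizes_def subgroup.m_closed subgroup.m_inv_closed)

lemma commute_conj: "x \<in> carrier G \<Longrightarrow> h \<in> carrier G \<Longrightarrow> x \<otimes> h = h \<otimes> x \<Longrightarrow> x \<otimes> h \<otimes> inv x = h"
  by (simp add: m_assoc)

text \<open>A Sylow \<open>p\<close>-subgroup \<open>P\<close> is centralized by Sylow subgroups for
  other primes and normalized by itself, so \<open>sylow_generate\<close> makes it normal in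
  \<open>T\<close>. A \<open>p\<close>-element outside \<open>P\<close> would then extend it to a
  larger \<open>p\<close>-subgroup.\<close>

lemma p_elements_subgroup:
  assumes T: "subgroup T G" "comm_coprime T" and p: "prime p"
  shows "subgroup (p_elements p T) G" "card (p_elements p T) = p ^ multiplicity p (card T)"
proof -
  let ?m = "multiplicity p (card T)"
  obtain P where P: "subgroup P G" "P \<subseteq> T" "card P = p ^ ?m"
    using sub_sylow[OF p T(1) multiplicity_dvd] by blast
  have Pc: "P \<subseteq> carrier G" using P subgroup.subset by blast
  have ordP: "\<exists>i. ord x = p ^ i" if "x \<in> P" for x
    using ord_dvd_card[OF P(1) that] P(3) p by (metis divides_primepow_nat)
  let ?N = "{g \<in> carrier G. normalizes g P} \<inter> T"
  have N: "subgroup ?N G" using normalizer_subgroup[OF Pc] T subgroup_Int by blast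
  have "?N = T"
  proof (rule sylow_generate[OF N _ T(1)])
    fix r :: nat assume r: "prime r"
    show "\<exists>R. subgroup R G \<and> R \<subseteq> ?N \<and> card R = r ^ multiplicity r (card T)"
    proof (cases "r = p")
      case True
      then show ?thesis using P Pc normalizes_self[OF P(1)] by auto
    next
      case False
      obtain R where R: "subgroup R G" "R \<subseteq> T" "card R = r ^ multiplicity r (card T)"
        using sub_sylow[OF r T(1) multiplicity_dvd] by blast
      have "normalizes x P" if x: "x \<in> R" for x
        unfolding normalizes_def
      proof
        fix h assume h: "h \<in> P"
        obtain i where i: "ord h = p ^ i" using ordP[OF h] by blast
        obtain j where j: "ord x = r ^ j" using ord_dvd_card[OF R(1) x] R(3) r by (metis divides_primepow_nat)
        have "coprime (ord x) (ord h)" using i j r p False coprime_prime_powers by simp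
        then have "x \<otimes> h = h \<otimes> x" using comm_coprimeD[OF T(2)] x h R P by blast
        then show "x \<otimes> h \<otimes> inv x \<in> P" using commute_conj x h sub_mem[OF R(1)] sub_mem[OF P(1)] by simp
      qed
      then show ?thesis using R sub_mem[OF R(1)] by blast
    qed
  qed simp
  then have nT: "normalizes g P" if "g \<in> T" for g using that by blast
  have "p_elements p T \<subseteq> P"
  proof
    fix x assume x: "x \<in> p_elements p T"
    show "x \<in> P"
    proof (rule ccontr)
      assume "x \<notin> P"
      have xT: "x \<in> T" "x \<in> carrier G" using x sub_mem[OF T(1)] by (auto simp: p_elements_def)
      obtain i where "ord x = p ^ i" using x by (auto simp: p_elements_def)
      then obtain n :: nat where n: "x [^] n \<notin> P" "(x [^] n) [^] p \<in> P"
        using prime_step[OF P(1) xT(2) \<open>x \<notin> P\<close>] by blast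
      let ?y = "x [^] n"
      have y: "?y \<in> T" "?y \<in> carrier G" using xT pow_mem[OF T(1)] by auto
      have "card (adjoin P ?y) = p ^ Suc ?m" using adjoin_card_prime[OF P(1) y(2) n(1) p n(2)] P(3) by simp
      moreover have "card (adjoin P ?y) dvd card T"
        using card_sub_dvd[OF adjoin_subgroup[OF P(1) y(2) nT[OF y(1)]] T(1)] adjoin_least[OF T(1) P(2) y(1)] by simp
      ultimately have "p ^ Suc ?m dvd card T" by metis
      then have "Suc ?m \<le> ?m" using card_sub_pos[OF T(1)] p by (intro multiplicity_geI) auto
      then show False by simp
    qed
  qed
  moreover have "P \<subseteq> p_elements p T" using P ordP by (auto simp: p_elements_def)
  ultimately have "p_elements p T = P" by blast
  then show "subgroup (p_elements p T) G" "card (p_elements p T) = p ^ ?m" using P by auto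
qed

lemma p_elements_normalized: "subgroup T G \<Longrightarrow> g \<in> T \<Longrightarrow> normalizes g (p_elements p T)"
  unfolding normalizes_def p_elements_def
  using ord_conj sub_mem by (auto simp: subgroup.m_closed subgroup.m_inv_closed)

text \<open>For some prime \<open>p\<close> a \<open>p\<close>-element of \<open>T\<close> lies
  outside \<open>H\<close>. A new \<open>p\<close>-element that normalizes the \<open>p\<close>-part
  of \<open>H\<close> commutes with the elements of \<open>H\<close> of order prime to
  \<open>p\<close>, and so normalizes all of \<open>H\<close>.\<close>

lemma comm_coprime_growth:
  assumes T: "subgroup T G" "comm_coprime T" and H: "subgroup H G" "H \<subset> T"
  shows "\<exists>g\<in>T - H. normalizes g H"
proof -
  obtain a where a: "a \<in> T" "a \<notin> H" using H by blast
  have ac: "a \<in> carrier G" using a sub_mem[OF T(1)] by blast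
  obtain p n i where p: "prime p" "ord (a [^] (n::nat)) = p ^ i" "a [^] n \<notin> H"
    using gen_prime_powers[OF H(1) ac] a by blast
  let ?P = "p_elements p T"
  note P = p_elements_subgroup[OF T p(1)]
  have "a [^] n \<in> ?P" using p(2) pow_mem[OF T(1) a(1)] by (auto simp: p_elements_def)
  then have "H \<inter> ?P \<subset> ?P" using p(3) by blast
  then obtain g where g: "g \<in> ?P" "g \<notin> H" "normalizes g (H \<inter> ?P)"
    using p_growth[OF p(1) P subgroup_Int[OF H(1) P(1)]] by auto
  have gT: "g \<in> T" and gc: "g \<in> carrier G" using g(1) sub_mem[OF T(1)] by (auto simp: p_elements_def)
  obtain k where k: "ord g = p ^ k" using g(1) by (auto simp: p_elements_def)
  have Hc: "H \<subseteq> carrier G" using H subgroup.subset by blast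
  have K: "subgroup {h \<in> carrier G. g \<otimes> h \<otimes> inv g \<in> H} G"
    by (rule closed_imp_subgroup) (use gc H(1) in \<open>auto simp: conj_hom subgroup.m_closed subgroup.one_closed\<close>)
  have "normalizes g H"
    unfolding normalizes_def
  proof
    fix h assume h: "h \<in> H"
    have "h \<in> {h \<in> carrier G. g \<otimes> h \<otimes> inv g \<in> H}"
    proof (rule gen_prime_powers[OF K])
      show "h \<in> carrier G" using h Hc by blast
      fix r m j assume r: "prime r" "ord (h [^] (m::nat)) = r ^ j"
      have hm: "h [^] m \<in> H" "h [^] m \<in> T" "h [^] m \<in> carrier G" using pow_mem[OF H(1) h] H Hc by auto
      have "g \<otimes> h [^] m \<otimes> inv g \<in> H"
      proof (cases "r = p")
        case True
        then have "h [^] m \<in> H \<inter> ?P" using hm r(2) by (auto simp: p_elements_def)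
        then show ?thesis using g(3) by (auto simp: normalizes_def)
      next
        case False
        then have "coprime (ord g) (ord (h [^] m))" using k r p(1) coprime_prime_powers by simp
        then have "g \<otimes> h [^] m = h [^] m \<otimes> g" using comm_coprimeD[OF T(2) gT hm(2)] by blast
        then show ?thesis using commute_conj[OF gc hm(3)] hm(1) by simp
      qed
      then show "h [^] m \<in> {h \<in> carrier G. g \<otimes> h \<otimes> inv g \<in> H}" using hm by simp
    qed
    then show "g \<otimes> h \<otimes> inv g \<in> H" by simp
  qed
  then show ?thesis using g gT by blast
qed

section \<open>Normal maximal subgroups\<close>

definition maximal_in :: "'a set \<Rightarrow> 'a set \<Rightarrow> bool"
  where "maximal_in M S \<longleftrightarrow> subgroup M G \<and> M \<subset> S \<and> (\<forall>K. subgroup K G \<longrightarrow> M \<subseteq> K \<longrightarrow> K \<subset> S \<longrightarrow> K = M)"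

lemma ex_maximal:
  assumes S: "subgroup S G" and H: "subgroup H G" "H \<subset> S"
  shows "\<exists>M. maximal_in M S \<and> H \<subseteq> M"
proof -
  let ?Q = "\<lambda>K. subgroup K G \<and> H \<subseteq> K \<and> K \<subset> S"
  have "\<forall>K. ?Q K \<longrightarrow> card K < card S" using finite_subgroup[OF S] by (auto intro: psubset_card_mono)
  moreover have "?Q H" using H by simp
  ultimately have "\<exists>M. ?Q M \<and> (\<forall>K. ?Q K \<longrightarrow> card K \<le> card M)" using ex_has_greatest_nat[of ?Q H card "card S"] by simp
  then obtain M where M: "?Q M" "\<And>K. ?Q K \<Longrightarrow> card K \<le> card M" by blast
  have "K = M" if K: "subgroup K G" "M \<subseteq> K" "K \<subset> S" for K
    using M(2)[of K] K M(1) card_seteq[OF finite_subgroup[OF K(1)] K(2)] by auto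
  then show ?thesis using M(1) by (auto simp: maximal_in_def)
qed

section \<open>Conjugates of a subgroup and the number of elements they cover\<close>

definition conj_set :: "'a \<Rightarrow> 'a set \<Rightarrow> 'a set"
  where "conj_set g M = (\<lambda>m. g \<otimes> m \<otimes> inv g) ` M"

lemma conj_set_mult: "a \<in> carrier G \<Longrightarrow> b \<in> carrier G \<Longrightarrow> M \<subseteq> carrier G \<Longrightarrow> conj_set a (conj_set b M) = conj_set (a \<otimes> b) M"
  by (auto simp: conj_set_def conj_mult image_image subset_iff intro!: image_cong)

lemma conj_set_one: "M \<subseteq> carrier G \<Longrightarrow> conj_set \<one> M = M"
  by (force simp: conj_set_def)

lemma conj_set_inv: "a \<in> carrier G \<Longrightarrow> M \<subseteq> carrier G \<Longrightarrow> conj_set (inv a) (conj_set a M) = M"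
  by (simp add: conj_set_mult conj_set_one)

lemma conj_set_inv': "a \<in> carrier G \<Longrightarrow> M \<subseteq> carrier G \<Longrightarrow> conj_set a (conj_set (inv a) M) = M"
  by (simp add: conj_set_mult conj_set_one)

lemma conj_set_subgroup: "g \<in> carrier G \<Longrightarrow> subgroup M G \<Longrightarrow> subgroup (conj_set g M) G"
proof (rule closed_imp_subgroup)
  assume g: "g \<in> carrier G" and M: "subgroup M G"
  have Mc: "M \<subseteq> carrier G" using M subgroup.subset by blast
  show "conj_set g M \<subseteq> carrier G" using g Mc by (auto simp: conj_set_def)
  show "\<one> \<in> conj_set g M" unfolding conj_set_def
    by (rule image_eqI[of _ _ \<one>]) (use g M in \<open>auto simp: subgroup.one_closed\<close>)
  fix x y assume "x \<in> conj_set g M" "y \<in> conj_set g M"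
  then obtain m n where m: "m \<in> M" "n \<in> M" "x = g \<otimes> m \<otimes> inv g" "y = g \<otimes> n \<otimes> inv g" by (auto simp: conj_set_def)
  then have "x \<otimes> y = g \<otimes> (m \<otimes> n) \<otimes> inv g" using g Mc by (simp add: conj_hom subset_iff)
  then show "x \<otimes> y \<in> conj_set g M" using m M unfolding conj_set_def by (auto intro: subgroup.m_closed)
qed

lemma conj_set_mono: "A \<subseteq> B \<Longrightarrow> conj_set g A \<subseteq> conj_set g B"
  by (auto simp: conj_set_def)

lemma conj_set_sub: "subgroup S G \<Longrightarrow> g \<in> S \<Longrightarrow> M \<subseteq> S \<Longrightarrow> conj_set g M \<subseteq> S"
  by (auto simp: conj_set_def subset_iff subgroup.m_closed subgroup.m_inv_closed)

lemma conj_set_maximal: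
  assumes S: "subgroup S G" and M: "maximal_in M S" and g: "g \<in> S"
  shows "maximal_in (conj_set g M) S"
proof -
  have gc: "g \<in> carrier G" and gi: "inv g \<in> S" "inv g \<in> carrier G"
    using g S sub_mem by (auto simp: subgroup.m_inv_closed)
  have sM: "subgroup M G" "M \<subset> S" and mx: "\<And>K. subgroup K G \<Longrightarrow> M \<subseteq> K \<Longrightarrow> K \<subset> S \<Longrightarrow> K = M"
    using M by (auto simp: maximal_in_def)
  have Mc: "M \<subseteq> carrier G" using sM subgroup.subset by blast
  have psub: "conj_set h K \<subset> S" if "K \<subset> S" "h \<in> S" for K h
  proof -
    have "card K < card S" using that finite_subgroup[OF S] psubset_card_mono by blast
    moreover have "card (conj_set h K) \<le> card K"
      unfolding conj_set_def using that finite_subgroup[OF S] by (auto intro!: card_image_le intro: finite_subset)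
    ultimately show ?thesis using conj_set_sub[OF S that(2)] that(1) by auto
  qed
  have "conj_set g M \<subset> S" using psub sM g by blast
  moreover have "K = conj_set g M" if K: "subgroup K G" "conj_set g M \<subseteq> K" "K \<subset> S" for K
  proof -
    have "M \<subseteq> conj_set (inv g) K" using conj_set_mono[OF K(2), of "inv g"] conj_set_inv[OF gc Mc] by simp
    then have "conj_set (inv g) K = M" using mx conj_set_subgroup[OF gi(2) K(1)] psub[OF K(3) gi(1)] by blast
    then show ?thesis using conj_set_inv'[OF gc, of K] subgroup.subset[OF K(1)] by simp
  qed
  ultimately show ?thesis using conj_set_subgroup[OF gc sM(1)] by (auto simp: maximal_in_def)
qed

lemma normalizes_conj_set: "normalizes g M \<longleftrightarrow> conj_set g M \<subseteq> M"
  by (auto simp: normalizes_def conj_set_def)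

lemma inv_mult_cancel [simp]:
  assumes "x \<in> carrier G" "y \<in> carrier G"
  shows "inv x \<otimes> (x \<otimes> y) = y" "x \<otimes> (inv x \<otimes> y) = y"
  using assms by (simp_all add: m_assoc[symmetric])

text \<open>Double counting of the pairs \<open>(g, m)\<close>. By \<open>dis\<close>, the
  \<open>g\<close> that occur with one conjugate element form a single left coset of
  \<open>M\<close>, and \<open>g\<close> determines \<open>m\<close>; so every fibre has
  \<open>card M\<close> elements.\<close>

lemma card_conjugates:
  assumes S: "subgroup S G" and M: "subgroup M G" "M \<subseteq> S" and D: "D \<subseteq> M" "\<And>g. g \<in> S \<Longrightarrow> normalizes g D"
    and dis: "\<And>g h y. g \<in> S \<Longrightarrow> h \<in> S \<Longrightarrow> y \<in> conj_set g M \<Longrightarrow> y \<in> conj_set h M \<Longrightarrow> y \<notin> D \<Longrightarrow> inv g \<otimes> h \<in> M"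
  shows "card S * (card M - card D) = card ((\<lambda>(g, m). g \<otimes> m \<otimes> inv g) ` (S \<times> (M - D))) * card M"
proof -
  let ?f = "\<lambda>(g, m). g \<otimes> m \<otimes> inv g" and ?A = "S \<times> (M - D)"
  have Sc: "S \<subseteq> carrier G" using S subgroup.subset by blast
  have Mc: "M \<subseteq> carrier G" using M subgroup.subset by blast
  have fin: "finite S" "finite M" "finite D" using finite_subgroup S M D finite_subset by blast+
  have notD: "g \<otimes> m \<otimes> inv g \<notin> D" if "g \<in> S" "m \<in> M - D" for g m
  proof
    assume a: "g \<otimes> m \<otimes> inv g \<in> D"
    have c: "g \<in> carrier G" "m \<in> carrier G" using that Sc Mc by auto
    have "normalizes (inv g) D" using D(2) that S subgroup.m_inv_closed by metis
    then have "inv g \<otimes> (g \<otimes> m \<otimes> inv g) \<otimes> inv (inv g) \<in> D" using a by (simp add: normalizes_def)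
    then have "m \<in> D" using c by (simp add: m_assoc)
    then show False using that by blast
  qed
  have fiber: "card {x \<in> ?A. ?f x = y} = card M" if y: "y \<in> ?f ` ?A" for y
  proof -
    obtain g0 m0 where 0: "g0 \<in> S" "m0 \<in> M - D" "y = g0 \<otimes> m0 \<otimes> inv g0" using y by auto
    have c0: "g0 \<in> carrier G" "m0 \<in> carrier G" using 0 Sc Mc by auto
    have yD: "y \<notin> D" using notD 0 by blast
    have yc: "y \<in> carrier G" using 0 c0 by simp
    let ?F = "{x \<in> ?A. ?f x = y}"
    have solve: "m = inv g \<otimes> y \<otimes> g" if "g \<in> S" "m \<in> M - D" "g \<otimes> m \<otimes> inv g = y" for g m
    proof -
      have "g \<in> carrier G" "m \<in> carrier G" using that Sc Mc by auto
      then show ?thesis using that(3) by (auto simp: m_assoc inv_solve_left)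
    qed
    have "inj_on fst ?F" using solve by (auto simp: inj_on_def)
    then have "card ?F = card (fst ` ?F)" by (rule card_image[symmetric])
    also have "fst ` ?F = (\<lambda>n. g0 \<otimes> n) ` M"
    proof
      show "fst ` ?F \<subseteq> (\<lambda>n. g0 \<otimes> n) ` M"
      proof clarsimp
        fix g m assume g: "g \<in> S" "m \<in> M" "m \<notin> D" "y = g \<otimes> m \<otimes> inv g"
        have "y \<in> conj_set g M" unfolding conj_set_def using g(2,4) by blast
        moreover have "y \<in> conj_set g0 M" unfolding conj_set_def using 0 by blast
        ultimately have "inv g0 \<otimes> g \<in> M" using dis[of g0 g y] g 0 yD by blast
        moreover have "g = g0 \<otimes> (inv g0 \<otimes> g)" using c0 g Sc by (simp add: m_assoc[symmetric] subset_iff)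
        ultimately show "g \<in> (\<lambda>n. g0 \<otimes> n) ` M" by blast
      qed
      show "(\<lambda>n. g0 \<otimes> n) ` M \<subseteq> fst ` ?F"
      proof
        fix g assume "g \<in> (\<lambda>n. g0 \<otimes> n) ` M"
        then obtain n where n: "n \<in> M" "g = g0 \<otimes> n" by blast
        have nc: "n \<in> carrier G" using n Mc by blast
        let ?m = "inv n \<otimes> m0 \<otimes> n"
        have gS: "g \<in> S" using n 0 M(2) S by (auto intro: subgroup.m_closed)
        have mM: "?m \<in> M" using n 0 M(1) by (simp add: subgroup.m_closed subgroup.m_inv_closed)
        have e: "g \<otimes> ?m \<otimes> inv g = y"
          using n nc c0 0 by (simp add: inv_mult_group m_assoc)
        have "?m \<notin> D"
        proof
          assume "?m \<in> D"
          then have "g \<otimes> ?m \<otimes> inv g \<in> D" using D(2)[OF gS] by (simp add: normalizes_def)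
          then show False using e yD by simp
        qed
        then have "(g, ?m) \<in> ?F" using gS mM e by simp
        then show "g \<in> fst ` ?F" by force
      qed
    qed
    also have "card ((\<lambda>n. g0 \<otimes> n) ` M) = card M" using c0 Mc by (intro card_image inj_onI) (auto simp: subset_iff)
    finally show ?thesis .
  qed
  have "card ?A = (\<Sum>y\<in>?f ` ?A. card {x \<in> ?A. ?f x = y})"
    using sum.image_gen[of ?A "\<lambda>_. 1::nat" ?f] fin by simp
  also have "\<dots> = card (?f ` ?A) * card M" using fiber by simp
  finally show ?thesis using fin D(1) by (simp add: card_cartesian_product card_Diff_subset)
qed

text \<open>The numbers are the orders of \<open>S\<close>, \<open>M\<close>, \<open>D\<close> and
  the size of the union of the conjugates of \<open>M\<close> outside \<open>D\<close>. The first
  equation reads \<open>u = s - s * d / m\<close>; here \<open>d / m\<close> is at most one half,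
  and \<open>s * d / m\<close> exceeds \<open>d\<close>.\<close>

lemma counting_arith:
  fixes s m d u :: nat
  assumes "s * (m - d) = u * m" "d dvd m" "d < m" "m dvd s" "m < s" "0 < d"
  shows "s \<le> 2 * u" "u < s - d"
proof -
  obtain k where k: "m = d * k" using assms(2) by blast
  have "2 \<le> k" using assms(3) k by (cases k; cases "k - 1") auto
  then have md: "2 * d \<le> m" using k by (simp add: mult.commute)
  have "s * m \<le> s * (2 * (m - d))" using md by (intro mult_le_mono) auto
  also have "\<dots> = 2 * u * m" using assms(1) by simp
  finally show "s \<le> 2 * u" using assms(3) by simp
  have "u * m + s * d = s * m" using assms(3) by (simp flip: assms(1) add_mult_distrib2)
  moreover have "d \<le> s" using assms(3,5) by simp
  then have "(s - d) * m + d * m = s * m" by (simp flip: add_mult_distrib)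
  moreover have "d * m < s * d" using assms(5,6) by (simp add: mult.commute)
  ultimately have "u * m < (s - d) * m" by linarith
  then show "u < s - d" by simp
qed

text \<open>
  The largest intersection \<open>D\<close> of two maximal subgroups is normal, and distinct maximal subgroups above
  \<open>D\<close> meet exactly in \<open>D\<close>. If no maximal subgroup were normal, the conjugates of one of them would cover at
  least half of \<open>S\<close>, but not all of \<open>S - D\<close>, and a second conjugacy class would not fit.
\<close>

lemma ex_normal_maximal:
  assumes S: "subgroup S G" "S \<noteq> {\<one>}"
    and cc: "\<And>T. subgroup T G \<Longrightarrow> T \<subset> S \<Longrightarrow> comm_coprime T"
  shows "\<exists>M. maximal_in M S \<and> (\<forall>g\<in>S. normalizes g M)"
proof (rule ccontr)
  assume "\<not> ?thesis"
  then have neg: "\<exists>g\<in>S. \<not> normalizes g M" if "maximal_in M S" for M using that by blast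
  have Sc: "S \<subseteq> carrier G" using S subgroup.subset by blast
  have finS: "finite S" using S finite_subgroup by blast
  have mxs: "subgroup M G" "M \<subset> S" "M \<subseteq> carrier G" "\<And>K. subgroup K G \<Longrightarrow> M \<subseteq> K \<Longrightarrow> K \<subset> S \<Longrightarrow> K = M"
    if "maximal_in M S" for M
    using that Sc by (auto simp: maximal_in_def)
  \<comment> \<open>A maximal subgroup that is not normal is its own normalizer in
    \<open>S\<close>.\<close>
  have self: "g \<in> M" if M: "maximal_in M S" and g: "g \<in> S" "normalizes g M" for M g
  proof -
    let ?N = "{g \<in> carrier G. normalizes g M} \<inter> S"
    have N: "subgroup ?N G" using normalizer_subgroup mxs[OF M] S subgroup_Int by blast
    have "M \<subseteq> ?N" using mxs[OF M] normalizes_self by auto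
    moreover have "?N \<noteq> S" using neg[OF M] by blast
    ultimately have "?N = M" using mxs(4)[OF M N] by blast
    then show ?thesis using g Sc by blast
  qed
  have "{\<one>} \<subset> S" using S subgroup.one_closed by blast
  then obtain M0 where M0: "maximal_in M0 S" using ex_maximal[OF S(1) triv_subgroup] by blast
  obtain g0 where g0: "g0 \<in> S" "\<not> normalizes g0 M0" using neg[OF M0] by blast
  \<comment> \<open>A pair with the largest intersection is wanted; \<open>M0\<close> and a
    conjugate different from it show that there are pairs at all.\<close>
  let ?Q = "\<lambda>(A, B). maximal_in A S \<and> maximal_in B S \<and> A \<noteq> B"
  let ?c = "\<lambda>(A, B). card (A \<inter> B)"
  have Q0: "?Q (M0, conj_set g0 M0)"
    using M0 conj_set_maximal[OF S(1) M0 g0(1)] g0(2) by (auto simp: normalizes_conj_set)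
  have "?c x < Suc (card S)" if "?Q x" for x
  proof -
    obtain A B where x: "x = (A, B)" by (cases x)
    then have "A \<inter> B \<subseteq> S" using that mxs(2) by blast
    then show ?thesis using x card_mono[OF finS] by (simp add: less_Suc_eq_le)
  qed
  then have "\<exists>x. ?Q x \<and> (\<forall>y. ?Q y \<longrightarrow> ?c y \<le> ?c x)"
    using ex_has_greatest_nat[of ?Q, OF Q0, of ?c "Suc (card S)"] by simp
  then obtain x where x: "?Q x" "\<forall>y. ?Q y \<longrightarrow> ?c y \<le> ?c x" by (elim exE conjE)
  obtain M1 M2 where xe: "x = (M1, M2)" by (cases x)
  have M1: "maximal_in M1 S" and M2: "maximal_in M2 S" and M12: "M1 \<noteq> M2" using x(1) xe by auto
  have big: "card (A \<inter> B) \<le> card (M1 \<inter> M2)" if "maximal_in A S" "maximal_in B S" "A \<noteq> B" for A B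
    using x(2)[THEN spec, of "(A, B)"] that xe by simp
  define D where "D = M1 \<inter> M2"
  have D: "subgroup D G" using subgroup_Int mxs(1) M1 M2 by (simp add: D_def)
  have DS: "D \<subseteq> S" using mxs(2)[OF M1] by (auto simp: D_def)
  have D1: "D \<subset> M1"
    using mxs(4)[OF M1 mxs(1)[OF M2]] mxs(2)[OF M2] M12 by (auto simp: D_def)
  have D2: "D \<subset> M2"
    using mxs(4)[OF M2 mxs(1)[OF M1]] mxs(2)[OF M1] M12 by (auto simp: D_def)
  have Dn: "normalizes g D" if g: "g \<in> S" for g
  proof -
    let ?N = "{g \<in> carrier G. normalizes g D} \<inter> S"
    have Dc: "D \<subseteq> carrier G" using D subgroup.subset by blast
    have N: "subgroup ?N G" using normalizer_subgroup[OF Dc] S subgroup_Int by blast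
    have DN: "D \<subseteq> ?N" using D DS Dc normalizes_self by auto
    have "?N = S"
    proof (rule ccontr)
      assume "?N \<noteq> S"
      then obtain M3 where M3: "maximal_in M3 S" "?N \<subseteq> M3" using ex_maximal[OF S(1) N] by blast
      \<comment> \<open>Coprime orders commute in \<open>M\<close>, so the normalizer of
        \<open>D\<close> in \<open>M\<close> is larger than \<open>D\<close>. As \<open>M3\<close>
        contains that normalizer, it meets \<open>M\<close> in more than \<open>D\<close>, against
        the choice of \<open>D\<close> unless both agree. This applies to \<open>M1\<close> and to
        \<open>M2\<close>.\<close>
      have eq: "M3 = M" if M: "maximal_in M S" "D \<subset> M" for M
      proof (rule ccontr)
        assume ne: "M3 \<noteq> M"
        obtain h where h: "h \<in> M - D" "normalizes h D"
          using comm_coprime_growth[OF mxs(1)[OF M(1)] cc[OF mxs(1,2)[OF M(1)]] D M(2)] by blast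
        have hN: "h \<in> ?N" using h mxs(2,3)[OF M(1)] by auto
        have "insert h D \<subseteq> M3 \<inter> M" using h hN DN M3(2) M(2) by auto
        moreover have "finite (M3 \<inter> M)" using mxs(2)[OF M(1)] finS finite_subset by blast
        ultimately have "card (insert h D) \<le> card (M3 \<inter> M)" by (rule card_mono[rotated])
        moreover have "card (insert h D) = Suc (card D)" using h finite_subgroup[OF D] by simp
        ultimately show False using big[OF M3(1) M(1) ne] by (simp add: D_def)
      qed
      show False using eq[OF M1 D1] eq[OF M2 D2] M12 by simp
    qed
    then show ?thesis using g by blast
  qed
  have uniq: "A = B" if A: "maximal_in A S" "D \<subseteq> A" and B: "maximal_in B S" "D \<subseteq> B" and y: "y \<in> A" "y \<in> B" "y \<notin> D" for A B y
  proof (rule ccontr)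
    assume "A \<noteq> B"
    then have "card (A \<inter> B) \<le> card D" using big[OF A(1) B(1)] by (simp add: D_def)
    moreover have "finite (A \<inter> B)" using mxs(2)[OF A(1)] finS finite_subset by blast
    ultimately have "A \<inter> B = D" using A B by (metis Int_greatest card_seteq)
    then show False using y by blast
  qed
  have DM: "D \<subseteq> conj_set g M" if g: "g \<in> S" and M: "D \<subseteq> M" for g M
  proof -
    have gc: "g \<in> carrier G" "inv g \<in> S" using g S Sc by (auto simp: subgroup.m_inv_closed)
    have "conj_set (inv g) D \<subseteq> D" using Dn[OF gc(2)] normalizes_conj_set by blast
    then have "D \<subseteq> conj_set g D" using conj_set_mono[of _ D g] conj_set_inv'[OF gc(1) subgroup.subset[OF D]] by metis
    then show ?thesis using conj_set_mono[OF M] by blast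
  qed
  define U where "U M = (\<lambda>(g, m). g \<otimes> m \<otimes> inv g) ` (S \<times> (M - D))" for M
  have dis: "inv g \<otimes> h \<in> M" if M: "maximal_in M S" "D \<subseteq> M" and g: "g \<in> S" "h \<in> S"
    and y: "y \<in> conj_set g M" "y \<in> conj_set h M" "y \<notin> D" for M g h y
  proof -
    have c: "g \<in> carrier G" "h \<in> carrier G" and Mc: "M \<subseteq> carrier G" using g Sc mxs(3)[OF M(1)] by auto
    have "conj_set g M = conj_set h M"
      by (rule uniq[OF conj_set_maximal[OF S(1) M(1) g(1)] DM[OF g(1) M(2)] conj_set_maximal[OF S(1) M(1) g(2)] DM[OF g(2) M(2)] y])
    then have "conj_set (inv g) (conj_set h M) = M" using conj_set_inv[OF c(1) Mc] by simp
    then have "conj_set (inv g \<otimes> h) M = M" using conj_set_mult[of "inv g" h M] c Mc by simp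
    then have "normalizes (inv g \<otimes> h) M" by (simp add: normalizes_conj_set)
    moreover have "inv g \<otimes> h \<in> S" using g S by (simp add: subgroup.m_closed subgroup.m_inv_closed)
    ultimately show ?thesis using self[OF M(1)] by blast
  qed
  have US: "U M \<subseteq> S - D" if M: "maximal_in M S" "D \<subseteq> M" for M
  proof
    fix y assume "y \<in> U M"
    then obtain g m where g: "g \<in> S" "m \<in> M" "m \<notin> D" "y = g \<otimes> m \<otimes> inv g" by (auto simp: U_def)
    have m: "m \<in> S" using g mxs(2)[OF M(1)] by blast
    have c: "g \<in> carrier G" "m \<in> carrier G" using g m Sc by auto
    have "y \<notin> D"
    proof
      assume "y \<in> D"
      then have "inv g \<otimes> y \<otimes> inv (inv g) \<in> D"
        using Dn[of "inv g"] g(1) S by (simp add: normalizes_def subgroup.m_inv_closed)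
      then show False using g(3,4) c by (simp add: m_assoc)
    qed
    then show "y \<in> S - D" using g m S by (auto simp: subgroup.m_closed subgroup.m_inv_closed)
  qed
  have count: "card S \<le> 2 * card (U M)" "card (U M) < card S - card D" if M: "maximal_in M S" "D \<subset> M" for M
  proof -
    have "card S * (card M - card D) = card (U M) * card M"
      unfolding U_def
      by (rule card_conjugates[OF S(1) mxs(1)[OF M(1)] _ _ Dn dis]) (use M mxs(2)[OF M(1)] in auto)
    moreover have "card D < card M" using M(2) finite_subgroup[OF mxs(1)[OF M(1)]] psubset_card_mono by blast
    moreover have "card M < card S" using mxs(2)[OF M(1)] finS psubset_card_mono by blast
    moreover have "card D dvd card M" using card_sub_dvd[OF D mxs(1)[OF M(1)]] M by blast
    moreover have "card M dvd card S" using card_sub_dvd[OF mxs(1)[OF M(1)] S(1)] mxs(2)[OF M(1)] by blast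
    ultimately show "card S \<le> 2 * card (U M)" "card (U M) < card S - card D"
      using counting_arith[of "card S" "card M" "card D" "card (U M)"] card_sub_pos[OF D] by simp_all
  qed
  have finSD: "finite (S - D)" using finS by simp
  have cSD: "card (S - D) = card S - card D" using DS finite_subgroup[OF D] by (simp add: card_Diff_subset)
  have "U M1 \<noteq> S - D" using count(2)[OF M1 D1] cSD by auto
  then obtain y where y: "y \<in> S" "y \<notin> D" "y \<notin> U M1" using US[OF M1] D1 by blast
  have yc: "y \<in> carrier G" using y Sc by blast
  let ?K = "adjoin D y"
  have K: "subgroup ?K G" using adjoin_subgroup[OF D yc Dn[OF y(1)]] .
  have KS: "?K \<subseteq> S" using adjoin_least[OF S(1) DS y(1)] .
  show False
  proof (cases "?K = S")
    case True
    \<comment> \<open>Elements of \<open>M1\<close> have the form \<open>d \<otimes> y [^] j\<close>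
      with both factors in \<open>M1\<close>; conjugation by \<open>y\<close> keeps the first in
      \<open>D\<close> and fixes the second. So the self-normalizing \<open>M1\<close> contains
      \<open>y\<close>, and with it all of \<open>S\<close>.\<close>
    have "normalizes y M1"
      unfolding normalizes_def
    proof
      fix m assume m: "m \<in> M1"
      then have "m \<in> ?K" using mxs(2)[OF M1] True by blast
      then obtain d j where d: "d \<in> D" "m = d \<otimes> y [^] (j::nat)" by (auto simp: adjoin_def)
      have c: "d \<in> carrier G" "y [^] j \<in> carrier G" using d DS Sc yc by auto
      have "y [^] j = inv d \<otimes> m" using d(2) c by (simp add: m_assoc[symmetric])
      moreover have "d \<in> M1" using d(1) D1 by blast
      ultimately have yj: "y [^] j \<in> M1" using m mxs(1)[OF M1] by (metis subgroup.m_closed subgroup.m_inv_closed)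
      have "y \<otimes> y [^] j \<otimes> inv y = y [^] j" using commute_conj[of y "y [^] j"] yc by (simp add: nat_pow_Suc2[symmetric])
      then have "y \<otimes> m \<otimes> inv y = (y \<otimes> d \<otimes> inv y) \<otimes> y [^] j" using conj_hom[OF yc c] d(2) by simp
      moreover have "y \<otimes> d \<otimes> inv y \<in> D" using Dn[OF y(1)] d by (simp add: normalizes_def)
      ultimately show "y \<otimes> m \<otimes> inv y \<in> M1" using yj D1 mxs(1)[OF M1] by (auto simp: subgroup.m_closed)
    qed
    then have yM: "y \<in> M1" using self[OF M1 y(1)] by blast
    then have "?K \<subseteq> M1" using adjoin_least[OF mxs(1)[OF M1]] D1 by blast
    then show False using True mxs(2)[OF M1] by blast
  next
    case False
    then obtain M' where M': "maximal_in M' S" "?K \<subseteq> M'" using ex_maximal[OF S(1) K] KS by blast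
    have D': "D \<subseteq> M'" and y': "y \<in> M'"
      using M'(2) adjoin_sup[OF subgroup.subset[OF D] yc] adjoin_mem[OF D yc] by auto
    \<comment> \<open>A common element would make a conjugate of \<open>M1\<close> equal to one of
      \<open>M'\<close>; then \<open>y\<close>, which is in \<open>M'\<close> but not in
      \<open>D\<close>, would lie in a conjugate of \<open>M1\<close>, against its choice.\<close>
    have "U M1 \<inter> U M' = {}"
    proof (rule ccontr)
      assume "U M1 \<inter> U M' \<noteq> {}"
      then obtain w where w: "w \<in> U M1" "w \<in> U M'" by blast
      obtain g m where g: "g \<in> S" "m \<in> M1" "w = g \<otimes> m \<otimes> inv g" using w(1) by (auto simp: U_def)
      obtain h n where h: "h \<in> S" "n \<in> M'" "w = h \<otimes> n \<otimes> inv h" using w(2) by (auto simp: U_def)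
      have c: "g \<in> carrier G" "h \<in> carrier G" using g h Sc by auto
      have wD: "w \<notin> D" using US[OF M1] D1 w by blast
      have w1: "w \<in> conj_set g M1" unfolding conj_set_def using g by blast
      have w2: "w \<in> conj_set h M'" unfolding conj_set_def using h by blast
      have "conj_set g M1 = conj_set h M'"
        by (rule uniq[OF conj_set_maximal[OF S(1) M1 g(1)] DM[OF g(1) psubset_imp_subset[OF D1]]
            conj_set_maximal[OF S(1) M'(1) h(1)] DM[OF h(1) D'] w1 w2 wD])
      then have "conj_set (inv h) (conj_set g M1) = M'" using conj_set_inv[OF c(2) mxs(3)[OF M'(1)]] by simp
      then have "conj_set (inv h \<otimes> g) M1 = M'" using conj_set_mult[of "inv h" g M1] c mxs(3)[OF M1] by simp
      then obtain k where k: "k \<in> M1" "y = (inv h \<otimes> g) \<otimes> k \<otimes> inv (inv h \<otimes> g)" using y' by (auto simp: conj_set_def)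
      have hg: "inv h \<otimes> g \<in> S" using g h S by (simp add: subgroup.m_closed subgroup.m_inv_closed)
      have "k \<notin> D"
        using Dn[OF hg] k(2) y(2) by (auto simp: normalizes_def)
      then have "y \<in> U M1" using k hg by (auto simp: U_def)
      then show False using y by blast
    qed
    moreover have U1: "U M1 \<subseteq> S - D" using US[OF M1] D1 by blast
    moreover have U2: "U M' \<subseteq> S - D" using US[OF M'(1) D'] .
    ultimately have "card (U M1 \<union> U M') = card (U M1) + card (U M')"
      using finSD by (intro card_Un_disjoint) (simp_all add: finite_subset[OF _ finSD])
    moreover have "card (U M1 \<union> U M') \<le> card (S - D)"
      using U1 U2 finSD by (intro card_mono) auto
    moreover have "D \<subset> M'" using D' y' y(2) by blast
    ultimately have "card S \<le> card S - card D"
      using count(1)[OF M1 D1] count(1)[OF M'(1)] cSD by simp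
    then show False using card_sub_pos[OF D] card_sub_pos[OF S(1)] by simp
  qed
qed

end

section \<open>Commutation in coprime orders\<close>

text \<open>The equation \<open>ab\<close> makes \<open>z\<close> the commutator of \<open>a\<close>
  and \<open>b\<close>. As it commutes with both, its powers are the commutators of
  \<open>a [^] k\<close> with \<open>b\<close> and of \<open>a\<close> with \<open>b [^] k\<close>,
  so its order divides both \<open>m\<close> and \<open>n\<close>.\<close>

lemma (in group) central_commutator_coprime:
  assumes c: "a \<in> carrier G" "b \<in> carrier G" "z \<in> carrier G" and ab: "a \<otimes> b = z \<otimes> b \<otimes> a"
    and za: "z \<otimes> a = a \<otimes> z" and zb: "z \<otimes> b = b \<otimes> z"
    and m: "a [^] (m::nat) = \<one>" and n: "b [^] (n::nat) = \<one>" and co: "coprime m n"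
  shows "z = \<one>"
proof -
  have 1: "a [^] k \<otimes> b = z [^] k \<otimes> b \<otimes> a [^] k" for k :: nat
  proof (induction k)
    case (Suc k)
    have zk: "a \<otimes> z [^] k = z [^] k \<otimes> a" using za c group_commutes_pow by metis
    have "a [^] Suc k \<otimes> b = a \<otimes> (a [^] k \<otimes> b)" using c by (simp only: nat_pow_Suc2 m_assoc nat_pow_closed)
    also have "\<dots> = (a \<otimes> z [^] k) \<otimes> b \<otimes> a [^] k" unfolding Suc using c by (simp add: m_assoc)
    also have "\<dots> = z [^] k \<otimes> (a \<otimes> b) \<otimes> a [^] k" unfolding zk using c by (simp add: m_assoc)
    also have "\<dots> = z [^] Suc k \<otimes> b \<otimes> (a \<otimes> a [^] k)" unfolding ab using c by (simp add: m_assoc)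
    also have "a \<otimes> a [^] k = a [^] Suc k" using c by (simp only: nat_pow_Suc2)
    finally show ?case .
  qed (use c in simp)
  have 2: "a \<otimes> b [^] k = z [^] k \<otimes> b [^] k \<otimes> a" for k :: nat
  proof (induction k)
    case (Suc k)
    have zk: "b [^] k \<otimes> z = z \<otimes> b [^] k" using zb c group_commutes_pow by metis
    have "a \<otimes> b [^] Suc k = (a \<otimes> b [^] k) \<otimes> b" using c by (simp add: m_assoc)
    also have "\<dots> = z [^] k \<otimes> b [^] k \<otimes> (a \<otimes> b)" unfolding Suc using c by (simp add: m_assoc)
    also have "\<dots> = z [^] k \<otimes> (b [^] k \<otimes> z) \<otimes> b \<otimes> a" unfolding ab using c by (simp add: m_assoc)
    also have "\<dots> = z [^] Suc k \<otimes> b [^] Suc k \<otimes> a" unfolding zk using c by (simp add: m_assoc)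
    finally show ?case .
  qed (use c in simp)
  have "z [^] m \<otimes> b = b" using 1[of m] m c by simp
  then have zm: "z [^] m = \<one>" using c by (metis l_cancel_one' nat_pow_closed r_cancel_one')
  have "a = z [^] n \<otimes> a" using 2[of n] n c by simp
  then have zn: "z [^] n = \<one>" using c by (metis nat_pow_closed r_cancel_one')
  have "ord z dvd 1" using zm zn pow_eq_id[OF c(3)] co by (metis coprime_common_divisor_nat coprime_def)
  then show ?thesis using ord_eq_1[OF c(3)] by simp
qed

context finite_group
begin

text \<open>A one-sided variant: since \<open>y\<close> commutes with \<open>w\<close>, the
  commutator of \<open>y [^] k\<close> and \<open>v\<close> is \<open>w [^] k\<close>, and
  \<open>k = ord y\<close> makes \<open>ord w\<close> divide \<open>ord y\<close>.\<close>

lemma commutes_if_coprime_commutator: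
  assumes c: "y \<in> carrier G" "v \<in> carrier G" and w: "w = y \<otimes> v \<otimes> inv y \<otimes> inv v" "y \<otimes> w = w \<otimes> y"
    and co: "coprime (ord y) (ord w)"
  shows "y \<otimes> v = v \<otimes> y"
proof -
  have wc: "w \<in> carrier G" using c w by simp
  have yv: "y \<otimes> v = w \<otimes> v \<otimes> y" using c w(1) by (simp add: m_assoc)
  have k: "y [^] k \<otimes> v = w [^] k \<otimes> v \<otimes> y [^] k" for k :: nat
  proof (induction k)
    case (Suc k)
    have wk: "y \<otimes> w [^] k = w [^] k \<otimes> y" using w(2) c wc group_commutes_pow by metis
    have "y [^] Suc k \<otimes> v = y \<otimes> (y [^] k \<otimes> v)" using c by (simp only: nat_pow_Suc2 m_assoc nat_pow_closed)
    also have "\<dots> = (y \<otimes> w [^] k) \<otimes> v \<otimes> y [^] k" unfolding Suc using c wc by (simp add: m_assoc)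
    also have "\<dots> = w [^] k \<otimes> (y \<otimes> v) \<otimes> y [^] k" unfolding wk using c wc by (simp add: m_assoc)
    also have "\<dots> = w [^] Suc k \<otimes> v \<otimes> (y \<otimes> y [^] k)" unfolding yv using c wc by (simp add: m_assoc)
    also have "y \<otimes> y [^] k = y [^] Suc k" using c by (simp only: nat_pow_Suc2)
    finally show ?case .
  qed (use c in simp)
  have "w [^] ord y \<otimes> v = v" using k[of "ord y"] c wc by simp
  then have "w [^] ord y = \<one>" using c wc by (metis nat_pow_closed r_cancel_one')
  then have "ord w dvd ord y" using pow_eq_id[OF wc] by simp
  then have "ord w = 1" using co by (metis coprime_common_divisor_nat dvd_refl)
  then have "w = \<one>" using ord_eq_1[OF wc] by simp
  then show ?thesis using yv c by simp
qed

text \<open>Subgroups of order \<open>p\<close> have index \<open>p\<close> and are normal by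
  \<open>p_growth\<close>. A commutator therefore lies in \<open>cyc a\<close> and in
  \<open>cyc b\<close>, which meet trivially unless they coincide.\<close>

lemma elementary_comm:
  assumes E: "elementary p R" and ab: "a \<in> R" "b \<in> R"
  shows "a \<otimes> b = b \<otimes> a"
proof -
  have p: "prime p" and R: "subgroup R G" and cR: "card R = p\<^sup>2" and e: "\<And>x. x \<in> R \<Longrightarrow> x [^] p = \<one>"
    using E by (auto simp: elementary_def)
  have p1: "1 < p" using p prime_gt_1_nat by blast
  have o: "ord x = p" if "x \<in> R" "x \<noteq> \<one>" for x
    using that e[OF that(1)] p ord_eq_1 pow_eq_id sub_mem[OF R] by (metis prime_nat_iff)
  have nrm: "normalizes y (cyc x)" if x: "x \<in> R" "x \<noteq> \<one>" and y: "y \<in> R" for x y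
  proof -
    have xc: "x \<in> carrier G" using x R sub_mem by blast
    have cx: "subgroup (cyc x) G" using cyc_subgroup[OF xc] .
    have cc: "card (cyc x) = p" using card_cyc[OF xc] o[OF x] by simp
    then have "cyc x \<noteq> R" using cR p1 by (auto simp: power2_eq_square)
    then obtain g where g: "g \<in> R" "g \<notin> cyc x" "normalizes g (cyc x)" "g [^] p \<in> cyc x"
      using p_growth[OF p R cR cx] cyc_sub[OF R x(1)] by blast
    have gc: "g \<in> carrier G" using g R sub_mem by blast
    have "card (adjoin (cyc x) g) = card R" using adjoin_card_prime[OF cx gc g(2) p g(4)] cc cR by (simp add: power2_eq_square)
    moreover have "adjoin (cyc x) g \<subseteq> R" using adjoin_least[OF R cyc_sub[OF R x(1)] g(1)] .
    ultimately have "adjoin (cyc x) g = R" using finite_subgroup[OF R] card_subset_eq by blast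
    moreover have "adjoin (cyc x) g \<subseteq> {h \<in> carrier G. normalizes h (cyc x)}"
      by (rule adjoin_least[OF normalizer_subgroup]) (use normalizes_self[OF cx] sub_mem[OF cx] subgroup.subset[OF cx] g gc in auto)
    ultimately show ?thesis using y by blast
  qed
  have c: "a \<in> carrier G" "b \<in> carrier G" using ab R sub_mem by auto
  show ?thesis
  proof (cases "a = \<one> \<or> b = \<one> \<or> b \<in> cyc a")
    case True
    then show ?thesis using c cyc_comm[OF c(1) cyc_self[OF c(1)]] by auto
  next
    case False
    let ?w = "b \<otimes> a \<otimes> inv b \<otimes> inv a"
    have "b \<otimes> a \<otimes> inv b \<in> cyc a" using nrm[OF ab(1) _ ab(2)] False cyc_self[OF c(1)] by (auto simp: normalizes_def)
    then have wa: "?w \<in> cyc a" using cyc_subgroup[OF c(1)] cyc_self[OF c(1)] by (simp add: subgroup.m_closed subgroup.m_inv_closed)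
    have "a \<otimes> inv b \<otimes> inv a \<in> cyc b"
      using nrm[OF ab(2) _ ab(1)] False cyc_self[OF c(2)] cyc_subgroup[OF c(2)]
      by (auto simp: normalizes_def subgroup.m_inv_closed)
    then have "b \<otimes> (a \<otimes> inv b \<otimes> inv a) \<in> cyc b"
      using cyc_subgroup[OF c(2)] cyc_self[OF c(2)] by (simp add: subgroup.m_closed)
    then have wb: "?w \<in> cyc b" using c by (simp add: m_assoc)
    have "?w = \<one>"
    proof (rule ccontr)
      assume w1: "?w \<noteq> \<one>"
      have wR: "?w \<in> R" using wa cyc_sub[OF R ab(1)] by blast
      have "cyc a = cyc ?w" using cyc_eq_if_ord[OF cyc_subgroup[OF c(1)] wa] o[OF wR w1] o[OF ab(1)] False card_cyc[OF c(1)] by simp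
      moreover have "cyc b = cyc ?w" using cyc_eq_if_ord[OF cyc_subgroup[OF c(2)] wb] o[OF wR w1] o[OF ab(2)] False card_cyc[OF c(2)] by simp
      ultimately show False using False cyc_self[OF c(2)] by simp
    qed
    then have "b \<otimes> a \<otimes> inv b = a" using c by (metis inv_closed inv_inv inv_equality m_closed inv_comm)
    then show ?thesis using conj_commute[OF c(2,1)] by simp
  qed
qed

text \<open>The complement of \<open>C\<close> in \<open>Q\<close> is a single coset,
  \<open>C #> b\<close>.\<close>

lemma index_two:
  assumes C: "subgroup C G" and Q: "subgroup Q G" "C \<subseteq> Q" "card Q = 2 * card C" and ab: "a \<in> Q - C" "b \<in> Q - C"
  shows "a \<otimes> inv b \<in> C"
proof -
  have Cc: "C \<subseteq> carrier G" using C subgroup.subset by blast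
  have c: "a \<in> carrier G" "b \<in> carrier G" using ab Q sub_mem by auto
  let ?B = "(\<lambda>x. x \<otimes> b) ` C"
  have BQ: "?B \<subseteq> Q" using ab Q by (auto intro: subgroup.m_closed)
  have "card ?B = card C" using Cc c by (intro card_image inj_onI) (auto simp: subset_iff)
  moreover have dis: "C \<inter> ?B = {}"
  proof (rule ccontr)
    assume "C \<inter> ?B \<noteq> {}"
    then obtain x where x: "x \<in> C" "x \<otimes> b \<in> C" by blast
    then have "inv x \<otimes> (x \<otimes> b) \<in> C" using C by (simp add: subgroup.m_closed subgroup.m_inv_closed)
    moreover have "inv x \<otimes> (x \<otimes> b) = b" using x Cc c by (simp add: subset_iff)
    ultimately show False using ab by simp
  qed
  moreover have finQ: "finite Q" using finite_subgroup[OF Q(1)] .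
  ultimately have "card (C \<union> ?B) = card Q" using Q finite_subset[OF BQ finQ] finite_subset[OF Q(2) finQ] by (simp add: card_Un_disjoint)
  then have "C \<union> ?B = Q" using finQ BQ Q(2) by (intro card_subset_eq) auto
  then obtain x where "x \<in> C" "a = x \<otimes> b" using ab by blast
  then show ?thesis using c Cc by (simp add: m_assoc subset_iff)
qed

lemma adjoin_card_coprime:
  assumes H: "subgroup H G" and y: "y \<in> carrier G" and co: "coprime (card H) (ord y)"
  shows "card (adjoin H y) = card H * ord y"
proof (rule adjoin_card[OF H y])
  show "0 < ord y" using ord_pos[OF y] .
  show "y [^] ord y \<in> H" using y H by (simp add: subgroup.one_closed)
  fix i :: nat assume i: "0 < i" "i < ord y"
  show "y [^] i \<notin> H"
  proof
    assume "y [^] i \<in> H"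
    then have "ord (y [^] i) dvd card H" using ord_dvd_card[OF H] by blast
    then have "ord (y [^] i) = 1" using ord_pow_dvd[OF y, of i] co by (metis coprime_common_divisor_nat)
    then have "y [^] i = \<one>" using ord_eq_1 y by simp
    then show False using pow_eq_id[OF y] i by (auto dest: dvd_imp_le)
  qed
qed

text \<open>
  For abelian \<open>Q\<close>, the image \<open>W\<close> of \<open>v \<mapsto> [y, v]\<close> is a proper subgroup because \<open>u\<close> is in the kernel, so
  \<open>W\<langle>y\<rangle>\<close> is a proper subgroup of \<open>S\<close> and \<open>y\<close> centralizes \<open>W\<close>. For \<open>Q\<^sub>8\<close>, \<open>[y, v]\<close> lies in \<open>\<langle>u\<rangle>\<close>, which has
  index 2.
\<close>

lemma centralizes_p_subgroup:
  assumes S: "subgroup S G" and cc: "\<And>T. subgroup T G \<Longrightarrow> T \<subset> S \<Longrightarrow> comm_coprime T"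
    and Q: "subgroup Q G" "Q \<subseteq> S" and y: "y \<in> S" "normalizes y Q" "coprime (card Q) (ord y)" "card S = card Q * ord y"
    and u: "u \<in> Q" "ord u = expo Q" "y \<otimes> u = u \<otimes> y"
    and types: "is_cyclic Q \<or> elementary r Q \<or> quaternionic Q" and v: "v \<in> Q"
  shows "y \<otimes> v = v \<otimes> y"
proof -
  have yc: "y \<in> carrier G" and uc: "u \<in> carrier G" and vc: "v \<in> carrier G" using y u v Q S sub_mem by auto
  have Qc: "Q \<subseteq> carrier G" using Q subgroup.subset by blast
  have co: "coprime (ord y) (ord w)" if "w \<in> Q" for w
    using y(3) ord_dvd_card[OF Q(1) that] by (metis coprime_commute coprime_divisors dvd_refl)
  have yQ: "y \<otimes> w \<otimes> inv y \<in> Q" if "w \<in> Q" for w using y(2) that by (simp add: normalizes_def)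
  let ?w = "\<lambda>v. y \<otimes> v \<otimes> inv y \<otimes> inv v"
  have wQ: "?w v \<in> Q" if "v \<in> Q" for v using yQ[OF that] that Q by (simp add: subgroup.m_closed subgroup.m_inv_closed)
  \<comment> \<open>It suffices that \<open>y\<close> commutes with the commutator
    \<open>?w v\<close>, whose order is coprime to that of \<open>y\<close>.\<close>
  have fin: "y \<otimes> v = v \<otimes> y" if "y \<otimes> ?w v = ?w v \<otimes> y"
    using commutes_if_coprime_commutator[OF yc vc refl that co[OF wQ[OF v]]] .
  show ?thesis
  proof (cases "\<forall>a\<in>Q. \<forall>b\<in>Q. a \<otimes> b = b \<otimes> a")
    case ab: True
    show ?thesis
    proof (cases "v = \<one>")
      case True
      then show ?thesis using yc by simp
    next
      case False
      have "u \<noteq> \<one>"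
      proof
        assume "u = \<one>"
        then have "expo Q = 1" using u(2) by simp
        then show False using ord_dvd_expo[OF v] ord_eq_1[OF vc] False by simp
      qed
      let ?W = "?w ` Q"
      \<comment> \<open>Since \<open>Q\<close> is commutative, \<open>?w\<close> is multiplicative
        on \<open>Q\<close>, so its image is closed under products.\<close>
      have W: "subgroup ?W G"
      proof (rule closed_imp_subgroup)
        show "?W \<subseteq> carrier G" using wQ Qc by blast
        have "\<one> = ?w \<one>" using yc by simp
        then show "\<one> \<in> ?W" using Q(1) subgroup.one_closed by blast
        fix s t assume "s \<in> ?W" "t \<in> ?W"
        then obtain a b where a: "a \<in> Q" "b \<in> Q" "s = ?w a" "t = ?w b" by blast
        have c: "a \<in> carrier G" "b \<in> carrier G" using a Qc by auto
        have ia: "inv a \<in> Q" "inv b \<in> Q" using a(1,2) subgroup.m_inv_closed[OF Q(1)] by blast+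
        have "?w (a \<otimes> b) = (y \<otimes> a \<otimes> inv y) \<otimes> (y \<otimes> b \<otimes> inv y) \<otimes> (inv b \<otimes> inv a)"
          using c yc by (simp add: conj_hom inv_mult_group)
        also have "inv b \<otimes> inv a = inv a \<otimes> inv b" using ab ia by blast
        also have "(y \<otimes> a \<otimes> inv y) \<otimes> (y \<otimes> b \<otimes> inv y) \<otimes> (inv a \<otimes> inv b) =
            (y \<otimes> a \<otimes> inv y) \<otimes> ((y \<otimes> b \<otimes> inv y) \<otimes> inv a) \<otimes> inv b"
          using c yc by (simp add: m_assoc)
        also have "(y \<otimes> b \<otimes> inv y) \<otimes> inv a = inv a \<otimes> (y \<otimes> b \<otimes> inv y)" using ab ia yQ[OF a(2)] by blast
        also have "(y \<otimes> a \<otimes> inv y) \<otimes> (inv a \<otimes> (y \<otimes> b \<otimes> inv y)) \<otimes> inv b = s \<otimes> t"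
          using a c yc by (simp add: m_assoc)
        finally have "s \<otimes> t = ?w (a \<otimes> b)" by simp
        then show "s \<otimes> t \<in> ?W" using subgroup.m_closed[OF Q(1) a(1,2)] by blast
      qed
      have WQ: "?W \<subseteq> Q" using wQ by blast
      have "\<not> inj_on ?w Q"
      proof
        assume inj: "inj_on ?w Q"
        have "?w u = ?w \<one>" using u(3) uc yc by (simp add: m_assoc)
        then have "u = \<one>" by (rule inj_onD[OF inj _ u(1) subgroup.one_closed[OF Q(1)]])
        then show False using \<open>u \<noteq> \<one>\<close> by simp
      qed
      then have cW: "card ?W < card Q"
        using card_image_le[OF finite_subgroup[OF Q(1)], of ?w] eq_card_imp_inj_on[OF finite_subgroup[OF Q(1)], of ?w] by linarith
      have nW: "normalizes y ?W" unfolding normalizes_def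
      proof
        fix s assume "s \<in> ?W"
        then obtain a where a: "a \<in> Q" "s = ?w a" by blast
        have c: "a \<in> carrier G" using a Qc by auto
        have "y \<otimes> s \<otimes> inv y = ?w (y \<otimes> a \<otimes> inv y)" using a c yc by (simp add: m_assoc inv_mult_group)
        then show "y \<otimes> s \<otimes> inv y \<in> ?W" using yQ[OF a(1)] by blast
      qed
      have "coprime (card ?W) (ord y)" using y(3) card_sub_dvd[OF W Q(1) WQ] by (metis coprime_divisors dvd_refl)
      then have cT: "card (adjoin ?W y) = card ?W * ord y" using adjoin_card_coprime[OF W yc] by blast
      have "adjoin ?W y \<subseteq> S" using adjoin_least[OF S _ y(1)] WQ Q(2) by blast
      moreover have "adjoin ?W y \<noteq> S" using cT y(4) cW ord_pos[OF yc] by auto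
      ultimately have "comm_coprime (adjoin ?W y)" using cc adjoin_subgroup[OF W yc nW] by blast
      moreover have "?w v \<in> adjoin ?W y" using adjoin_sup[OF subgroup.subset[OF W] yc] v by blast
      moreover have "y \<in> adjoin ?W y" using adjoin_mem[OF W yc] .
      ultimately show ?thesis using fin comm_coprimeD co[OF wQ[OF v]] by blast
    qed
  next
    case nab: False
    have "\<not> is_cyclic Q" using nab cyc_comm Qc by (auto simp: is_cyclic_def)
    moreover have "\<not> elementary r Q" using nab elementary_comm by blast
    ultimately have "quaternionic Q" using types by blast
    then have ql: "quaternion_like Q" using quaternionic_iso_Q8 iso_Q8_quaternion_like Q(1) by blast
    have ou: "ord u = 4" using u(2) euler_quaternion_like(1)[OF ql] by simp
    let ?C = "cyc u"
    have C: "subgroup ?C G" "?C \<subseteq> Q" "card Q = 2 * card ?C"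
      using cyc_subgroup[OF uc] cyc_sub[OF Q(1) u(1)] card_cyc[OF uc] ou ql by (auto simp: quaternion_like_def)
    have yC: "y \<otimes> x = x \<otimes> y" if "x \<in> ?C" for x
      using that cyc_memE[OF uc that] group_commutes_pow[of u y] u(3) uc yc by metis
    show ?thesis
    proof (cases "v \<in> ?C")
      case True
      then show ?thesis using yC by blast
    next
      case False
      \<comment> \<open>If the conjugate were in \<open>?C\<close>, it would commute with
        \<open>y\<close> and thus equal \<open>v\<close>, which is outside
        \<open>?C\<close>.\<close>
      have "y \<otimes> v \<otimes> inv y \<notin> ?C"
      proof
        assume x: "y \<otimes> v \<otimes> inv y \<in> ?C"
        have "y \<otimes> (y \<otimes> v \<otimes> inv y) = (y \<otimes> v \<otimes> inv y) \<otimes> y" using yC[OF x] .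
        then have "y \<otimes> (y \<otimes> v \<otimes> inv y) = y \<otimes> v" using yc vc by (simp add: m_assoc)
        then have "y \<otimes> v \<otimes> inv y = v" using yc vc by simp
        then show False using x False by simp
      qed
      then have "?w v \<in> ?C" using index_two[OF C(1) Q(1) C(2,3), of "y \<otimes> v \<otimes> inv y" v] yQ[OF v] v False by blast
      then show ?thesis using yC fin by blast
    qed
  qed
qed

text \<open>Strong induction on the order makes the claim available for proper subgroups. An element
  of prime power order outside the normal maximal \<open>M\<close> reveals the index of
  \<open>M\<close> as its prime, so there is only one such prime \<open>p\<close>, and only pairs
  with one \<open>p\<close>-element are left for \<open>key\<close>.\<close>

theorem comm_coprime_if_types:
  assumes A: exp_attained
    and types: "\<And>p n T. prime p \<Longrightarrow> subgroup T G \<Longrightarrow> card T = p ^ n \<Longrightarrow>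
      is_cyclic T \<or> elementary p T \<or> quaternionic T"
    and S: "subgroup S G"
  shows "comm_coprime S"
  using S
proof (induction "card S" arbitrary: S rule: less_induct)
  case less
  note S = less.prems
  have cc: "comm_coprime T" if "subgroup T G" "T \<subset> S" for T
    using less.hyps[of T] that finite_subgroup[OF S] psubset_card_mono by blast
  show ?case
  proof (cases "S = {\<one>}")
    case True
    then show ?thesis by (simp add: comm_coprime_def)
  next
    case False
    obtain M where M: "maximal_in M S" and nM: "\<And>g. g \<in> S \<Longrightarrow> normalizes g M"
      using ex_normal_maximal[OF S False cc] by blast
    have sM: "subgroup M G" "M \<subset> S" and mx: "\<And>K. subgroup K G \<Longrightarrow> M \<subseteq> K \<Longrightarrow> K \<subset> S \<Longrightarrow> K = M"
      using M by (auto simp: maximal_in_def)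
    have ccM: "comm_coprime M" using cc sM by blast
    have index: "card S = card M * q" if q: "prime q" and x: "x \<in> S" "x \<notin> M" "ord x = q ^ i" for x q i
    proof -
      have xc: "x \<in> carrier G" using x S sub_mem by blast
      obtain n :: nat where n: "x [^] n \<notin> M" "(x [^] n) [^] q \<in> M" using prime_step[OF sM(1) xc x(2,3)] by blast
      have y: "x [^] n \<in> S" "x [^] n \<in> carrier G" using pow_mem[OF S x(1)] xc by auto
      let ?K = "adjoin M (x [^] n)"
      have K: "subgroup ?K G" using adjoin_subgroup[OF sM(1) y(2) nM[OF y(1)]] .
      have "M \<subseteq> ?K" using adjoin_sup[OF subgroup.subset[OF sM(1)] y(2)] .
      moreover have "?K \<noteq> M" using adjoin_mem[OF sM(1) y(2)] n(1) by blast
      moreover have "?K \<subseteq> S" using adjoin_least[OF S _ y(1)] sM(2) by blast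
      ultimately have "?K = S" using mx[OF K] by blast
      then show ?thesis using adjoin_card_prime[OF sM(1) y(2) n(1) q n(2)] by simp
    qed
    obtain a0 where a0: "a0 \<in> S" "a0 \<notin> M" using sM(2) by blast
    obtain p n i where p: "prime p" "ord (a0 [^] (n::nat)) = p ^ i" "a0 [^] n \<notin> M"
      using gen_prime_powers[OF sM(1) sub_mem[OF S a0(1)]] a0(2) by blast
    have ip: "card S = card M * p" using index[OF p(1) pow_mem[OF S a0(1)] p(3,2)] .
    have inM: "x \<in> M" if "prime r" "r \<noteq> p" "x \<in> S" "ord x = r ^ j" for x r j
      using index[of r x j] ip that card_sub_pos[OF sM(1)] by auto
    have key: "a \<otimes> b = b \<otimes> a"
      if r: "prime r" "r \<noteq> p" and a: "a \<in> S" "ord a = r ^ i" and b: "b \<in> S" "ord b = p ^ j" for a b r i j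
    proof -
      have bc: "b \<in> carrier G" using b S sub_mem by blast
      let ?Q = "p_elements r S"
      have QM: "?Q = p_elements r M" using inM[OF r] sM(2) by (auto simp: p_elements_def)
      have Q: "subgroup ?Q G" "card ?Q = r ^ multiplicity r (card M)"
        using p_elements_subgroup[OF sM(1) ccM r(1)] QM by auto
      have QS: "?Q \<subseteq> S" by (auto simp: p_elements_def)
      have aQ: "a \<in> ?Q" using a by (auto simp: p_elements_def)
      have coab: "coprime (ord a) (ord b)" using a b r p(1) coprime_prime_powers by simp
      let ?T = "adjoin ?Q b"
      have T: "subgroup ?T G" using adjoin_subgroup[OF Q(1) bc p_elements_normalized[OF S b(1)]] .
      show ?thesis
      proof (cases "?T = S")
        case False
        then have "comm_coprime ?T" using cc[OF T] adjoin_least[OF S QS b(1)] by blast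
        then show ?thesis
          using comm_coprimeD[OF _ _ _ coab] adjoin_mem[OF Q(1) bc] adjoin_sup[OF subgroup.subset[OF Q(1)] bc] aQ by blast
      next
        case True
        have coQ: "coprime (card ?Q) (p ^ k)" for k using Q(2) r p(1) coprime_prime_powers by simp
        have cS: "card S = card ?Q * p ^ j" using adjoin_card_coprime[OF Q(1) bc] coQ b(2) True by simp
        obtain x where x: "x \<in> S" "ord x = expo S" using A S by (auto simp: exp_attained_def)
        have xc: "x \<in> carrier G" using x S sub_mem by blast
        define \<beta> where "\<beta> = multiplicity p (ord x)"
        obtain e where e: "ord x = p ^ \<beta> * e" "\<not> p dvd e"
          using multiplicity_decompose'[of "ord x" p] ord_pos[OF xc] p(1) unfolding \<beta>_def
          by (metis less_numeral_extra(3) not_prime_unit)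
        have cope: "coprime (p ^ k) e" for k using p(1) e(2) by (simp add: prime_imp_coprime coprime_power_left_iff)
        obtain s t :: nat where st: "ord (x [^] s) = p ^ \<beta>" "ord (x [^] t) = e"
          using split_coprime[OF xc e(1) cope] by blast
        define y u where "y = x [^] s" and "u = x [^] t"
        have y: "y \<in> S" "y \<in> carrier G" "ord y = p ^ \<beta>" and u: "u \<in> S" "u \<in> carrier G" "ord u = e"
          using st pow_mem[OF S x(1)] xc by (auto simp: y_def u_def)
        have yu: "y \<otimes> u = u \<otimes> y" using xc by (simp add: y_def u_def nat_pow_mult add.commute)
        have "e dvd card ?Q * p ^ j" using ord_dvd_card[OF S u(1)] u(3) cS by simp
        then have "e dvd card ?Q" using cope[of j] by (simp add: coprime_dvd_mult_left_iff coprime_commute)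
        then have "\<exists>k. e = r ^ k" using Q(2) r(1) by (metis divides_primepow_nat)
        then have uQ: "u \<in> ?Q" using u by (auto simp: p_elements_def)
        \<comment> \<open>The exponent of \<open>?Q\<close> divides \<open>p ^ \<beta> * e\<close>
          and is coprime to \<open>p\<close>; so it divides \<open>e\<close>, which is itself the
          order of an element of \<open>?Q\<close>.\<close>
        have "expo ?Q dvd expo S" using QS ord_dvd_expo by (intro expo_dvd) blast
        then have "expo ?Q dvd p ^ \<beta> * e" using x(2) e(1) by simp
        moreover have "coprime (expo ?Q) (p ^ \<beta>)"
          using coQ[of \<beta>] expo_dvd_card[OF Q(1)] by (metis coprime_divisors dvd_refl)
        ultimately have "expo ?Q dvd e" by (metis coprime_dvd_mult_right_iff)
        then have ue: "ord u = expo ?Q" using ord_dvd_expo[OF uQ] u(3) by (simp add: dvd_antisym)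
        \<comment> \<open>The order of \<open>b\<close> divides the exponent of \<open>S\<close>,
          hence that of \<open>y\<close>. So \<open>y\<close> is large enough to replace
          \<open>b\<close> as generator of a complement of \<open>?Q\<close>.\<close>
        have "p ^ j dvd p ^ \<beta> * e" using ord_dvd_expo[OF b(1)] b(2) x(2) e(1) by simp
        then have jb: "p ^ j dvd p ^ \<beta>" using cope[of j] by (simp add: coprime_dvd_mult_left_iff)
        have cy: "coprime (card ?Q) (ord y)" using coQ y(3) by simp
        have nyQ: "normalizes y ?Q" using p_elements_normalized[OF S y(1)] .
        have cA: "card (adjoin ?Q y) = card ?Q * ord y" using adjoin_card_coprime[OF Q(1) y(2) cy] .
        moreover have AS: "adjoin ?Q y \<subseteq> S" using adjoin_least[OF S QS y(1)] .
        moreover have "card S \<le> card ?Q * ord y" using cS y(3) jb p(1) by (simp add: dvd_imp_le prime_gt_0_nat)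
        ultimately have Ay: "adjoin ?Q y = S" using finite_subgroup[OF S] by (simp add: card_seteq)
        have "card S = card ?Q * ord y" using cA Ay by simp
        then have cent: "y \<otimes> v = v \<otimes> y" if "v \<in> ?Q" for v
          using centralizes_p_subgroup[OF S cc Q(1) QS y(1) nyQ cy _ uQ ue yu types[OF r(1) Q]] that by blast
        have "b \<in> adjoin ?Q y" using b(1) Ay by simp
        then obtain h k where h: "h \<in> ?Q" "b = h \<otimes> y [^] (k::nat)" by (auto simp: adjoin_def)
        have hc: "h \<in> carrier G" using h sub_mem[OF Q(1)] by blast
        \<comment> \<open>As the factors of \<open>b\<close> commute and
          \<open>b [^] ord y = \<one>\<close>, also \<open>h [^] ord y = \<one>\<close>. The order
          of \<open>h\<close> is coprime to \<open>ord y\<close>, so \<open>h\<close> is trivial and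
          \<open>b\<close> is a power of \<open>y\<close>.\<close>
        have hy: "h \<otimes> y [^] k = y [^] k \<otimes> h" using group_commutes_pow[of y h k] cent[OF h(1)] hc y(2) by metis
        have "b [^] ord y = \<one>" using jb b(2) y(3) pow_eq_id[OF bc] by simp
        then have "h [^] ord y \<otimes> (y [^] k) [^] ord y = \<one>"
          using pow_mult_distrib[OF hy hc, of "ord y"] h(2) y(2) by simp
        moreover have "(y [^] k) [^] ord y = \<one>" using y(2) by (simp add: pow_eq_id nat_pow_pow)
        ultimately have "h [^] ord y = \<one>" using hc by simp
        then have "ord h dvd ord y" using pow_eq_id[OF hc] by simp
        moreover have "ord h dvd card ?Q" using ord_dvd_card[OF Q(1) h(1)] .
        ultimately have "ord h = 1" using cy by (metis coprime_common_divisor_nat)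
        then have "b = y [^] k" using h(2) ord_eq_1[OF hc] y(2) by simp
        then show ?thesis using group_commutes_pow[of y a k] cent[OF aQ] sub_mem[OF S a(1)] y(2) by metis
      qed
    qed
    show ?thesis
    proof (rule comm_coprimeI[OF S])
      fix q r i j a b
      assume q: "prime q" "prime r" "q \<noteq> r" "a \<in> S" "b \<in> S" "ord a = q ^ i" "ord b = r ^ j"
      consider "q \<noteq> p" "r \<noteq> p" | "q = p" | "r = p" by blast
      then show "a \<otimes> b = b \<otimes> a"
      proof cases
        case 1
        then have "a \<in> M" "b \<in> M" using inM q by blast+
        moreover have "coprime (ord a) (ord b)" using q coprime_prime_powers by simp
        ultimately show ?thesis using comm_coprimeD[OF ccM] by blast
      next
        case 2
        then show ?thesis using key[of r b j a i] q by simp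
      next
        case 3
        then show ?thesis using key[of q a i b j] q by simp
      qed
    qed
  qed
qed

section \<open>Nilpotency\<close>

text \<open>The commutator of \<open>a\<close> and \<open>b\<close> is pushed down the central
  series: if it lies in \<open>N (Suc j)\<close>, it is central modulo \<open>N j\<close>, and
  \<open>central_commutator_coprime\<close> in the factor group puts it into
  \<open>N j\<close>.\<close>

lemma nilpotent_imp_comm_coprime:
  assumes "nilpotent_group G"
  shows "comm_coprime (carrier G)"
proof -
  have ex: "\<exists>(N :: nat \<Rightarrow> 'a set) n. N 0 = {\<one>} \<and> N n = carrier G \<and> (\<forall>i\<le>n. N i \<lhd> G) \<and>
      (\<forall>i<n. N i \<subseteq> N (Suc i) \<and> (\<forall>x\<in>N (Suc i). \<forall>g\<in>carrier G. x \<otimes> g \<otimes> inv x \<otimes> inv g \<in> N i))"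
    using assms unfolding nilpotent_group_def by (rule conjunct2)
  obtain N :: "nat \<Rightarrow> 'a set" and n where N: "N 0 = {\<one>}" "N n = carrier G" "\<forall>i\<le>n. N i \<lhd> G"
    and comm0: "\<forall>i<n. N i \<subseteq> N (Suc i) \<and> (\<forall>x\<in>N (Suc i). \<forall>g\<in>carrier G. x \<otimes> g \<otimes> inv x \<otimes> inv g \<in> N i)"
    using ex by (elim exE conjE)
  have comm: "x \<otimes> g \<otimes> inv x \<otimes> inv g \<in> N i" if "i < n" "x \<in> N (Suc i)" "g \<in> carrier G" for i x g
    using comm0[rule_format, OF that(1)] that(2,3) by blast
  show ?thesis
    unfolding comm_coprime_def
  proof (intro ballI impI)
    fix a b assume c: "a \<in> carrier G" "b \<in> carrier G" and co: "coprime (ord a) (ord b)"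
    let ?c = "a \<otimes> b \<otimes> inv a \<otimes> inv b"
    have cc: "?c \<in> carrier G" using c by simp
    have "?c \<in> N (n - i)" if "i \<le> n" for i
      using that
    proof (induction i)
      case 0
      then show ?case using N cc by simp
    next
      case (Suc i)
      define j where "j = n - Suc i"
      have j: "j < n" "n - i = Suc j" using Suc.prems by (auto simp: j_def)
      have cS: "?c \<in> N (Suc j)" using Suc j by simp
      interpret M: normal "N j" G using N(3) j by simp
      interpret H: group "G Mod N j" by (rule M.factorgroup_is_group)
      interpret h: group_hom G "G Mod N j" "\<lambda>x. N j #> x"
        using M.r_coset_hom_Mod by unfold_locales
      have one: "N j #> k = \<one>\<^bsub>G Mod N j\<^esub>" if "k \<in> N j" for k
        using M.rcos_const[OF group_axioms that] by simp
      have cm: "(N j #> ?c) \<otimes>\<^bsub>G Mod N j\<^esub> (N j #> g) = (N j #> g) \<otimes>\<^bsub>G Mod N j\<^esub> (N j #> ?c)" if g: "g \<in> carrier G" for g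
      proof -
        let ?k = "?c \<otimes> g \<otimes> inv ?c \<otimes> inv g"
        have k: "?k \<in> N j" using comm[OF j(1) cS g] .
        have kc: "?k \<in> carrier G" using cc g by simp
        have "?c \<otimes> g = ?k \<otimes> (g \<otimes> ?c)" using cc g by (simp add: m_assoc)
        then have "N j #> (?c \<otimes> g) = N j #> (?k \<otimes> (g \<otimes> ?c))" by simp
        also have "\<dots> = (N j #> ?k) \<otimes>\<^bsub>G Mod N j\<^esub> (N j #> (g \<otimes> ?c))" using kc cc g h.hom_mult by blast
        also have "\<dots> = N j #> (g \<otimes> ?c)" unfolding one[OF k] by (rule H.l_one) (use cc g h.hom_closed in blast)
        finally have "N j #> (?c \<otimes> g) = N j #> (g \<otimes> ?c)" .
        then show ?thesis using h.hom_mult[OF cc g] h.hom_mult[OF g cc] by metis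
      qed
      have "a \<otimes> b = ?c \<otimes> b \<otimes> a" using c by (simp add: m_assoc)
      then have ab: "(N j #> a) \<otimes>\<^bsub>G Mod N j\<^esub> (N j #> b) = (N j #> ?c) \<otimes>\<^bsub>G Mod N j\<^esub> (N j #> b) \<otimes>\<^bsub>G Mod N j\<^esub> (N j #> a)"
        using c cc h.hom_mult by (metis m_closed)
      have pw: "(N j #> x) [^]\<^bsub>G Mod N j\<^esub> ord x = \<one>\<^bsub>G Mod N j\<^esub>" if "x \<in> carrier G" for x
        using h.hom_nat_pow[OF that, of "ord x"] that by simp
      have "N j #> ?c = \<one>\<^bsub>G Mod N j\<^esub>"
        by (rule H.central_commutator_coprime[OF h.hom_closed[OF c(1)] h.hom_closed[OF c(2)] h.hom_closed[OF cc] ab cm[OF c(1)] cm[OF c(2)]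
            pw[OF c(1)] pw[OF c(2)] co])
      then have "N j #> ?c = N j" by simp
      then have "?c \<in> N j" using rcos_self[OF cc M.subgroup_axioms] by simp
      then show ?case by (simp add: j_def)
    qed
    from this[of n] have "?c = \<one>" using N(1) by simp
    then have "a \<otimes> b \<otimes> inv a = b" using c by (metis inv_closed inv_inv inv_equality m_closed inv_comm)
    then show "a \<otimes> b = b \<otimes> a" using conj_commute[OF c] by simp
  qed
qed

text \<open>Conjugation permutes the solutions of \<open>x [^] 2 = \<one>\<close> and fixes the
  identity, so it also fixes the only other solution.\<close>

lemma quaternion_like_involutions:
  assumes "quaternion_like P"
  obtains z where "z \<noteq> \<one>" "{x \<in> P. x [^] (2::nat) = \<one>} = {\<one>, z}"
    "\<And>x t. x \<in> P \<Longrightarrow> t \<in> {\<one>, z} \<Longrightarrow> x \<otimes> t = t \<otimes> x"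
proof -
  have P: "subgroup P G" and c2: "card {x \<in> P. x [^] (2::nat) = \<one>} = 2"
    using assms by (auto simp: quaternion_like_def)
  have "\<one> \<in> {x \<in> P. x [^] (2::nat) = \<one>}" using P by (simp add: subgroup.one_closed)
  then obtain z where z: "{x \<in> P. x [^] (2::nat) = \<one>} = {\<one>, z}" "z \<noteq> \<one>"
    using c2 unfolding card_2_iff by (metis insertE insert_commute singletonD)
  have "x \<otimes> t = t \<otimes> x" if x: "x \<in> P" and t: "t \<in> {\<one>, z}" for x t
  proof -
    have tP: "t \<in> P" "t [^] (2::nat) = \<one>" using t z(1) by blast+
    have c: "x \<in> carrier G" "t \<in> carrier G" using x tP P sub_mem by auto
    have "x \<otimes> t \<otimes> inv x \<in> P" using x tP P by (simp add: subgroup.m_closed subgroup.m_inv_closed)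
    moreover have "(x \<otimes> t \<otimes> inv x) [^] (2::nat) = \<one>" using conj_pow[OF c, of 2] tP(2) c by simp
    ultimately have "x \<otimes> t \<otimes> inv x \<in> {\<one>, z}" using z(1) by blast
    moreover have "x \<otimes> t \<otimes> inv x = \<one> \<longleftrightarrow> t = \<one>"
      using ord_conj[OF c] ord_eq_1 c by (metis inv_closed m_closed)
    ultimately have "x \<otimes> t \<otimes> inv x = t" using t by auto
    then show ?thesis using conj_commute[OF c] by simp
  qed
  then show ?thesis using that z by blast
qed

text \<open>Squares have trivial square, so they are central. The commutator is the product of the
  squares of \<open>x \<otimes> g\<close>, \<open>inv x\<close> and \<open>inv g\<close>.\<close>

lemma quaternion_like_commutator:
  assumes Q: "quaternion_like P" and x: "x \<in> P" and g: "g \<in> P" and t: "t \<in> P"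
  shows "(x \<otimes> g \<otimes> inv x \<otimes> inv g) \<otimes> t = t \<otimes> (x \<otimes> g \<otimes> inv x \<otimes> inv g)"
proof -
  obtain z where z: "{x \<in> P. x [^] (2::nat) = \<one>} = {\<one>, z}"
    "\<And>x t. x \<in> P \<Longrightarrow> t \<in> {\<one>, z} \<Longrightarrow> x \<otimes> t = t \<otimes> x"
    using quaternion_like_involutions[OF Q] by metis
  have P: "subgroup P G" and p4: "\<And>x. x \<in> P \<Longrightarrow> x [^] (4::nat) = \<one>" using Q by (auto simp: quaternion_like_def)
  have cent: "u \<otimes> (y [^] (2::nat)) = (y [^] (2::nat)) \<otimes> u" if y: "y \<in> P" and u: "u \<in> P" for u y
  proof -
    have "(y [^] (2::nat)) [^] (2::nat) = y [^] (4::nat)" using sub_mem[OF P y] by (simp add: nat_pow_pow)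
    then have "y [^] (2::nat) \<in> {\<one>, z}" using z(1) p4[OF y] pow_mem[OF P y] by auto
    then show ?thesis using z(2) u by blast
  qed
  have m: "x \<otimes> g \<in> P" "inv x \<in> P" "inv g \<in> P" using x g P by (auto simp: subgroup.m_closed subgroup.m_inv_closed)
  have c: "x \<in> carrier G" "g \<in> carrier G" "t \<in> carrier G" using x g t P sub_mem by auto
  let ?a = "(x \<otimes> g) [^] (2::nat)" and ?b = "inv x [^] (2::nat)" and ?d = "inv g [^] (2::nat)"
  have ac: "?a \<in> carrier G" "?b \<in> carrier G" "?d \<in> carrier G" using c by simp_all
  have "x \<otimes> g \<otimes> inv x \<otimes> inv g = ?a \<otimes> (inv g \<otimes> ?b \<otimes> g) \<otimes> ?d"
    using c by (simp add: numeral_2_eq_2 m_assoc)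
  also have "inv g \<otimes> ?b \<otimes> g = ?b" using cent[OF m(2) m(3)] c by (simp add: m_assoc)
  finally have e: "x \<otimes> g \<otimes> inv x \<otimes> inv g = ?a \<otimes> ?b \<otimes> ?d" .
  have "?a \<otimes> ?b \<otimes> ?d \<otimes> t = t \<otimes> (?a \<otimes> ?b \<otimes> ?d)"
    using cent[OF m(1) t] cent[OF m(2) t] cent[OF m(3) t] ac c by (metis m_assoc m_closed)
  then show ?thesis using e by simp
qed

text \<open>Such a group has class at most 2, since all commutators lie in the centre.\<close>

lemma nilpotent_if_types:
  assumes C: "comm_coprime (carrier G)"
    and types: "\<And>p. prime p \<Longrightarrow>
      (\<forall>a\<in>p_elements p (carrier G). \<forall>b\<in>p_elements p (carrier G). a \<otimes> b = b \<otimes> a) \<or> quaternion_like (p_elements p (carrier G))"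
  shows "nilpotent_group G"
proof -
  define Z where "Z = {z \<in> carrier G. \<forall>g\<in>carrier G. z \<otimes> g = g \<otimes> z}"
  define cm where "cm x g = x \<otimes> g \<otimes> inv x \<otimes> inv g" for x g
  have Zc: "Z \<subseteq> carrier G" by (auto simp: Z_def)
  have sZ: "subgroup Z G"
  proof (rule closed_imp_subgroup)
    fix x y assume xy: "x \<in> Z" "y \<in> Z"
    then have c: "x \<in> carrier G" "y \<in> carrier G" using Zc by auto
    have "x \<otimes> y \<otimes> g = g \<otimes> (x \<otimes> y)" if g: "g \<in> carrier G" for g
    proof -
      have "x \<otimes> g = g \<otimes> x" "y \<otimes> g = g \<otimes> y" using xy g by (auto simp: Z_def)
      then show ?thesis using c g by (metis m_assoc)
    qed
    then show "x \<otimes> y \<in> Z" using c by (simp add: Z_def)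
  qed (auto simp: Z_def)
  have cp: "a \<otimes> b = b \<otimes> a" if "prime p" "prime q" "p \<noteq> q" "a \<in> carrier G" "b \<in> carrier G"
    "ord a = p ^ i" "ord b = q ^ j" for p q i j a b
    using comm_coprimeD[OF C that(4,5)] that coprime_prime_powers by simp
  \<comment> \<open>Elements of order prime to \<open>p\<close> commute with the
    \<open>p\<close>-element \<open>z\<close> anyway, so commuting with \<open>p\<close>-elements is
    enough.\<close>
  have inZ: "z \<in> Z" if p: "prime p" and z: "z \<in> p_elements p (carrier G)"
    and comm: "\<And>t. t \<in> p_elements p (carrier G) \<Longrightarrow> z \<otimes> t = t \<otimes> z" for p z
  proof -
    have zc: "z \<in> carrier G" using z by (simp add: p_elements_def)
    obtain i where i: "ord z = p ^ i" using z by (auto simp: p_elements_def)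
    have "g \<in> {x \<in> carrier G. x \<otimes> z = z \<otimes> x}" if g: "g \<in> carrier G" for g
    proof (rule gen_prime_powers[OF centralizer_subgroup[OF zc] g])
      fix q n j assume q: "prime q" "ord (g [^] (n::nat)) = q ^ j"
      have gn: "g [^] n \<in> carrier G" using g by simp
      have "g [^] n \<otimes> z = z \<otimes> g [^] n"
      proof (cases "q = p")
        case True
        then have "g [^] n \<in> p_elements p (carrier G)" using gn q(2) by (auto simp: p_elements_def)
        then show ?thesis using comm by metis
      next
        case False
        then show ?thesis using cp[OF q(1) p False gn zc q(2) i] by blast
      qed
      then show "g [^] n \<in> {x \<in> carrier G. x \<otimes> z = z \<otimes> x}" using gn by simp
    qed
    then show ?thesis using zc by (auto simp: Z_def)
  qed
  \<comment> \<open>Central commutators are multiplicative in each argument. Hence the elements with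
    central commutators form a subgroup, and \<open>gen_prime_powers\<close> reduces both arguments
    to prime power order.\<close>
  have cml: "cm (x \<otimes> y) g = cm y g \<otimes> cm x g"
    if c: "x \<in> carrier G" "y \<in> carrier G" "g \<in> carrier G" and y: "cm y g \<in> Z" for x y g
  proof -
    have "cm (x \<otimes> y) g = x \<otimes> cm y g \<otimes> (g \<otimes> inv x \<otimes> inv g)" using c by (simp add: cm_def m_assoc inv_mult_group)
    also have "x \<otimes> cm y g = cm y g \<otimes> x" using y c by (simp add: Z_def)
    also have "cm y g \<otimes> x \<otimes> (g \<otimes> inv x \<otimes> inv g) = cm y g \<otimes> cm x g" using c by (simp add: cm_def m_assoc)
    finally show ?thesis .
  qed
  have cmr: "cm g (x \<otimes> y) = cm g x \<otimes> cm g y"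
    if c: "x \<in> carrier G" "y \<in> carrier G" "g \<in> carrier G" and y: "cm g y \<in> Z" for x y g
  proof -
    have "cm g (x \<otimes> y) = g \<otimes> x \<otimes> inv g \<otimes> (cm g y \<otimes> inv x)" using c by (simp add: cm_def m_assoc inv_mult_group)
    also have "cm g y \<otimes> inv x = inv x \<otimes> cm g y" using y c by (simp add: Z_def)
    also have "g \<otimes> x \<otimes> inv g \<otimes> (inv x \<otimes> cm g y) = cm g x \<otimes> cm g y" using c by (simp add: cm_def m_assoc)
    finally show ?thesis .
  qed
  have pp: "cm x g \<in> Z" if p: "prime p" and q: "prime q" and c: "x \<in> carrier G" "g \<in> carrier G"
    and o: "ord x = p ^ i" "ord g = q ^ j" for p q i j x g
  proof -
    have one: "cm x g \<in> Z" if "x \<otimes> g = g \<otimes> x"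
    proof -
      have "cm x g = \<one>" unfolding cm_def commute_conj[OF c that] using c by simp
      then show ?thesis using sZ by (simp add: subgroup.one_closed)
    qed
    show ?thesis
    proof (cases "p = q")
      case False
      then show ?thesis using cp[OF p q False c o] one by blast
    next
      case True
      let ?P = "p_elements p (carrier G)"
      have x: "x \<in> ?P" "g \<in> ?P" using c o True by (auto simp: p_elements_def)
      have P: "subgroup ?P G" using p_elements_subgroup(1)[OF subgroup_self C p] .
      have "cm x g \<in> ?P" using x P by (simp add: cm_def subgroup.m_closed subgroup.m_inv_closed)
      then show ?thesis using types[OF p] one x inZ[OF p] quaternion_like_commutator[OF _ x] unfolding cm_def by blast
    qed
  qed
  have all: "cm x g \<in> Z" if x: "x \<in> carrier G" and g: "g \<in> carrier G" for x g
  proof -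
    have "x \<in> {x \<in> carrier G. cm x g \<in> Z}"
    proof (rule gen_prime_powers[OF _ x])
      show "subgroup {x \<in> carrier G. cm x g \<in> Z} G"
        by (rule closed_imp_subgroup) (use g sZ in \<open>auto simp: cml subgroup.m_closed subgroup.one_closed\<close>, simp add: cm_def subgroup.one_closed)
      fix p n i assume p: "prime p" "ord (x [^] (n::nat)) = p ^ i"
      have xn: "x [^] n \<in> carrier G" using x by simp
      have "g \<in> {g \<in> carrier G. cm (x [^] n) g \<in> Z}"
      proof (rule gen_prime_powers[OF _ g])
        show "subgroup {g \<in> carrier G. cm (x [^] n) g \<in> Z} G"
          by (rule closed_imp_subgroup) (use xn sZ in \<open>auto simp: cmr subgroup.m_closed subgroup.one_closed\<close>, simp add: cm_def subgroup.one_closed)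
        fix q m j assume q: "prime q" "ord (g [^] (m::nat)) = q ^ j"
        have "cm (x [^] n) (g [^] m) \<in> Z" using pp[OF p(1) q(1) xn _ p(2) q(2)] g by simp
        then show "g [^] m \<in> {g \<in> carrier G. cm (x [^] n) g \<in> Z}" using g by simp
      qed
      then show "x [^] n \<in> {x \<in> carrier G. cm x g \<in> Z}" using xn by simp
    qed
    then show ?thesis by simp
  qed
  define N where "N i = (if i = 0 then {\<one>} else if i = 1 then Z else carrier G)" for i :: nat
  have nZ: "Z \<lhd> G" using sZ by (auto simp: normal_inv_iff Z_def m_assoc)
  have "N i \<lhd> G" for i using one_is_normal normal_self nZ by (simp add: N_def)
  moreover have "N i \<subseteq> N (Suc i)" for i using Zc sZ by (auto simp: N_def subgroup.one_closed)
  moreover have "x \<otimes> g \<otimes> inv x \<otimes> inv g \<in> N i" if i: "i < 2" and x: "x \<in> N (Suc i)" and g: "g \<in> carrier G" for i x g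
  proof (cases "i = 0")
    case True
    then have "x \<in> Z" using x by (simp add: N_def)
    then have "x \<otimes> g = g \<otimes> x" "x \<in> carrier G" using g by (auto simp: Z_def)
    then show ?thesis using True g by (simp add: N_def m_assoc)
  next
    case False
    then have "i = 1" using i by simp
    then show ?thesis using all[of x g] x g by (simp add: N_def cm_def)
  qed
  ultimately show ?thesis
    unfolding nilpotent_group_def using is_group by (intro conjI exI[of _ N] exI[of _ 2]) (auto simp: N_def)
qed

section \<open>Isomorphism types of Sylow subgroups\<close>

lemma cyclic_group_sub_iff:
  assumes "subgroup P G"
  shows "cyclic_group (G\<lparr>carrier := P\<rparr>) \<longleftrightarrow> is_cyclic P"
proof -
  interpret P: group "G\<lparr>carrier := P\<rparr>" using assms by (rule subgroup_imp_group)
  have "range (\<lambda>n::int. x [^]\<^bsub>G\<lparr>carrier := P\<rparr>\<^esub> n) = cyc x" if "x \<in> P" for x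
    using generate_pow[of x] sub_mem[OF assms that] int_pow_consistent[OF assms that]
    by (auto simp: full_SetCompr_eq)
  then show ?thesis unfolding P.cyclic_group is_cyclic_def by auto
qed

text \<open>Elements \<open>a\<close> and \<open>b\<close> of order \<open>p\<close> with
  \<open>b\<close> outside \<open>cyc a\<close> give \<open>R\<close> as the set of products of
  their powers; both groups have \<open>p ^ 2\<close> elements, so surjectivity implies
  injectivity.\<close>

lemma elementary_iso:
  assumes E: "elementary p R"
  shows "G\<lparr>carrier := R\<rparr> \<cong> integer_mod_group p \<times>\<times> integer_mod_group p"
proof -
  have p: "prime p" and R: "subgroup R G" and cR: "card R = p\<^sup>2" and e: "\<And>x. x \<in> R \<Longrightarrow> x [^] p = \<one>"
    using E by (auto simp: elementary_def)
  have p1: "1 < p" using p prime_gt_1_nat by blast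
  have o: "ord x dvd p" if "x \<in> R" for x using that e pow_eq_id sub_mem[OF R] by metis
  have "R \<noteq> {\<one>}" using cR p1 by (auto simp: power2_eq_square)
  then obtain a where a: "a \<in> R" "a \<noteq> \<one>" using R subgroup.one_closed by blast
  have ac: "a \<in> carrier G" using a R sub_mem by blast
  have oa: "ord a = p" using o[OF a(1)] p a(2) ord_eq_1[OF ac] by (metis prime_nat_iff)
  have "cyc a \<noteq> R" using card_cyc[OF ac] oa cR p1 by (auto simp: power2_eq_square)
  then obtain b where b: "b \<in> R" "b \<notin> cyc a" using cyc_sub[OF R a(1)] by blast
  have bc: "b \<in> carrier G" using b R sub_mem by blast
  have "card (adjoin (cyc a) b) = card R"
    using adjoin_card_prime[OF cyc_subgroup[OF ac] bc b(2) p] e[OF b(1)] cyc_subgroup[OF ac] card_cyc[OF ac] oa cR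
    by (simp add: subgroup.one_closed power2_eq_square)
  then have A: "adjoin (cyc a) b = R"
    using adjoin_least[OF R cyc_sub[OF R a(1)] b(1)] finite_subgroup[OF R] card_subset_eq by blast
  let ?H = "integer_mod_group p \<times>\<times> integer_mod_group p"
  have carH: "carrier ?H = {0..<int p} \<times> {0..<int p}" using p1 by (simp add: carrier_integer_mod_group)
  define f where "f = (\<lambda>(i, j). a [^] (i::int) \<otimes> b [^] (j::int))"
  \<comment> \<open>The reduction modulo \<open>p\<close> in \<open>integer_mod_group p\<close> is
    invisible in exponents, as orders in \<open>R\<close> divide \<open>p\<close>.\<close>
  have md: "x [^] (i mod int p) = x [^] i" if "x \<in> R" for x and i :: int
  proof -
    have "int (ord x) dvd i - i mod int p"
      using o[OF that] by (metis dvd_minus_mod dvd_trans of_nat_dvd_iff)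
    then show ?thesis using int_pow_eq[OF sub_mem[OF R that]] by simp
  qed
  have inR: "x [^] (i::int) \<in> R" if "x \<in> R" for x i using subgroup_int_pow_closed[OF R that] .
  have cm: "b [^] (j::int) \<otimes> a [^] (i::int) = a [^] i \<otimes> b [^] j" for i j
    using elementary_comm[OF E inR[OF b(1)] inR[OF a(1)]] .
  have hom: "f \<in> hom ?H (G\<lparr>carrier := R\<rparr>)"
  proof (rule homI)
    fix x y assume "x \<in> carrier ?H" "y \<in> carrier ?H"
    obtain i j where x: "x = (i, j)" by (cases x)
    obtain k l where y: "y = (k, l)" by (cases y)
    have "f (x \<otimes>\<^bsub>?H\<^esub> y) = a [^] (i + k) \<otimes> b [^] (j + l)"
      by (simp add: x y f_def md[OF a(1)] md[OF b(1)])
    also have "\<dots> = a [^] i \<otimes> (b [^] j \<otimes> a [^] k) \<otimes> b [^] l"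
      using ac bc by (simp add: cm int_pow_mult m_assoc)
    also have "\<dots> = f x \<otimes> f y" using ac bc by (simp add: x y f_def m_assoc)
    finally show "f (x \<otimes>\<^bsub>?H\<^esub> y) = f x \<otimes>\<^bsub>G\<lparr>carrier := R\<rparr>\<^esub> f y" by simp
  next
    fix x assume "x \<in> carrier ?H"
    show "f x \<in> carrier (G\<lparr>carrier := R\<rparr>)"
      using inR[OF a(1)] inR[OF b(1)] R by (cases x) (simp add: f_def subgroup.m_closed)
  qed
  have surj: "f ` carrier ?H = R"
  proof
    show "f ` carrier ?H \<subseteq> R"
      using inR[OF a(1)] inR[OF b(1)] R by (auto simp: f_def subgroup.m_closed)
    show "R \<subseteq> f ` carrier ?H"
    proof
      fix x assume "x \<in> R"
      then have "x \<in> adjoin (cyc a) b" using A by simp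
      then obtain h n where h: "h \<in> cyc a" "x = h \<otimes> b [^] (n::nat)" by (auto simp: adjoin_def)
      obtain m where m: "h = a [^] (m::nat)" using cyc_memE[OF ac h(1)] by blast
      have "x = f (int m mod int p, int n mod int p)"
        using h m md[OF a(1), of "int m"] md[OF b(1), of "int n"] by (simp add: f_def int_pow_int)
      moreover have "(int m mod int p, int n mod int p) \<in> carrier ?H" using carH p1 by simp
      ultimately show "x \<in> f ` carrier ?H" by blast
    qed
  qed
  have fin: "finite (carrier ?H)" using carH by simp
  have "card (carrier ?H) = card R" using carH cR by (simp add: power2_eq_square)
  then have "inj_on f (carrier ?H)" using eq_card_imp_inj_on[OF fin, of f] unfolding surj by simp
  then have "f \<in> iso ?H (G\<lparr>carrier := R\<rparr>)" using hom surj by (simp add: iso_def bij_betw_def)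
  then have "?H \<cong> G\<lparr>carrier := R\<rparr>" by (auto simp: is_iso_def)
  then show ?thesis using group.iso_sym[OF DirProd_group[OF group_integer_mod_group group_integer_mod_group]] by blast
qed

lemma iso_elementary:
  assumes R: "subgroup R G" and q: "prime q"
    and iso: "G\<lparr>carrier := R\<rparr> \<cong> integer_mod_group q \<times>\<times> integer_mod_group q"
  shows "elementary q R"
proof -
  let ?H = "integer_mod_group q \<times>\<times> integer_mod_group q"
  interpret R: group "G\<lparr>carrier := R\<rparr>" using R by (rule subgroup_imp_group)
  interpret H: group ?H by (rule DirProd_group) simp_all
  obtain f where f: "f \<in> iso (G\<lparr>carrier := R\<rparr>) ?H" using iso by (auto simp: is_iso_def)
  interpret f: group_hom "G\<lparr>carrier := R\<rparr>" ?H f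
    using f by (simp add: iso_def group_hom_def group_hom_axioms_def H.is_group R.is_group)
  have bij: "bij_betw f R (carrier ?H)" using f by (simp add: iso_def)
  have q1: "1 < q" using q prime_gt_1_nat by blast
  have "card R = q\<^sup>2" using bij_betw_same_card[OF bij] q1 by (simp add: carrier_integer_mod_group power2_eq_square)
  moreover have "x [^] q = \<one>" if x: "x \<in> R" for x
  proof -
    have pw: "y [^]\<^bsub>?H\<^esub> n = (fst y [^]\<^bsub>integer_mod_group q\<^esub> n, snd y [^]\<^bsub>integer_mod_group q\<^esub> n)" for y and n :: nat
      by (induction n) (simp_all add: mult_DirProd')
    have "f (x [^] q) = f x [^]\<^bsub>?H\<^esub> q" using f.hom_nat_pow[of x q] x by (simp flip: nat_pow_consistent)
    also have "\<dots> = \<one>\<^bsub>?H\<^esub>" by (simp add: pw)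
    also have "\<dots> = f \<one>" using f.hom_one by simp
    finally show ?thesis using bij x pow_mem[OF R x, of q] subgroup.one_closed[OF R] by (meson bij_betw_def inj_onD)
  qed
  ultimately show ?thesis using R q by (simp add: elementary_def)
qed

section \<open>Divisibility from the types of Sylow subgroups\<close>

definition ord_count :: "'a set \<Rightarrow> nat \<Rightarrow> nat" where "ord_count S m = card {x \<in> S. ord x = m}"

lemma euler_cnt: "euler S = ord_count S (expo S)"
  by (simp add: euler_def ord_count_def)

text \<open>Products of commuting elements of orders \<open>m\<close> and \<open>n\<close> biject
  with the elements of order \<open>m * n\<close>: raising to the power \<open>u\<close>, which is 1
  modulo \<open>m\<close> and 0 modulo \<open>n\<close>, recovers the first factor.\<close>

lemma ord_count_mult:
  assumes S: "subgroup S G" "comm_coprime S" and co: "coprime m n"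
  shows "ord_count S (m * n) = ord_count S m * ord_count S n"
proof -
  let ?A = "{x \<in> S. ord x = m}" and ?B = "{x \<in> S. ord x = n}" and ?C = "{x \<in> S. ord x = m * n}"
  let ?f = "\<lambda>(a, b). a \<otimes> b"
  obtain u where u: "[u = 1] (mod m)" "[u = 0] (mod n)" using binary_chinese_remainder_nat[OF co] by blast
  have comm: "a \<otimes> b = b \<otimes> a" if "a \<in> ?A" "b \<in> ?B" for a b
    using comm_coprimeD[OF S(2)] that co by auto
  have rec: "(a \<otimes> b) [^] u = a" if ab: "a \<in> ?A" "b \<in> ?B" for a b
  proof -
    have c: "a \<in> carrier G" "b \<in> carrier G" using ab S sub_mem by auto
    have "(a \<otimes> b) [^] u = a [^] u \<otimes> b [^] u" using pow_mult_distrib[OF comm[OF ab] c] .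
    also have "a [^] u = a [^] (1::nat)" using pow_eq_iff[OF c(1)] u(1) ab by blast
    also have "b [^] u = b [^] (0::nat)" using pow_eq_iff[OF c(2)] u(2) ab by blast
    finally show ?thesis using c by simp
  qed
  have inj: "inj_on ?f (?A \<times> ?B)"
  proof (rule inj_onI)
    fix x y assume x: "x \<in> ?A \<times> ?B" and y: "y \<in> ?A \<times> ?B" and e: "?f x = ?f y"
    obtain a b where ab: "x = (a, b)" "a \<in> ?A" "b \<in> ?B" using x by blast
    obtain c d where cd: "y = (c, d)" "c \<in> ?A" "d \<in> ?B" using y by blast
    have "a = c" using rec[OF ab(2,3)] rec[OF cd(2,3)] e ab cd by simp
    moreover have "a \<in> carrier G" "b \<in> carrier G" "d \<in> carrier G" using ab cd S sub_mem by auto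
    ultimately show "x = y" using e ab cd by simp
  qed
  have img: "?f ` (?A \<times> ?B) = ?C"
  proof
    show "?f ` (?A \<times> ?B) \<subseteq> ?C"
    proof clarify
      fix a b assume ab: "a \<in> S" "b \<in> S" "m = ord a" "n = ord b"
      have "ord (a \<otimes> b) = ord a * ord b"
        by (rule ord_commuting_coprime) (use ab comm[of a b] co S sub_mem in auto)
      then show "a \<otimes> b \<in> S \<and> ord (a \<otimes> b) = ord a * ord b" using ab S by (simp add: subgroup.m_closed)
    qed
    show "?C \<subseteq> ?f ` (?A \<times> ?B)"
    proof
      fix x assume x: "x \<in> ?C"
      then obtain s t :: nat where st: "x = x [^] s \<otimes> x [^] t" "ord (x [^] s) = m" "ord (x [^] t) = n"
        using split_coprime[OF _ _ co, of x] sub_mem[OF S(1)] by blast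
      have "x [^] s \<in> ?A" "x [^] t \<in> ?B" using st x pow_mem[OF S(1)] by auto
      then have "(x [^] s, x [^] t) \<in> ?A \<times> ?B" by blast
      then show "x \<in> ?f ` (?A \<times> ?B)" using st(1) by (intro image_eqI[of _ _ "(x [^] s, x [^] t)"]) auto
    qed
  qed
  show ?thesis
    using card_image[OF inj] unfolding img ord_count_def by (simp add: card_cartesian_product)
qed

lemma ord_count_one: "subgroup S G \<Longrightarrow> ord_count S 1 = 1"
proof -
  assume S: "subgroup S G"
  have "{x \<in> S. ord x = 1} = {\<one>}" using ord_eq_1 sub_mem[OF S] subgroup.one_closed[OF S] by auto
  then show ?thesis by (simp add: ord_count_def)
qed

lemma ord_count_prod:
  assumes S: "subgroup S G" "comm_coprime S" and F: "finite F" "\<And>p. p \<in> F \<Longrightarrow> prime p"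
  shows "ord_count S (\<Prod>p\<in>F. p ^ e p) = (\<Prod>p\<in>F. ord_count S (p ^ e p))"
  using F
proof (induction F rule: finite_induct)
  case empty
  then show ?case using ord_count_one[OF S(1)] by simp
next
  case (insert q F)
  have "coprime (q ^ e q) (\<Prod>p\<in>F. p ^ e p)"
    using insert by (intro prod_coprime_right coprime_prime_powers) auto
  then show ?case using insert ord_count_mult[OF S] by simp
qed

text \<open>The exponent of the \<open>p\<close>-part is the \<open>p\<close>-part of the exponent:
  an element of order \<open>expo K\<close> has a power of order \<open>p ^ \<beta>\<close>, and
  \<open>p\<close>-elements of \<open>K\<close> have orders dividing \<open>expo K\<close>.\<close>

lemma euler_pel:
  assumes A: exp_attained and p: "prime p" and K: "subgroup K G" and P: "subgroup (p_elements p K) G"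
  shows "euler (p_elements p K) = ord_count K (p ^ multiplicity p (expo K))"
proof -
  obtain x where x: "x \<in> K" "ord x = expo K" using A K by (auto simp: exp_attained_def)
  have xc: "x \<in> carrier G" using x K sub_mem by blast
  define \<beta> where "\<beta> = multiplicity p (expo K)"
  have e0: "expo K \<noteq> 0" using ord_pos[OF xc] x by simp
  obtain e where e: "ord x = p ^ \<beta> * e" "\<not> p dvd e"
    using multiplicity_decompose'[of "ord x" p] e0 p x(2) unfolding \<beta>_def by (metis not_prime_unit)
  have "coprime (p ^ \<beta>) e" using p e(2) by (simp add: prime_imp_coprime coprime_power_left_iff)
  then obtain s where s: "ord (x [^] (s::nat)) = p ^ \<beta>" using split_coprime[OF xc e(1)] by blast
  have "x [^] s \<in> p_elements p K" using s pow_mem[OF K x(1)] by (auto simp: p_elements_def)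
  then have d1: "p ^ \<beta> dvd expo (p_elements p K)" using ord_dvd_expo[of "x [^] s"] s by simp
  obtain z where z: "z \<in> p_elements p K" "ord z = expo (p_elements p K)" using A P by (auto simp: exp_attained_def)
  obtain \<gamma> where g: "ord z = p ^ \<gamma>" "z \<in> K" using z by (auto simp: p_elements_def)
  have "p ^ \<gamma> dvd expo K" using ord_dvd_expo[OF g(2)] g by simp
  then have "\<gamma> \<le> \<beta>" using e0 p unfolding \<beta>_def by (intro multiplicity_geI) auto
  then have "expo (p_elements p K) dvd p ^ \<beta>" using g z(2) by (metis le_imp_power_dvd)
  then have ex: "expo (p_elements p K) = p ^ \<beta>" using d1 by (simp add: dvd_antisym)
  have "{x \<in> p_elements p K. ord x = p ^ \<beta>} = {x \<in> K. ord x = p ^ \<beta>}" by (auto simp: p_elements_def)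
  then show ?thesis by (simp add: euler_def ord_count_def ex \<beta>_def)
qed

text \<open>The count is squeezed between those in \<open>cyc x\<close> and in \<open>cyc a\<close>,
  where \<open>x\<close> has order \<open>expo H\<close>; both are
  \<open>totient (expo H)\<close>.\<close>

lemma euler_cyclic_sub:
  assumes A: exp_attained and a: "a \<in> carrier G" and H: "subgroup H G" "H \<subseteq> cyc a"
  shows "euler H = totient (expo H)"
proof -
  obtain x where x: "x \<in> H" "ord x = expo H" using A H by (auto simp: exp_attained_def)
  have xc: "x \<in> carrier G" using x H sub_mem by blast
  have d: "expo H dvd ord a" using ord_dvd_card[OF cyc_subgroup[OF a], of x] x H(2) card_cyc[OF a] by auto
  have c1: "card {y \<in> cyc a. ord y = expo H} = totient (expo H)" using ord_count_cyc[OF a d] .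
  have c2: "card {y \<in> cyc x. ord y = expo H} = totient (expo H)" using ord_count_cyc[OF xc, of "expo H"] x(2) by simp
  have "finite (cyc a)" using cyc_subgroup[OF a] finite_subgroup by blast
  then have "card {y \<in> H. ord y = expo H} \<le> totient (expo H)"
    unfolding c1[symmetric] using H(2) by (intro card_mono) auto
  moreover have "totient (expo H) \<le> card {y \<in> H. ord y = expo H}"
    unfolding c2[symmetric] using cyc_sub[OF H(1) x(1)] finite_subgroup[OF H(1)] by (intro card_mono) auto
  ultimately show ?thesis by (simp add: euler_def)
qed

text \<open>For exponent 2 only the involution counts. For exponent 4 the subgroup contains
  \<open>z\<close>, the square of an element of order 4, and all elements except
  \<open>\<one>\<close> and \<open>z\<close> count. The clause about order 4 serves to exclude the
  value 1 for larger subgroups.\<close>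

lemma euler_quaternion_sub:
  assumes A: exp_attained and Q: "quaternion_like P" and H: "subgroup H G" "H \<subseteq> P"
  shows "euler H = 1 \<or> (\<exists>x\<in>H. ord x = 4) \<and> (card H = 4 \<and> euler H = 2 \<or> card H = 8 \<and> euler H = 6)"
proof -
  obtain z where z: "z \<noteq> \<one>" "{x \<in> P. x [^] (2::nat) = \<one>} = {\<one>, z}"
    using quaternion_like_involutions[OF Q] by metis
  have P: "subgroup P G" "card P = 8" and p4: "\<And>x. x \<in> P \<Longrightarrow> x [^] (4::nat) = \<one>"
    using Q by (auto simp: quaternion_like_def)
  have Hc: "H \<subseteq> carrier G" using H subgroup.subset by blast
  have one: "\<one> \<in> H" using H subgroup.one_closed by blast
  have o4: "ord x dvd 4" if "x \<in> H" for x using p4 that H Hc pow_eq_id by blast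
  have d4: "d \<in> {1, 2, 4}" if "d dvd 4" for d :: nat
  proof -
    have "d \<le> 4" using that by (intro dvd_imp_le) auto
    then have "d \<in> {0,1,2,3,4}" by auto
    then show ?thesis using that by auto
  qed
  obtain x where x: "x \<in> H" "ord x = expo H" using A H by (auto simp: exp_attained_def)
  consider "expo H = 1" | "expo H = 2" | "expo H = 4" using d4[OF o4[OF x(1)]] x(2) by auto
  then show ?thesis
  proof cases
    case 1
    then show ?thesis using ord_count_one[OF H(1)] by (simp add: euler_cnt)
  next
    case 2
    have "y = z" if "y \<in> H" "ord y = 2" for y
    proof -
      have yc: "y \<in> carrier G" using that Hc by blast
      have "y [^] (2::nat) = \<one>" using pow_ord_eq_1[OF yc] that(2) by simp
      then have "y \<in> {\<one>, z}" using z(2) that(1) H(2) by blast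
      moreover have "y \<noteq> \<one>" using that(2) by auto
      ultimately show ?thesis by blast
    qed
    then have "{y \<in> H. ord y = 2} = {x}" using x 2 by auto
    then show ?thesis by (simp add: euler_def 2)
  next
    case 3
    have xc: "x \<in> carrier G" using x Hc by blast
    have "x [^] (2::nat) \<noteq> \<one>" using pow_eq_id[OF xc, of 2] x(2) 3 by auto
    moreover have "x [^] (2::nat) \<in> {\<one>, z}"
    proof -
      have "(x [^] (2::nat)) [^] (2::nat) = \<one>" using p4[of x] x(1) H(2) xc by (auto simp: nat_pow_pow)
      moreover have "x [^] (2::nat) \<in> P" using pow_mem[OF H(1) x(1)] H(2) by blast
      ultimately show ?thesis using z(2) by blast
    qed
    ultimately have zH: "z \<in> H" using pow_mem[OF H(1) x(1), of 2] by auto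
    have "ord y = 4 \<longleftrightarrow> y \<notin> {\<one>, z}" if y: "y \<in> H" for y
    proof -
      have yc: "y \<in> carrier G" using y Hc by blast
      have "y \<in> {\<one>, z} \<longleftrightarrow> y [^] (2::nat) = \<one>" using z(2) y H(2) by blast
      also have "\<dots> \<longleftrightarrow> ord y dvd 2" using pow_eq_id[OF yc] .
      also have "\<dots> \<longleftrightarrow> ord y \<noteq> 4" using d4[OF o4[OF y]] by auto
      finally show ?thesis by blast
    qed
    then have "{y \<in> H. ord y = 4} = H - {\<one>, z}" by auto
    then have e: "euler H = card H - 2" using z(1) zH one by (simp add: euler_def 3 card_Diff_subset)
    have "card H dvd 8" using card_sub_dvd[OF H(1) P(1) H(2)] P(2) by simp
    moreover have "4 dvd card H" using ord_dvd_card[OF H(1) x(1)] x(2) 3 by simp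
    ultimately obtain k where k: "card H = 4 * k" "4 * k dvd 4 * 2" by (auto elim!: dvdE[of 4])
    then have "k dvd 2" by simp
    then have "k = 1 \<or> k = 2" using two_is_prime_nat by (metis prime_nat_iff)
    then have "card H = 4 \<and> euler H = 2 \<or> card H = 8 \<and> euler H = 6" using e k(1) by (elim disjE) simp_all
    moreover have "\<exists>x\<in>H. ord x = 4" using x 3 by metis
    ultimately show ?thesis by blast
  qed
qed

text \<open>The values are totients in the cyclic case, 1, \<open>q - 1\<close> and
  \<open>q\<^sup>2 - 1\<close> in the elementary case, and 1, 2 and 6 in the quaternion case; along
  inclusions each divides the next.\<close>

lemma euler_dvd_types:
  assumes A: exp_attained and sP: "subgroup P G" and types: "is_cyclic P \<or> (\<exists>q. elementary q P) \<or> quaternion_like P"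
    and H: "subgroup H G" "H \<subseteq> K" and K: "subgroup K G" "K \<subseteq> P"
  shows "euler H dvd euler K"
proof -
  have ee: "expo H dvd expo K" using H ord_dvd_expo by (intro expo_dvd) blast
  have HP: "H \<subseteq> P" using H K by blast
  from types consider "is_cyclic P" | q where "elementary q P" | "quaternion_like P" by blast
  then show ?thesis
  proof cases
    case 1
    then obtain a where a: "a \<in> P" "P = cyc a" by (auto simp: is_cyclic_def)
    have ac: "a \<in> carrier G" using sub_mem[OF sP a(1)] .
    show ?thesis
      using euler_cyclic_sub[OF A ac H(1)] euler_cyclic_sub[OF A ac K(1)] HP K(2) a(2) totient_dvd[OF ee] by simp
  next
    case (2 q)
    then have q: "prime q" and P: "subgroup P G" "card P = q\<^sup>2" and e: "\<And>x. x \<in> P \<Longrightarrow> x [^] q = \<one>"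
      by (auto simp: elementary_def)
    have q1: "1 < q" using q prime_gt_1_nat by blast
    show ?thesis
    proof (cases "H = {\<one>}")
      case True
      then have "expo H = 1" by (simp add: expo_def)
      then show ?thesis using ord_count_one[OF H(1)] by (simp add: euler_cnt)
    next
      case False
      have "K \<noteq> {\<one>}" using False H subgroup.one_closed by blast
      have eH: "euler H = card H - 1" by (rule euler_exponent_prime(2)[OF H(1) q _ False]) (use e HP in blast)
      have eK: "euler K = card K - 1" by (rule euler_exponent_prime(2)[OF K(1) q _ \<open>K \<noteq> {\<one>}\<close>]) (use e K in blast)
      obtain i where i: "card H = q ^ i" "i \<le> 2"
        using card_sub_dvd[OF H(1) P(1) HP] P(2) q by (metis divides_primepow_nat)
      obtain j where j: "card K = q ^ j" "j \<le> 2"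
        using card_sub_dvd[OF K(1) P(1) K(2)] P(2) q by (metis divides_primepow_nat)
      have "i \<noteq> 0"
      proof
        assume "i = 0"
        then have "card H = 1" using i by simp
        then show False using False subgroup.one_closed[OF H(1)] by (metis card_1_singletonE singletonD)
      qed
      moreover have "i \<le> j"
      proof -
        have "q ^ i \<le> q ^ j" using card_mono[OF finite_subgroup[OF K(1)] H(2)] i j by simp
        then show ?thesis using q1 by simp
      qed
      ultimately consider "i = j" | "i = 1" "j = 2" using j(2) i(2) by linarith
      then show ?thesis
      proof cases
        case 1
        then show ?thesis using eH eK i j by simp
      next
        case 2
        have "q\<^sup>2 - 1 = (q - 1) * (q + 1)" using q1 by (cases q) (auto simp: power2_eq_square algebra_simps)
        then show ?thesis using eH eK i j 2 by simp
      qed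
    qed
  next
    case 3
    \<comment> \<open>An element of order 4 and its inverse are two elements of largest order in
      \<open>K\<close>.\<close>
    have eK: "euler K \<noteq> 1" if "\<exists>x\<in>H. ord x = 4"
    proof -
      from that obtain x where x: "x \<in> H" "ord x = 4" by blast
      have xc: "x \<in> carrier G" using x H sub_mem by blast
      have "ord t dvd 4" if "t \<in> K" for t
        using 3 that K(2) pow_eq_id[OF sub_mem[OF K(1) that], of 4] by (auto simp: quaternion_like_def)
      then have "expo K dvd 4" by (rule expo_dvd)
      moreover have "4 dvd expo K" using ord_dvd_expo[of x K] x H by auto
      ultimately have ex: "expo K = 4" by (simp add: dvd_antisym)
      have "{x, inv x} \<subseteq> {y \<in> K. ord y = expo K}" using x H K(1) xc by (auto simp: ex subgroup.m_inv_closed)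
      moreover have "x \<noteq> inv x"
      proof
        assume "x = inv x"
        then have "x \<otimes> x = \<one>" using xc by (metis r_inv)
        then have "x [^] (2::nat) = \<one>" using xc by (simp add: numeral_2_eq_2)
        then show False using pow_eq_id[OF xc] x(2) by simp
      qed
      ultimately have "2 \<le> euler K"
        unfolding euler_def using card_mono[of "{y \<in> K. ord y = expo K}" "{x, inv x}"] finite_subgroup[OF K(1)] by simp
      then show ?thesis by simp
    qed
    have cHK: "card H \<le> card K" using card_mono[OF finite_subgroup[OF K(1)] H(2)] .
    show ?thesis
    proof (cases "euler H = 1")
      case True
      then show ?thesis by simp
    next
      case False
      then have h: "card H = 4 \<and> euler H = 2 \<or> card H = 8 \<and> euler H = 6" "euler K \<noteq> 1"
        using euler_quaternion_sub[OF A 3 H(1) HP] eK by blast+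
      then have "card K = 4 \<and> euler K = 2 \<or> card K = 8 \<and> euler K = 6"
        using euler_quaternion_sub[OF A 3 K] by blast
      then show ?thesis using h(1) cHK by auto
    qed
  qed
qed

text \<open>The exponent factors into prime powers and \<open>ord_count\<close> respects coprime
  factors, so \<open>euler\<close> is a product over the \<open>p\<close>-parts, where
  \<open>euler_dvd_types\<close> applies.\<close>

lemma euler_monotone_if_types:
  assumes A: exp_attained and C: "comm_coprime (carrier G)"
    and types: "\<And>p. prime p \<Longrightarrow>
      is_cyclic (p_elements p (carrier G)) \<or> (\<exists>q. elementary q (p_elements p (carrier G))) \<or> quaternion_like (p_elements p (carrier G))"
  shows euler_monotone
proof -
  let ?F = "prime_factors (card (carrier G))"
  have g0: "card (carrier G) \<noteq> 0" using card_sub_pos[OF subgroup_self] by simp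
  have CS: "comm_coprime S" if "subgroup S G" for S
    using C subgroup.subset[OF that] unfolding comm_coprime_def by blast
  have main: "euler S = (\<Prod>p\<in>?F. euler (p_elements p S))" if S: "subgroup S G" for S
  proof -
    have ed: "expo S dvd card (carrier G)"
      using expo_dvd_card[OF S] card_sub_dvd[OF S subgroup_self subgroup.subset[OF S]] by (rule dvd_trans)
    then have e0: "expo S > 0" using g0 by (metis dvd_0_left_iff gr0I)
    have "expo S = (\<Prod>p\<in>prime_factors (expo S). p ^ multiplicity p (expo S))" using prime_factorization_nat[OF e0] .
    \<comment> \<open>One index set for all subgroups lets the products for \<open>H\<close> and
      \<open>K\<close> be compared factor by factor; the added primes have exponent 0.\<close>
    also have "\<dots> = (\<Prod>p\<in>?F. p ^ multiplicity p (expo S))"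
    proof (rule prod.mono_neutral_left)
      show "\<forall>p\<in>?F - prime_factors (expo S). p ^ multiplicity p (expo S) = 1"
        by (auto simp: prime_factors_multiplicity)
    qed (use dvd_prime_factors[OF g0 ed] in auto)
    finally have "euler S = ord_count S (\<Prod>p\<in>?F. p ^ multiplicity p (expo S))" by (simp add: euler_cnt)
    also have "\<dots> = (\<Prod>p\<in>?F. ord_count S (p ^ multiplicity p (expo S)))"
      by (rule ord_count_prod[OF S CS[OF S]]) auto
    also have "\<dots> = (\<Prod>p\<in>?F. euler (p_elements p S))"
    proof (rule prod.cong[OF refl])
      fix p assume "p \<in> ?F"
      then have p: "prime p" by auto
      show "ord_count S (p ^ multiplicity p (expo S)) = euler (p_elements p S)"
        using euler_pel[OF A p S p_elements_subgroup(1)[OF S CS[OF S] p]] by simp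
    qed
    finally show ?thesis .
  qed
  show ?thesis
    unfolding euler_monotone_def
  proof (intro allI impI)
    fix H K assume H: "subgroup H G" and K: "subgroup K G" and HK: "H \<subseteq> K"
    have "euler (p_elements p H) dvd euler (p_elements p K)" if "p \<in> ?F" for p
    proof -
      have p: "prime p" using that by auto
      show ?thesis
        by (rule euler_dvd_types[OF A p_elements_subgroup(1)[OF subgroup_self C p] types[OF p] p_elements_subgroup(1)[OF H CS[OF H] p] _ p_elements_subgroup(1)[OF K CS[OF K] p]])
          (use HK subgroup.subset[OF K] in \<open>auto simp: p_elements_def\<close>)
    qed
    then show "euler H dvd euler K" unfolding main[OF H] main[OF K] by (rule prod_dvd_prod)
  qed
qed

end

theorem theorem1p1:
  fixes G :: "('a, 'b) monoid_scheme"
  assumes "group G" and "finite (carrier G)"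
    and "\<And>S. subgroup S G \<Longrightarrow> \<phi> (G\<lparr>carrier := S\<rparr>) \<noteq> 0"
  shows "(\<forall>H K. subgroup H G \<longrightarrow> subgroup K G \<longrightarrow> H \<subseteq> K \<longrightarrow>
            \<phi> (G\<lparr>carrier := H\<rparr>) dvd \<phi> (G\<lparr>carrier := K\<rparr>))
     \<longleftrightarrow>
         (nilpotent_group G \<and>
          (\<forall>p P. sylow_subgroup G p P \<longrightarrow>
             cyclic_group (G\<lparr>carrier := P\<rparr>) \<or>
             G\<lparr>carrier := P\<rparr> \<cong> Q8 \<or>
             (\<exists>q::nat. Factorial_Ring.prime q \<and>
                G\<lparr>carrier := P\<rparr> \<cong> integer_mod_group q \<times>\<times> integer_mod_group q)))"
    (is "?mono \<longleftrightarrow> nilpotent_group G \<and> (\<forall>p P. sylow_subgroup G p P \<longrightarrow> ?type P)")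
proof -
  interpret finite_group G
    using assms(1,2) by (simp add: finite_group_def finite_group_axioms_def)
  have A: exp_attained
    unfolding exp_attained_def
  proof (intro allI impI)
    fix S assume S: "subgroup S G"
    then have "euler S \<noteq> 0" using assms(3)[OF S] num_exp_elems_sub[OF S] by simp
    then show "\<exists>x\<in>S. ord x = expo S" unfolding euler_def by (metis (mono_tags, lifting) card.empty empty_Collect_eq)
  qed
  have mono: "?mono \<longleftrightarrow> euler_monotone" by (auto simp: euler_monotone_def num_exp_elems_sub)
  have self: "subgroup (carrier G) G" by (rule subgroup_self)
  show ?thesis
  proof
    assume ?mono
    then have D: euler_monotone using mono by blast
    have types: "is_cyclic T \<or> elementary p T \<or> quaternionic T"
      if "prime p" "subgroup T G" "card T = p ^ n" for p T n
      using p_subgroup_types[OF D A that] .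
    have ql: "quaternion_like T" if "quaternionic T" for T
      using that quaternionic_iso_Q8[OF that] iso_Q8_quaternion_like by (auto simp: quaternionic_def)
    have C: "comm_coprime (carrier G)" by (rule comm_coprime_if_types[OF A types self])
    have "nilpotent_group G"
    proof (rule nilpotent_if_types[OF C])
      fix p :: nat assume p: "prime p"
      have P: "subgroup (p_elements p (carrier G)) G" using p_elements_subgroup(1)[OF self C p] .
      consider "is_cyclic (p_elements p (carrier G))" | "elementary p (p_elements p (carrier G))" | "quaternionic (p_elements p (carrier G))"
        using types[OF p P p_elements_subgroup(2)[OF self C p]] by blast
      then show "(\<forall>a\<in>p_elements p (carrier G). \<forall>b\<in>p_elements p (carrier G). a \<otimes>\<^bsub>G\<^esub> b = b \<otimes>\<^bsub>G\<^esub> a) \<or> quaternion_like (p_elements p (carrier G))"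
      proof cases
        case 1
        then obtain a where a: "a \<in> p_elements p (carrier G)" "p_elements p (carrier G) = cyc a" by (auto simp: is_cyclic_def)
        then show ?thesis using cyc_comm[of a] sub_mem[OF P a(1)] by metis
      qed (use elementary_comm ql in blast)+
    qed
    moreover have "?type P" if "sylow_subgroup G p P" for p P
    proof -
      have P: "prime p" "subgroup P G" "card P = p ^ multiplicity p (order G)"
        using that by (auto simp: sylow_subgroup_def)
      consider "is_cyclic P" | "elementary p P" | "quaternionic P" using types[OF P] by blast
      then show ?thesis
      proof cases
        case 1
        then show ?thesis using cyclic_group_sub_iff[OF P(2)] by blast
      next
        case 2
        then show ?thesis using elementary_iso P(1) by blast
      next
        case 3
        then show ?thesis using quaternionic_iso_Q8 by blast
      qed
    qed
    ultimately show "nilpotent_group G \<and> (\<forall>p P. sylow_subgroup G p P \<longrightarrow> ?type P)" by blast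
  next
    assume a: "nilpotent_group G \<and> (\<forall>p P. sylow_subgroup G p P \<longrightarrow> ?type P)"
    then have C: "comm_coprime (carrier G)" using nilpotent_imp_comm_coprime by blast
    have "is_cyclic (p_elements p (carrier G)) \<or> (\<exists>q. elementary q (p_elements p (carrier G))) \<or> quaternion_like (p_elements p (carrier G))"
      if p: "prime p" for p
    proof -
      let ?P = "p_elements p (carrier G)"
      have P: "subgroup ?P G" using p_elements_subgroup(1)[OF self C p] .
      \<comment> \<open>As coprime orders commute, the \<open>p\<close>-elements form a Sylow
        subgroup, so the assumption on types applies to them.\<close>
      have "sylow_subgroup G p ?P"
        using p P p_elements_subgroup(2)[OF self C p] by (simp add: sylow_subgroup_def order_def)
      then have "?type ?P" using a by blast
      then show ?thesis
        using cyclic_group_sub_iff[OF P] iso_Q8_quaternion_like[OF P] iso_elementary[OF P] by blast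
    qed
    then show ?mono using mono euler_monotone_if_types[OF A C] by blast
  qed
qed

end
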